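(* Let $r,s$ be indeterminates, let $K=\mathbb{Q}(r,s)$, and let $$\phi_{r,s}=\frac{2x^2+(2-r)x+(2-r)}{-x^2+(2+r)x+2-r-s}\in K(x).$$ Let $n$ be a positive integer and set $F_n:=U_n(\phi_{r,s})\in\mathbb{Q}(r,s)$, where $U_n$ is defined in the context. Then $F_n$ is a polynomial in $r$ and $s$ with integer coefficients. Moreover, as a subset of $\mathbb{A}^2(\overline{\mathbb{Q}})$, the set $C_n$ is equal to the set of points on the curve $F_n=0$.
   Context: For a field $K$ of characteristic $0$ and a nonconstant $\phi\in K(x)$, the $n$th dynatomic polynomial of $\phi$ is $$\Phi_{n,\phi}=\prod_{d\mid n}(x\,q_d-p_d)^{\mu(n/d)}\in K[x],$$ where $\mu$ is the Möbius function and $\phi^d=p_d/q_d$ (the $d$th iterate) with $p_d,q_d\in K[x]$ coprime. Write the derivative as $\phi'=p/q$ with $p,q\in K[x]$ coprime, and let $\ell$ be the leading coefficient of $\Phi_{n,\phi}$. If $\Phi_{n,\phi}$ has nonzero discriminant and $\infty$ is not $n$-periodic for $\phi$, define $$U_n(\phi):=\frac{\operatorname{Res}(\Phi_{n,\phi},p)}{\operatorname{Res}(\Phi_{n,\phi},q)}\cdot\ell^{\deg(q)-\deg(p)}\in K.$$ For a degree-two $\phi\in\overline{\mathbb{Q}}(x)$, let $[\phi]$ denote its conjugacy class under degree-one elements of $\overline{\mathbb{Q}}(x)$ (acting by $\sigma^{-1}\circ\phi\circ\sigma$), and let $\mathcal{M}_2(\overline{\mathbb{Q}})$ be the set of such classes.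 If $P$ is an $n$-periodic point of $\phi$ (exact period $n$), its multiplier is $(\phi^n)'(P)$ (computed after conjugating if $P=\infty$). There is a bijection $\mathcal{M}_2(\overline{\mathbb{Q}})\to\mathbb{A}^2(\overline{\mathbb{Q}})$, $[\phi]\mapsto(\sigma_1,\sigma_2)$, where $\sigma_i$ is the $i$th elementary symmetric function of the multipliers of the three fixed points of $\phi$ (counted with multiplicity); $\mathcal{M}_2(\overline{\mathbb{Q}})$ is identified with $\mathbb{A}^2(\overline{\mathbb{Q}})$ in this way. $C_n$ is the set of classes $[\phi]$ such that $\phi$ has an $n$-periodic critical point in $\mathbb{P}^1(\overline{\mathbb{Q}})$, viewed as a subset of $\mathbb{A}^2(\overline{\mathbb{Q}})$, with coordinates denoted $(r,s)$. *)

theory Defs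
  imports
    "HOL-Computational_Algebra.Computational_Algebra"
    "HOL-Algebra.Algebraic_Closure_Type"
    "Subresultants.Resultant_Prelim"
begin

text \<open>Throughout, the field \<open>K(x)\<close> of rational functions over a field \<open>K = 'k\<close> is the type
  \<open>'k poly fract\<close>.\<close>

text \<open>An arbitrary choice of coprime \<open>(p, q)\<close> with \<open>\<phi> = p/q\<close>. It is unique up to a common nonzero
  constant factor; apart from the dynatomic polynomial, which inherits such a factor, the notions
  below do not depend on the choice.\<close>

definition rf_quot :: "'k::field poly fract \<Rightarrow> 'k poly \<times> 'k poly" where
  "rf_quot \<phi> = (SOME (p, q). q \<noteq> 0 \<and> coprime p q \<and> \<phi> = Fract p q)"

definition rf_num :: "'k::field poly fract \<Rightarrow> 'k poly" where
  "rf_num \<phi> = fst (rf_quot \<phi>)"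

definition rf_den :: "'k::field poly fract \<Rightarrow> 'k poly" where
  "rf_den \<phi> = snd (rf_quot \<phi>)"

definition rf_degree :: "'k::field poly fract \<Rightarrow> nat" where
  "rf_degree \<phi> = max (degree (rf_num \<phi>)) (degree (rf_den \<phi>))"

definition rf_X :: "'k::field poly fract" where
  "rf_X = to_fract [:0, 1:]"

text \<open>The composition \<open>\<phi> \<circ> \<psi>\<close> is \<open>\<phi>\<close> evaluated at the element \<open>\<psi>\<close> of the extension \<open>K(x)\<close> of \<open>K\<close>
  (meaningful for nonconstant \<open>\<psi>\<close>).\<close>

definition rf_comp :: "'k::field poly fract \<Rightarrow> 'k poly fract \<Rightarrow> 'k poly fract" where
  "rf_comp \<phi> \<psi> =
     poly (map_poly (\<lambda>c. to_fract [:c:]) (rf_num \<phi>)) \<psi> /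
     poly (map_poly (\<lambda>c. to_fract [:c:]) (rf_den \<phi>)) \<psi>"

definition rf_iter :: "nat \<Rightarrow> 'k::field poly fract \<Rightarrow> 'k poly fract" where
  "rf_iter n \<phi> = (rf_comp \<phi> ^^ n) rf_X"

definition rf_deriv :: "'k::field poly fract \<Rightarrow> 'k poly fract" where
  "rf_deriv \<phi> =
     Fract (pderiv (rf_num \<phi>) * rf_den \<phi> - rf_num \<phi> * pderiv (rf_den \<phi>)) ((rf_den \<phi>)\<^sup>2)"

text \<open>The value at a point of \<open>K\<close> that is not a pole.\<close>

definition rf_eval :: "'k::field poly fract \<Rightarrow> 'k \<Rightarrow> 'k" where
  "rf_eval \<phi> a = poly (rf_num \<phi>) a / poly (rf_den \<phi>) a"


datatype 'k proj1 = Fin 'k | Infty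

definition rf_map :: "'k::field poly fract \<Rightarrow> 'k proj1 \<Rightarrow> 'k proj1" where
  "rf_map \<phi> P =
     (let p = rf_num \<phi>; q = rf_den \<phi> in
      case P of
        Fin a \<Rightarrow> if poly q a = 0 then Infty else Fin (poly p a / poly q a)
      | Infty \<Rightarrow> if degree p > degree q then Infty
                 else Fin (coeff p (degree q) / lead_coeff q))"

definition n_periodic :: "nat \<Rightarrow> 'k::field poly fract \<Rightarrow> 'k proj1 \<Rightarrow> bool" where
  "n_periodic n \<phi> P \<longleftrightarrow>
     0 < n \<and> (rf_map \<phi> ^^ n) P = P \<and> (\<forall>m. 0 < m \<and> m < n \<longrightarrow> (rf_map \<phi> ^^ m) P \<noteq> P)"


definition moebius :: "nat \<Rightarrow> int" where
  "moebius n = (if squarefree n then (- 1) ^ card (prime_factors n) else 0)"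

definition dynatomic :: "nat \<Rightarrow> 'k::field poly fract \<Rightarrow> 'k poly" where
  "dynatomic n \<phi> =
     (THE f. to_fract f =
        (\<Prod>d | d dvd n.
           to_fract ([:0, 1:] * rf_den (rf_iter d \<phi>) - rf_num (rf_iter d \<phi>))
             powi moebius (n div d)))"

definition poly_discriminant :: "'k::field poly \<Rightarrow> 'k" where
  "poly_discriminant f =
     (- 1) ^ (degree f * (degree f - 1) div 2) * resultant f (pderiv f) / lead_coeff f"

text \<open>The conditions under which \<open>U\<^sub>n(\<phi>)\<close> is defined; \<open>U\<close> itself is the bare formula.\<close>

definition U_defined :: "nat \<Rightarrow> 'k::field poly fract \<Rightarrow> bool" where
  "U_defined n \<phi> \<longleftrightarrow> poly_discriminant (dynatomic n \<phi>) \<noteq> 0 \<and> \<not> n_periodic n \<phi> Infty"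

definition U :: "nat \<Rightarrow> 'k::field poly fract \<Rightarrow> 'k" where
  "U n \<phi> =
     (let f = dynatomic n \<phi>; p = rf_num (rf_deriv \<phi>); q = rf_den (rf_deriv \<phi>) in
      resultant f p / resultant f q * lead_coeff f powi (int (degree q) - int (degree p)))"


text \<open>\<open>\<tau>\<close> is the compositional inverse of \<open>\<sigma>\<close>.\<close>

definition conjugate :: "'k::field poly fract \<Rightarrow> 'k poly fract \<Rightarrow> bool" where
  "conjugate \<phi> \<psi> \<longleftrightarrow>
     (\<exists>\<sigma> \<tau>. rf_degree \<sigma> = 1 \<and> rf_degree \<tau> = 1 \<and>
        rf_comp \<sigma> \<tau> = rf_X \<and> rf_comp \<tau> \<sigma> = rf_X \<and> \<psi> = rf_comp \<tau> (rf_comp \<phi> \<sigma>))"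

definition conj_class :: "'k::field poly fract \<Rightarrow> 'k poly fract set" where
  "conj_class \<phi> = {\<psi>. conjugate \<phi> \<psi>}"

text \<open>The conjugate by \<open>\<sigma> = 1/x\<close>, which moves \<open>\<infinity>\<close> to \<open>0\<close>.\<close>

definition flip_conj :: "'k::field poly fract \<Rightarrow> 'k poly fract" where
  "flip_conj \<phi> = rf_comp (inverse rf_X) (rf_comp \<phi> (inverse rf_X))"

text \<open>The multiplier at an \<open>n\<close>-periodic point.\<close>

definition multiplier :: "nat \<Rightarrow> 'k::field poly fract \<Rightarrow> 'k proj1 \<Rightarrow> 'k" where
  "multiplier n \<phi> P =
     (case P of
        Fin a \<Rightarrow> rf_eval (rf_deriv (rf_iter n \<phi>)) a
      | Infty \<Rightarrow> rf_eval (rf_deriv (rf_iter n (flip_conj \<phi>))) 0)"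

text \<open>The multiplicity of a point as a fixed point (\<open>0\<close> if it is not fixed).\<close>

definition fixed_mult :: "'k::field poly fract \<Rightarrow> 'k proj1 \<Rightarrow> nat" where
  "fixed_mult \<phi> P =
     (case P of
        Fin a \<Rightarrow> Polynomial.order a ([:0, 1:] * rf_den \<phi> - rf_num \<phi>)
      | Infty \<Rightarrow> Polynomial.order 0 ([:0, 1:] * rf_den (flip_conj \<phi>) - rf_num (flip_conj \<phi>)))"

text \<open>The \<open>i\<close>th elementary symmetric function of the multipliers of the fixed points; the index set
  contains \<open>m\<close> labelled copies of a fixed point of multiplicity \<open>m\<close>.\<close>

definition multiplier_esym :: "nat \<Rightarrow> 'k::field poly fract \<Rightarrow> 'k" where
  "multiplier_esym i \<phi> =
     (\<Sum>A | A \<subseteq> (SIGMA P : UNIV. {..<fixed_mult \<phi> P}) \<and> finite A \<and> card A = i.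
        \<Prod>(P, j)\<in>A. multiplier 1 \<phi> P)"

text \<open>The coordinates \<open>(\<sigma>\<^sub>1, \<sigma>\<^sub>2)\<close> of a conjugacy class of degree-two maps: the common value on all
  members of the class.\<close>

definition moduli_coords :: "'k::field poly fract set \<Rightarrow> 'k \<times> 'k" where
  "moduli_coords c = the_elem ((\<lambda>\<phi>. (multiplier_esym 1 \<phi>, multiplier_esym 2 \<phi>)) ` c)"

text \<open>Critical points in \<open>\<bbbP>\<^sup>1\<close>: vanishing of the derivative in local coordinates, where \<open>1/x\<close> is the
  coordinate at \<open>\<infinity>\<close> both in the source and in the target.\<close>

definition critical_point :: "'k::field poly fract \<Rightarrow> 'k proj1 \<Rightarrow> bool" where
  "critical_point \<phi> P \<longleftrightarrow>
     (let (\<psi>, a) = (case P of Fin a \<Rightarrow> (\<phi>, a) | Infty \<Rightarrow> (rf_comp \<phi> (inverse rf_X), 0));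
          \<chi> = (if rf_map \<phi> P = Infty then inverse \<psi> else \<psi>)
      in rf_eval (rf_deriv \<chi>) a = 0)"

definition M2 :: "'k::field poly fract set set" where
  "M2 = conj_class ` {\<phi>. rf_degree \<phi> = 2}"

definition C :: "nat \<Rightarrow> (rat alg_closure) poly fract set set" where
  "C n = {c \<in> M2. \<exists>\<phi>. rf_degree \<phi> = 2 \<and> c = conj_class \<phi> \<and>
                       (\<exists>P. critical_point \<phi> P \<and> n_periodic n \<phi> P)}"


text \<open>\<open>\<rat>(r, s)\<close> is the fraction field of \<open>\<rat>[r][s]\<close>.\<close>

type_synonym rat_rs = "rat poly poly fract"

definition r_var :: rat_rs where "r_var = to_fract [:[:0, 1:]:]"

definition s_var :: rat_rs where "s_var = to_fract [:0, 1:]"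

definition phi_rs :: "rat_rs poly fract" where
  "phi_rs = Fract [:2 - r_var, 2 - r_var, 2:] [:2 - r_var - s_var, 2 + r_var, - 1:]"

text \<open>The value \<open>F(a, b)\<close> of a polynomial \<open>F \<in> \<int>[r][s]\<close>: the inner variable is \<open>r\<close>.\<close>

definition eval2 :: "int poly poly \<Rightarrow> 'a::comm_ring_1 \<Rightarrow> 'a \<Rightarrow> 'a" where
  "eval2 F a b = poly (map_poly (\<lambda>f. poly (map_poly of_int f) a) F) b"

end

theory Submission
  imports Defs "Subresultants.Subresultant"
begin

text \<open>
  Over an algebraically closed field of characteristic \<open>0\<close> every quadratic map is conjugate to a
  normal form \<open>(x\<^sup>2 + u x + 1) / (b x)\<close>, whose critical points are \<open>\<plusminus>1\<close> and whose fixed point \<open>\<infinity>\<close> has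
  multiplier \<open>b\<close>. Let \<open>a\<^sub>d(b, u) \<in> \<int>[b, u]\<close> be the difference of the homogeneous coordinates of the \<open>d\<close>th
  iterate of \<open>1\<close>. Since \<open>1\<close> is critical, the sequence \<open>a\<^sub>d\<close> is rigidly divisible: the multiplicity of a
  prime in \<open>a\<^sub>d\<close> is constant on the multiples of its rank of apparition and \<open>0\<close> elsewhere. Hence
  \<open>A = \<Prod>\<^bsub>d | n\<^esub> a\<^sub>d ^ \<mu> (n / d)\<close> is a polynomial, and \<open>A(b, u) = 0\<close> if and only if \<open>1\<close> has exact period \<open>n\<close>.
  The same lemma, applied to \<open>x q\<^sub>d - p\<^sub>d\<close>, yields the dynatomic polynomial; these polynomials are squarefree
  because they are so after specialisation to a Chebyshev map.

  By Poisson's formula \<open>U\<^sub>n(\<phi>)\<close> is the product of the multiplier factors \<open>\<phi>'(z)\<close> over the roots \<open>z\<close> of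
  the dynatomic polynomial. Conjugating \<open>\<phi>\<^bsub>r,s\<^esub>\<close> to the normal form, where \<open>b\<close> is a root of
  \<open>\<chi> = T\<^sup>3 - r T\<^sup>2 + s T - (r - 2)\<close>, evaluates it as \<open>A(b, u) A(b, -u)\<close> up to a power of \<open>b\<close>. As this
  holds for every root of \<open>\<chi>\<close>, \<open>U\<^sub>n\<close> descends to \<open>\<int>[r, s]\<close>, and the identity specialises to all \<open>(r, s)\<close>.
\<close>

subsection \<open>Fraction fields as Euclidean rings\<close>

text \<open>Up to sign the coefficients of \<open>chi\<close> are the elementary symmetric functions
  of the three fixed-point multipliers, whose product is their sum minus 2; \<open>phi_rs\<close> is
  built so that every root b of \<open>chi\<close> is itself a fixed point, of multiplier b. Given r
  and b, the parameter u is known only through \<open>u\<^sup>2 = 4 - 2 * b - (r - b) * b\<close>.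
  The sign of u is changed by x \<mapsto> -x, which swaps the critical points, so only the product
  over both critical points can descend. Two obstacles shape the argument. At some points the
  specialised \<open>phi_rs\<close> is useless: if u = 0, its resultant vanishes and the degree
  drops. Hence U is compared with A only generically, and what gets specialised is the identity F
  b^k = A(b, u) A(b, -u) b^k', whose right side describes the normal form at every point with b
  \<noteq> 0. Moreover b is not a unit over \<int>[r, s], its norm being r - 2, so its power cannot
  simply be divided out; that U has no denominator comes from the fact that no prime divides both r
  and s.\<close>

instantiation fract :: (idom)
  "{unique_euclidean_ring, normalization_euclidean_semiring, normalization_semidom_multiplicative}"
begin

definition [simp]: "normalize_fract = (normalize_field :: 'a fract \<Rightarrow> _)"
definition [simp]: "unit_factor_fract = (unit_factor_field :: 'a fract \<Rightarrow> _)"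
definition [simp]: "modulo_fract = (mod_field :: 'a fract \<Rightarrow> _)"
definition [simp]: "euclidean_size_fract = (euclidean_size_field :: 'a fract \<Rightarrow> _)"
definition [simp]: "division_segment (x :: 'a fract) = 1"

instance
  by standard (simp_all add: dvd_field_iff field_split_simps split: if_splits)

end

instantiation fract :: (idom) euclidean_ring_gcd
begin

definition gcd_fract :: "'a fract \<Rightarrow> 'a fract \<Rightarrow> 'a fract" where
  "gcd_fract = Euclidean_Algorithm.gcd"
definition lcm_fract :: "'a fract \<Rightarrow> 'a fract \<Rightarrow> 'a fract" where
  "lcm_fract = Euclidean_Algorithm.lcm"
definition Gcd_fract :: "'a fract set \<Rightarrow> 'a fract" where
  "Gcd_fract = Euclidean_Algorithm.Gcd"
definition Lcm_fract :: "'a fract set \<Rightarrow> 'a fract" where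
  "Lcm_fract = Euclidean_Algorithm.Lcm"

instance
  by standard (simp_all add: gcd_fract_def lcm_fract_def Gcd_fract_def Lcm_fract_def)

end

text \<open>The point is polynomials over these fields: they now have a gcd, hence reduced fractions
  and Bezout coefficients.\<close>

instance fract :: (idom) field_gcd ..
instance alg_closure :: (field) field_gcd ..

subsection \<open>Resultants\<close>

lemma alg_closed_proots_factor:
  fixes p :: "'a :: alg_closed_field poly"
  assumes "p \<noteq> 0"
  shows "p = smult (lead_coeff p) (\<Prod>x\<in>#proots p. [:-x, 1:])" "size (proots p) = degree p"
proof -
  obtain A where A: "size A = degree p" "p = smult (lead_coeff p) (\<Prod>x\<in>#A. [:-x, 1:])"
    using alg_closed_imp_factorization[OF assms] by blast
  have "proots p = proots (\<Prod>x\<in>#A. [:-x, 1:])"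
    by (subst A(2)) (use assms in simp)
  also have "\<dots> = (\<Sum>p\<in>#image_mset (\<lambda>x. [:-x, 1:]) A. proots p)"
    using proots_prod_mset[of "image_mset (\<lambda>x. [:-x, 1:]) A"] by (auto simp: image_iff)
  also have "\<dots> = A"
  proof (induction A)
    case (add x A)
    have "proots [:-x, 1:] = {#x#}" using proots_linear_factor[of "- x"] by simp
    with add show ?case by (simp del: proots_linear_factor)
  qed auto
  finally have "proots p = A" .
  with A show "p = smult (lead_coeff p) (\<Prod>x\<in>#proots p. [:-x, 1:])" "size (proots p) = degree p"
    by auto
qed

lemma poly_alg_closed_eq_prod:
  fixes p :: "'a :: alg_closed_field poly"
  assumes "p \<noteq> 0"
  shows "poly p x = lead_coeff p * (\<Prod>a\<in>#proots p. x - a)"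
proof -
  have "poly (\<Prod>a\<in>#A. [:-a, 1:]) x = (\<Prod>a\<in>#A. x - a)" for A :: "'a multiset"
    by (induction A) (auto simp: algebra_simps)
  thus ?thesis
    by (subst alg_closed_proots_factor(1)[OF assms]) simp
qed

lemma prod_mset_poly_const: "(\<Prod>x\<in>#A. poly [:c:] x) = (c :: 'a :: comm_ring_1) ^ size A"
  by (induction A) auto

lemma prod_mset_const_mult:
  "(\<Prod>x\<in>#A. c * f x) = c ^ size A * (\<Prod>x\<in>#A. f x :: 'a :: comm_monoid_mult)"
  by (induction A) (auto simp: mult_ac)

lemma prod_mset_diff_swap:
  fixes A B :: "'a :: comm_ring_1 multiset"
  shows "(\<Prod>x\<in>#A. \<Prod>y\<in>#B. x - y) = (-1) ^ (size A * size B) * (\<Prod>y\<in>#B. \<Prod>x\<in>#A. y - x)"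
proof (induction A)
  case (add a A)
  have "(\<Prod>y\<in>#B. a - y) = (\<Prod>y\<in>#B. (-1) * (y - a))" by simp
  also have "\<dots> = (-1) ^ size B * (\<Prod>y\<in>#B. y - a)"
    by (rule prod_mset_const_mult)
  finally show ?case using add
    by (simp add: power_add mult_ac prod_mset.distrib)
qed auto

text \<open>Both sides are the product of all differences of a root of f and a root of g, with the
  same powers of leading coefficients; exchanging the roles costs one sign per pair.\<close>

lemma poisson_swap:
  fixes f g :: "'a :: alg_closed_field poly"
  assumes "f \<noteq> 0" "g \<noteq> 0"
  shows "lead_coeff f ^ degree g * (\<Prod>x\<in>#proots f. poly g x) =
    (-1) ^ (degree f * degree g) * (lead_coeff g ^ degree f * (\<Prod>x\<in>#proots g. poly f x))"
proof -
  have "(\<Prod>x\<in>#proots f. poly g x) = (\<Prod>x\<in>#proots f. lead_coeff g * (\<Prod>a\<in>#proots g. x - a))"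
    by (simp only: poly_alg_closed_eq_prod[OF assms(2)])
  moreover have "(\<Prod>x\<in>#proots g. poly f x) = (\<Prod>x\<in>#proots g. lead_coeff f * (\<Prod>a\<in>#proots f. x - a))"
    by (simp only: poly_alg_closed_eq_prod[OF assms(1)])
  ultimately show ?thesis
    using prod_mset_diff_swap[of "proots f" "proots g"] assms
    by (simp add: prod_mset_const_mult alg_closed_proots_factor(2) mult_ac)
qed

text \<open>The Euclidean step, read off from the theory of subresultants at index 0. A constant
  remainder is the boundary case in which the index equals the degree of the remainder and the
  subresultant is a multiple of the remainder itself.\<close>

lemma resultant_rec:
  fixes f g :: "'a :: field poly"
  assumes "degree f \<ge> degree g" "degree g > 0" "f mod g \<noteq> 0"
  shows "resultant f g =
    (-1) ^ (degree f * degree g) * lead_coeff g ^ (degree f - degree (f mod g)) * resultant g (f mod g)"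
proof -
  have eq: "f + (- (f div g)) * g = f mod g"
    by (simp add: minus_div_mult_eq_mod [symmetric])
  have lt: "degree (f mod g) < degree g"
    using assms by (metis degree_0 degree_mod_less' less_numeral_extra(3))
  show ?thesis
  proof (cases "degree (f mod g) = 0")
    case False
    have "subresultant 0 f g = smult ((-1)^((degree f - 0) * (degree g - 0)) *
        lead_coeff g ^ (degree f - degree (f mod g))) (subresultant 0 g (f mod g))"
      by (rule BT_lemma_1_12[OF eq assms(1)]) (use lt False in auto)
    thus ?thesis by (simp add: subresultant_resultant)
  next
    case True
    then obtain c where c: "f mod g = [:c:]" by (metis degree_eq_zeroE)
    have "subresultant (degree (f mod g)) f g = smult ((-1)^((degree f - degree (f mod g)) * (degree g - degree (f mod g))) *
        lead_coeff g ^ (degree f - degree (f mod g)) * lead_coeff (f mod g) ^ (degree g - degree (f mod g) - 1)) (f mod g)"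
      by (rule BT_lemma_1_13'[OF eq assms(1)]) (use lt True in auto)
    hence "resultant f g = (-1)^(degree f * degree g) * lead_coeff g ^ degree f * (c ^ (degree g - 1) * c)"
      by (simp add: subresultant_resultant True c)
    also have "c ^ (degree g - 1) * c = c ^ degree g"
      using assms(2) by (metis Suc_pred' mult.commute power_Suc)
    also have "c ^ degree g = resultant g (f mod g)"
      using resultant_swap[of g "[:c:]"] by (simp add: c)
    finally show ?thesis using True by simp
  qed
qed

lemma resultant_dvd_0:
  fixes f g :: "'a :: field poly"
  assumes "degree f \<ge> degree g" "degree g > 0" "f mod g = 0" "f \<noteq> 0"
  shows "resultant f g = 0"
proof -
  have eq: "f + (- (f div g)) * g = f mod g"
    by (simp add: minus_div_mult_eq_mod [symmetric])
  have "subresultant (degree (f mod g)) f g = smult ((-1)^((degree f - degree (f mod g)) * (degree g - degree (f mod g))) *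
        lead_coeff g ^ (degree f - degree (f mod g)) * lead_coeff (f mod g) ^ (degree g - degree (f mod g) - 1)) (f mod g)"
    by (rule BT_lemma_1_13'[OF eq assms(1)]) (use assms in auto)
  thus ?thesis using assms by (simp add: subresultant_resultant)
qed

text \<open>Induction along the Euclidean algorithm: f and f mod g agree at the roots of g, so the
  product over these roots does not change, and \<open>poisson_swap\<close> moves between the roots
  of f and those of g.\<close>

lemma resultant_poisson:
  fixes f g :: "'a :: alg_closed_field poly"
  assumes "f \<noteq> 0" "g \<noteq> 0"
  shows "resultant f g = lead_coeff f ^ degree g * (\<Prod>x\<in>#proots f. poly g x)"
  using assms
proof (induction "degree g" arbitrary: f g rule: less_induct)
  case less
  note f0 = less.prems(1) and g0 = less.prems(2)
  show ?case
  proof (cases "degree g = 0")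
    case True
    then obtain c where c: "g = [:c:]" by (metis degree_eq_zeroE)
    have "(\<Prod>x\<in>#proots f. poly g x) = c ^ size (proots f)"
      unfolding c by (rule prod_mset_poly_const)
    moreover have "resultant f g = c ^ degree f" using resultant_swap[of f g] by (simp add: c)
    ultimately show ?thesis using alg_closed_proots_factor(2)[OF f0] True by simp
  next
    case dg: False
    show ?thesis
    proof (cases "degree f < degree g")
      case True
      have "resultant f g = (-1) ^ (degree f * degree g) * resultant g f"
        by (rule resultant_swap)
      also have "resultant g f = lead_coeff g ^ degree f * (\<Prod>x\<in>#proots g. poly f x)"
        by (rule less.hyps[OF True g0 f0])
      finally show ?thesis using poisson_swap[OF f0 g0] by simp
    next
      case False
      hence le: "degree f \<ge> degree g" by simp
      have "poly (f mod g) x = poly f x" if "poly g x = 0" for x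
        by (metis that add_0 div_mult_mod_eq mult_zero_right poly_add poly_mult)
      hence mod_eq: "(\<Prod>x\<in>#proots g. poly (f mod g) x) = (\<Prod>x\<in>#proots g. poly f x)"
        using g0 by (intro arg_cong[of _ _ prod_mset] image_mset_cong) auto
      show ?thesis
      proof (cases "f mod g = 0")
        case True
        have "proots g \<noteq> {#}" using dg alg_closed_proots_factor(2)[OF g0] by auto
        hence "(\<Prod>x\<in>#proots g. poly (f mod g) x) = 0" unfolding True by (cases "proots g") auto
        hence "(\<Prod>x\<in>#proots g. poly f x) = 0" using mod_eq by simp
        thus ?thesis using poisson_swap[OF f0 g0] resultant_dvd_0[OF le _ True f0] dg by simp
      next
        case m0: False
        have lt: "degree (f mod g) < degree g"
          using dg g0 by (metis degree_0 degree_mod_less' not_gr0)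
        have "resultant f g =
    (-1) ^ (degree f * degree g) * lead_coeff g ^ (degree f - degree (f mod g)) * resultant g (f mod g)"
          by (rule resultant_rec[OF le _ m0]) (use dg in auto)
        also have "resultant g (f mod g) = lead_coeff g ^ degree (f mod g) * (\<Prod>x\<in>#proots g. poly (f mod g) x)"
          by (rule less.hyps[OF lt g0 m0])
        finally have "resultant f g = (-1) ^ (degree f * degree g) *
           (lead_coeff g ^ (degree f - degree (f mod g) + degree (f mod g)) * (\<Prod>x\<in>#proots g. poly f x))"
          by (simp add: mod_eq power_add mult_ac)
        also have "degree f - degree (f mod g) + degree (f mod g) = degree f"
          using lt le by simp
        finally show ?thesis using poisson_swap[OF f0 g0] by simp
      qed
    qed
  qed
qed

lemma resultant_eq_0_iff_common_root:
  fixes f g :: "'a :: alg_closed_field poly"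
  assumes "f \<noteq> 0" "g \<noteq> 0"
  shows "resultant f g = 0 \<longleftrightarrow> (\<exists>x. poly f x = 0 \<and> poly g x = 0)"
  using assms by (auto simp: resultant_poisson prod_mset_zero_iff)

subsection \<open>Moebius inversion and rigid divisibility\<close>

lemma moebius_1: "moebius 1 = 1"
  by (simp add: moebius_def)

lemma moebius_cases: "moebius n = 1 \<or> moebius n = -1 \<or> moebius n = 0"
  by (auto simp: moebius_def minus_one_power_iff)

lemma moebius_prime_mult:
  assumes "prime p" "\<not> p dvd d" "d > 0"
  shows "moebius (p * d) = - moebius d"
proof -
  have cop: "coprime p d" using assms by (simp add: prime_imp_coprime)
  have "squarefree (p * d) \<longleftrightarrow> squarefree d"
    using squarefree_mult_coprime[OF cop squarefree_prime[OF assms(1)]] squarefree_multD(2)[of p d] by blast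
  moreover have "prime_factors (p * d) = insert p (prime_factors d)"
    using assms by (subst prime_factors_product) (auto simp: prime_prime_factors)
  moreover have "p \<notin> prime_factors d" using assms by auto
  ultimately show ?thesis by (auto simp: moebius_def)
qed

text \<open>Only squarefree divisors count; those not divisible by a fixed prime p of k cancel
  against their multiples by p.\<close>

lemma sum_moebius_divisors:
  assumes "k > 0"
  shows "(\<Sum>d | d dvd k. moebius d) = (if k = 1 then 1 else 0)"
proof (cases "k = 1")
  case True
  thus ?thesis by (simp add: moebius_1[unfolded One_nat_def])
next
  case False
  then obtain p where p: "prime p" "p dvd k" using prime_factor_nat by blast
  define S where "S = {d. d dvd k \<and> squarefree d}"
  define S0 where "S0 = {d\<in>S. \<not> p dvd d}"
  have fin: "finite {d. d dvd k}" using assms by (simp add: finite_divisors_nat)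
  have finS: "finite S" unfolding S_def by (rule finite_subset[OF _ fin]) auto
  have "(\<Sum>d | d dvd k. moebius d) = (\<Sum>d\<in>S. moebius d)"
    by (rule sum.mono_neutral_right[OF fin]) (auto simp: S_def moebius_def)
  also have "S = S0 \<union> (*) p ` S0"
  proof (intro equalityI subsetI)
    fix d assume d: "d \<in> S"
    show "d \<in> S0 \<union> (*) p ` S0"
    proof (cases "p dvd d")
      case True
      then obtain e where e: "d = p * e" by blast
      have "\<not> p dvd e"
      proof
        assume "p dvd e"
        hence "p\<^sup>2 dvd d" by (auto simp: e power2_eq_square)
        with d have "is_unit p" unfolding S_def squarefree_def by blast
        with p(1) show False by auto
      qed
      moreover have "e \<in> S" using d unfolding S_def e
        by (auto intro: squarefree_multD(2) dvd_mult_right)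
      ultimately show ?thesis by (auto simp: S0_def e)
    qed (use d in \<open>auto simp: S0_def\<close>)
  next
    fix d assume "d \<in> S0 \<union> (*) p ` S0"
    thus "d \<in> S"
    proof
      assume "d \<in> (*) p ` S0"
      then obtain e where e: "d = p * e" "e dvd k" "squarefree e" "\<not> p dvd e"
        by (auto simp: S0_def S_def)
      have "coprime p e" using e p by (simp add: prime_imp_coprime)
      moreover have "squarefree p" using p by (simp add: squarefree_prime)
      ultimately show "d \<in> S" using e p unfolding S_def
        by (auto intro!: divides_mult squarefree_mult_coprime)
    qed (auto simp: S0_def)
  qed
  also have "(\<Sum>d\<in>S0 \<union> (*) p ` S0. moebius d) = (\<Sum>d\<in>S0. moebius d) + (\<Sum>d\<in>(*) p ` S0. moebius d)"
    by (rule sum.union_disjoint) (use finS in \<open>auto simp: S0_def\<close>)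
  also have "(\<Sum>d\<in>(*) p ` S0. moebius d) = (\<Sum>d\<in>S0. moebius (p * d))"
    by (rule sum.reindex_cong[where l = "(*) p"]) (use p in \<open>auto simp: inj_on_def\<close>)
  also have "\<dots> = (\<Sum>d\<in>S0. - moebius d)"
    by (intro sum.cong refl moebius_prime_mult p)
      (use assms in \<open>auto simp: S0_def S_def intro: dvd_pos_nat\<close>)
  finally show ?thesis using False by (simp add: sum_negf)
qed

text \<open>Substituting e = n / d leads to the divisors of n / m. In this dual form of inversion,
  an exponent that is constant on the multiples of m and 0 elsewhere contributes to the quotient at
  n only if n = m.\<close>

lemma sum_moebius_multiples:
  assumes "n > 0"
  shows "(\<Sum>d | d dvd n. if m dvd d then moebius (n div d) else 0) = (if m = n then 1 else 0)"
proof -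
  have fin: "finite {d. d dvd n}" using assms by (simp add: finite_divisors_nat)
  have "(\<Sum>d | d dvd n. if m dvd d then moebius (n div d) else 0) =
        (\<Sum>d | d dvd n \<and> m dvd d. moebius (n div d))"
    by (rule sum.mono_neutral_cong_right) (use fin in auto)
  also have "\<dots> = (if m = n then 1 else 0)"
  proof (cases "m dvd n")
    case True
    have m: "m > 0" using True assms by (auto intro!: Nat.gr0I)
    have "(\<Sum>d | d dvd n \<and> m dvd d. moebius (n div d)) = (\<Sum>e | e dvd n div m. moebius e)"
    proof (rule sum.reindex_bij_witness[where i = "\<lambda>e. n div e" and j = "\<lambda>d. n div d"])
      fix d assume d: "d \<in> {d. d dvd n \<and> m dvd d}"
      thus "n div (n div d) = d" using assms
        by (auto elim!: dvdE)
      show "n div d \<in> {e. e dvd n div m}" using d assms m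
        by (auto elim!: dvdE)
    next
      fix e assume e: "e \<in> {e. e dvd n div m}"
      then obtain k where k: "n div m = e * k" by blast
      hence n: "n = m * (e * k)" using True by (metis dvd_mult_div_cancel)
      have "e > 0" using n assms by (auto intro!: Nat.gr0I)
      thus "n div (n div e) = e" "n div e \<in> {d. d dvd n \<and> m dvd d}" using n assms
        by (auto simp: mult_ac)
    qed auto
    also have "\<dots> = (if n div m = 1 then 1 else 0)"
      by (rule sum_moebius_divisors) (use True assms m in \<open>auto elim!: dvdE\<close>)
    also have "n div m = 1 \<longleftrightarrow> m = n" using True m assms
      by (auto elim!: dvdE)
    finally show ?thesis by simp
  next
    case False
    hence "{d. d dvd n \<and> m dvd d} = {}" using dvd_trans by blast
    with False show ?thesis by (metis dvd_refl sum.empty)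
  qed
  finally show ?thesis .
qed

text \<open>Numerator and denominator of \<open>\<Prod>\<^bsub>d | n\<^esub> f d ^ \<mu> (n / d)\<close>.\<close>

definition mob_pos :: "nat \<Rightarrow> (nat \<Rightarrow> 'a :: comm_monoid_mult) \<Rightarrow> 'a" where
  "mob_pos n f = (\<Prod>d | d dvd n \<and> moebius (n div d) = 1. f d)"

definition mob_neg :: "nat \<Rightarrow> (nat \<Rightarrow> 'a :: comm_monoid_mult) \<Rightarrow> 'a" where
  "mob_neg n f = (\<Prod>d | d dvd n \<and> moebius (n div d) = -1. f d)"

lemma mob_mult:
  "mob_pos n (\<lambda>d. f d * g d) = mob_pos n f * mob_pos n g"
  "mob_neg n (\<lambda>d. f d * g d) = mob_neg n f * mob_neg n g"
  by (simp_all add: mob_pos_def mob_neg_def prod.distrib)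

lemma mob_cong:
  assumes "\<And>d. d > 0 \<Longrightarrow> f d = g d" "n > 0"
  shows "mob_pos n f = mob_pos n g" "mob_neg n f = mob_neg n g"
  unfolding mob_pos_def mob_neg_def
  by (intro prod.cong refl assms(1); use assms(2) in \<open>auto intro: dvd_pos_nat\<close>)+

lemma mob_nonzero:
  fixes f :: "nat \<Rightarrow> 'a :: idom"
  assumes "\<And>d. d > 0 \<Longrightarrow> f d \<noteq> 0" "n > 0"
  shows "mob_pos n f \<noteq> 0" "mob_neg n f \<noteq> 0"
  unfolding mob_pos_def mob_neg_def
  using assms by (auto simp: prod_zero_iff finite_divisors_nat intro: dvd_pos_nat)

lemma prod_powi_moebius:
  fixes f :: "nat \<Rightarrow> 'a :: field"
  assumes "n > 0" "\<And>d. d > 0 \<Longrightarrow> f d \<noteq> 0"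
  shows "(\<Prod>d | d dvd n. f d powi moebius (n div d)) * mob_neg n f = mob_pos n f"
proof -
  have fin: "finite {d. d dvd n}" using assms by (simp add: finite_divisors_nat)
  have neg: "mob_neg n f = (\<Prod>d | d dvd n. if moebius (n div d) = -1 then f d else 1)"
    unfolding mob_neg_def by (subst prod.inter_filter[symmetric]) (use fin in \<open>auto intro!: prod.cong\<close>)
  have pos: "mob_pos n f = (\<Prod>d | d dvd n. if moebius (n div d) = 1 then f d else 1)"
    unfolding mob_pos_def by (subst prod.inter_filter[symmetric]) (use fin in \<open>auto intro!: prod.cong\<close>)
  show ?thesis unfolding neg pos prod.distrib[symmetric]
  proof (intro prod.cong refl)
    fix d assume "d \<in> {d. d dvd n}"
    hence "f d \<noteq> 0" using assms by (auto intro: dvd_pos_nat)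
    thus "f d powi moebius (n div d) * (if moebius (n div d) = - 1 then f d else 1) =
         (if moebius (n div d) = 1 then f d else 1)"
      using moebius_cases[of "n div d"] by (auto simp: power_int_minus)
  qed
qed

text \<open>\<open>rigid_at p f m e\<close>: \<open>m\<close> is the rank of apparition of the prime \<open>p\<close> in the sequence \<open>f\<close>, and
  \<open>e\<close> is the common multiplicity.\<close>

definition rigid_at :: "'a :: factorial_semiring \<Rightarrow> (nat \<Rightarrow> 'a) \<Rightarrow> nat \<Rightarrow> nat \<Rightarrow> bool" where
  "rigid_at p f m e \<longleftrightarrow> (\<forall>d>0. multiplicity p (f d) = (if m dvd d then e else 0))"

text \<open>Induction on the index, subtracting m. By induction the multiplicity at j is 0 or the
  one at m, hence below twice the latter, so the shift hypothesis always applies. The factor 2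
  reflects the second-order error of a critical orbit.\<close>

lemma rigid_atI:
  fixes f :: "nat \<Rightarrow> 'a :: factorial_semiring"
  assumes p: "prime_elem p" and f: "\<And>d. d > 0 \<Longrightarrow> f d \<noteq> 0"
  assumes shift: "\<And>m j. m > 0 \<Longrightarrow> j > 0 \<Longrightarrow> p dvd f m \<Longrightarrow>
      multiplicity p (f j) < 2 * multiplicity p (f m) \<Longrightarrow> multiplicity p (f (m + j)) = multiplicity p (f j)"
  assumes m: "m > 0" "p dvd f m" "\<And>d. 0 < d \<Longrightarrow> d < m \<Longrightarrow> \<not> p dvd f d"
  shows "rigid_at p f m (multiplicity p (f m))" "multiplicity p (f m) > 0"
proof -
  have mult: "multiplicity p (f d) > 0 \<longleftrightarrow> p dvd f d" if "d > 0" for d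
    using prime_multiplicity_gt_zero_iff[OF p f[OF that]] .
  show e: "multiplicity p (f m) > 0" using mult m by auto
  have "multiplicity p (f d) = (if m dvd d then multiplicity p (f m) else 0)" if "d > 0" for d
    using that
  proof (induction d rule: less_induct)
    case (less d)
    consider "d < m" | "d = m" | "d > m" by linarith
    thus ?case
    proof cases
      case 1
      hence "\<not> m dvd d" using less.prems by (auto dest: dvd_imp_le)
      moreover have "\<not> p dvd f d" using 1 less.prems m(3) by blast
      ultimately show ?thesis using mult[OF less.prems] by simp
    next
      case 3
      define j where "j = d - m"
      have j: "d = m + j" "j > 0" "j < d" using 3 m by (auto simp: j_def)
      have IH: "multiplicity p (f j) = (if m dvd j then multiplicity p (f m) else 0)"
        by (rule less.IH) (use j in auto)
      have "multiplicity p (f (m + j)) = multiplicity p (f j)"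
        by (rule shift) (use IH m j e in auto)
      thus ?thesis using IH j by simp
    qed auto
  qed
  thus "rigid_at p f m (multiplicity p (f m))" unfolding rigid_at_def by blast
qed

lemma rigid_at_ex:
  fixes f :: "nat \<Rightarrow> 'a :: factorial_semiring"
  assumes p: "prime_elem p" and f: "\<And>d. d > 0 \<Longrightarrow> f d \<noteq> 0"
  assumes shift: "\<And>m j. m > 0 \<Longrightarrow> j > 0 \<Longrightarrow> p dvd f m \<Longrightarrow>
      multiplicity p (f j) < 2 * multiplicity p (f m) \<Longrightarrow> multiplicity p (f (m + j)) = multiplicity p (f j)"
  shows "\<exists>m e. rigid_at p f m e"
proof (cases "\<exists>d>0. p dvd f d")
  case True
  define m where "m = (LEAST d. d > 0 \<and> p dvd f d)"
  have "m > 0 \<and> p dvd f m" unfolding m_def using True by (rule LeastI_ex)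
  moreover have "\<not> p dvd f d" if "0 < d" "d < m" for d
    using not_less_Least[of d "\<lambda>d. d > 0 \<and> p dvd f d"] that by (auto simp: m_def)
  ultimately show ?thesis using rigid_atI(1)[OF p f shift] by blast
next
  case False
  have "multiplicity p (f d) = 0" if "d > 0" for d
    by (rule not_dvd_imp_multiplicity_0) (use that False in blast)
  \<comment> \<open>A prime that divides no term gets rank 1 and multiplicity 0.\<close>
  hence "rigid_at p f 1 0" unfolding rigid_at_def by simp
  thus ?thesis by blast
qed

lemma multiplicity_mob:
  fixes f :: "nat \<Rightarrow> 'a :: factorial_semiring"
  assumes n: "n > 0" and p: "prime_elem p" and f: "\<And>d. d > 0 \<Longrightarrow> f d \<noteq> 0" and r: "rigid_at p f m e"
  shows "multiplicity p (mob_pos n f) = multiplicity p (mob_neg n f) + (if m = n then e else 0)"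
proof -
  have fin: "finite {d. d dvd n}" using n by (simp add: finite_divisors_nat)
  have *: "multiplicity p (\<Prod>d\<in>S. f d) = (\<Sum>d\<in>S. if m dvd d then e else 0)" if "S \<subseteq> {d. d dvd n}" for S
  proof -
    have pos: "d > 0" if "d \<in> S" for d
    proof -
      have "d dvd n" using \<open>S \<subseteq> {d. d dvd n}\<close> that by blast
      thus ?thesis using n by (rule dvd_pos_nat[rotated])
    qed
    have "finite S" using that fin by (rule finite_subset)
    moreover have "0 \<notin> f ` S" using pos f by force
    ultimately
    have "multiplicity p (\<Prod>d\<in>S. f d) = (\<Sum>d\<in>S. multiplicity p (f d))"
      by (intro prime_elem_multiplicity_prod_distrib[OF p])
    thus ?thesis using pos r by (auto simp: rigid_at_def intro!: sum.cong)
  qed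
  define g where "g d = (if m dvd d then int e else 0)" for d
  have part: "int (multiplicity p (\<Prod>d | d dvd n \<and> R d. f d)) = (\<Sum>d | d dvd n. if R d then g d else 0)" for R
  proof -
    have "int (multiplicity p (\<Prod>d | d dvd n \<and> R d. f d)) = (\<Sum>d | d dvd n \<and> R d. g d)"
      by (subst *) (auto simp: g_def intro!: sum.cong)
    also have "\<dots> = (\<Sum>d | d dvd n. if R d then g d else 0)"
      by (rule sum.mono_neutral_cong_left) (use fin in auto)
    finally show ?thesis .
  qed
  have "int (multiplicity p (mob_pos n f)) - int (multiplicity p (mob_neg n f)) =
     (\<Sum>d | d dvd n. if moebius (n div d) = 1 then g d else 0) -
     (\<Sum>d | d dvd n. if moebius (n div d) = -1 then g d else 0)"
    unfolding mob_pos_def mob_neg_def part ..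
  also have "\<dots> = (\<Sum>d | d dvd n. int e * (if m dvd d then moebius (n div d) else 0))"
    unfolding sum_subtractf[symmetric] g_def
  proof (intro sum.cong refl)
    fix d
    show "(if moebius (n div d) = 1 then if m dvd d then int e else 0 else 0) -
        (if moebius (n div d) = -1 then if m dvd d then int e else 0 else 0) =
        int e * (if m dvd d then moebius (n div d) else 0)"
      using moebius_cases[of "n div d"] by auto
  qed
  also have "\<dots> = int e * (if m = n then 1 else 0)"
    by (simp only: sum_distrib_left[symmetric] sum_moebius_multiples[OF n])
  finally show ?thesis by (auto split: if_splits)
qed

lemma mob_quotient:
  fixes f :: "nat \<Rightarrow> 'a :: factorial_semiring"
  assumes n: "n > 0" and f: "\<And>d. d > 0 \<Longrightarrow> f d \<noteq> 0"
    and r: "\<And>p. prime_elem p \<Longrightarrow> \<exists>m e. rigid_at p f m e"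
  obtains A where "A * mob_neg n f = mob_pos n f"
proof -
  have nz: "mob_neg n f \<noteq> 0"
    unfolding mob_neg_def
    using assms by (auto simp: prod_zero_iff finite_divisors_nat intro: dvd_pos_nat)
  have "mob_neg n f dvd mob_pos n f"
  proof (rule multiplicity_le_imp_dvd[OF nz])
    fix p :: 'a assume "prime p"
    hence p: "prime_elem p" by auto
    from r[OF p] obtain m e where "rigid_at p f m e" by blast
    from multiplicity_mob[OF n p f this]
    show "multiplicity p (mob_neg n f) \<le> multiplicity p (mob_pos n f)" by simp
  qed
  thus ?thesis using that by (metis dvdE mult.commute)
qed

lemma multiplicity_mob_quotient:
  fixes f :: "nat \<Rightarrow> 'a :: factorial_semiring"
  assumes n: "n > 0" and p: "prime_elem p" and f: "\<And>d. d > 0 \<Longrightarrow> f d \<noteq> 0" and r: "rigid_at p f m e"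
    and A: "A * mob_neg n f = mob_pos n f"
  shows "A \<noteq> 0" "multiplicity p A = (if m = n then e else 0)"
proof -
  have nz: "mob_neg n f \<noteq> 0" "mob_pos n f \<noteq> 0"
    unfolding mob_neg_def mob_pos_def
    using n f by (auto simp: prod_zero_iff finite_divisors_nat intro: dvd_pos_nat)
  thus A0: "A \<noteq> 0" using A by auto
  show "multiplicity p A = (if m = n then e else 0)"
    using multiplicity_mob[OF n p f r] prime_elem_multiplicity_mult_distrib[OF p A0 nz(1)]
    unfolding A by linarith
qed

subsection \<open>Homogeneous quadratic maps\<close>

text \<open>A triple \<open>(a, b, c)\<close> stands for the binary form \<open>a y\<^sup>2 + b x y + c x\<^sup>2\<close>, so that the
  entries are the coefficients, lowest first, of the dehomogenised polynomial.\<close>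

definition qf :: "'a :: comm_ring_1 \<times> 'a \<times> 'a \<Rightarrow> 'a \<Rightarrow> 'a \<Rightarrow> 'a" where
  "qf f x y = (case f of (a, b, c) \<Rightarrow> a * y\<^sup>2 + b * x * y + c * x\<^sup>2)"

definition qmap ::
    "'a :: comm_ring_1 \<times> 'a \<times> 'a \<Rightarrow> 'a \<times> 'a \<times> 'a \<Rightarrow> 'a \<times> 'a \<Rightarrow> 'a \<times> 'a" where
  "qmap f g v = (qf f (fst v) (snd v), qf g (fst v) (snd v))"

definition qit ::
    "'a :: comm_ring_1 \<times> 'a \<times> 'a \<Rightarrow> 'a \<times> 'a \<times> 'a \<Rightarrow> nat \<Rightarrow> 'a \<times> 'a \<Rightarrow> 'a \<times> 'a" where
  "qit f g d v = (qmap f g ^^ d) v"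

definition map3 :: "('a \<Rightarrow> 'b) \<Rightarrow> 'a \<times> 'a \<times> 'a \<Rightarrow> 'b \<times> 'b \<times> 'b" where
  "map3 h f = (case f of (a, b, c) \<Rightarrow> (h a, h b, h c))"

lemma qf_simp [simp]: "qf (a, b, c) x y = a * y\<^sup>2 + b * x * y + c * x\<^sup>2"
  by (simp add: qf_def)

lemma map3_simp [simp]: "map3 h (a, b, c) = (h a, h b, h c)"
  by (simp add: map3_def)

lemma qmap_simp [simp]: "qmap f g (x, y) = (qf f x y, qf g x y)"
  by (simp add: qmap_def)

lemma qit_0 [simp]: "qit f g 0 v = v"
  by (simp add: qit_def)

lemma qit_Suc: "qit f g (Suc d) v = qmap f g (qit f g d v)"
  by (simp add: qit_def)

lemma qit_Suc': "qit f g (Suc d) v = qit f g d (qmap f g v)"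
  by (simp add: qit_def funpow_swap1)

lemma qit_add: "qit f g (m + j) v = qit f g j (qit f g m v)"
  unfolding qit_def by (simp only: add.commute[of m j] funpow_add o_apply)

lemma fst_qit_Suc: "fst (qit f g (Suc d) v) = qf f (fst (qit f g d v)) (snd (qit f g d v))"
  and snd_qit_Suc: "snd (qit f g (Suc d) v) = qf g (fst (qit f g d v)) (snd (qit f g d v))"
  by (simp_all add: qit_Suc qmap_def)

lemma qf_scale: "qf f (c * x) (c * y) = c\<^sup>2 * qf f x y"
  by (cases f) (simp add: power2_eq_square algebra_simps)

lemma qit_scale: "qit f g d (c * x, c * y) =
    (c ^ 2 ^ d * fst (qit f g d (x, y)), c ^ 2 ^ d * snd (qit f g d (x, y)))"
  by (induction d)
    (auto simp: qit_Suc qmap_def qf_scale power_mult[symmetric] mult.commute)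

lemma (in comm_ring_hom) hom_qf: "hom (qf f x y) = qf (map3 hom f) (hom x) (hom y)"
  by (cases f) (simp add: hom_distribs)

text \<open>Iterates are integral polynomial expressions in the coefficients and the starting point;
  every specialisation below rests on this.\<close>

lemma (in comm_ring_hom) hom_qit:
  "map_prod hom hom (qit f g d v) = qit (map3 hom f) (map3 hom g) d (map_prod hom hom v)"
proof (induction d)
  case (Suc d)
  have "fst (qit (map3 hom f) (map3 hom g) d (map_prod hom hom v)) = hom (fst (qit f g d v))"
    "snd (qit (map3 hom f) (map3 hom g) d (map_prod hom hom v)) = hom (snd (qit f g d v))"
    unfolding Suc[symmetric] by simp_all
  thus ?case by (simp add: qit_Suc qmap_def hom_qf)
qed simp

lemma (in comm_ring_hom) hom_fst_qit: "hom (fst (qit f g d v)) = fst (qit (map3 hom f) (map3 hom g) d (map_prod hom hom v))"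
  and hom_snd_qit: "hom (snd (qit f g d v)) = snd (qit (map3 hom f) (map3 hom g) d (map_prod hom hom v))"
  by (simp_all add: hom_qit[symmetric])

subsection \<open>The orbit of a critical point in the normal form\<close>

text \<open>Normal form: \<open>(x\<^sup>2 + u x + 1) / (b x)\<close>. Its critical points are \<open>\<plusminus>1\<close>; the point
  \<open>\<infinity>\<close> is fixed with multiplier \<open>b\<close>.\<close>

definition nit :: "'a :: comm_ring_1 \<Rightarrow> 'a \<Rightarrow> nat \<Rightarrow> 'a \<times> 'a" where
  "nit b u d = qit (1, u, 1) (0, b, 0) d (1, 1)"

text \<open>Over a field with b \<noteq> 0 it vanishes exactly when the critical point 1 is back at
  itself after d steps.\<close>

definition asq :: "'a :: comm_ring_1 \<Rightarrow> 'a \<Rightarrow> nat \<Rightarrow> 'a" where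
  "asq b u d = fst (nit b u d) - snd (nit b u d)"

lemma nit_0: "nit b u 0 = (1, 1)"
  by (simp add: nit_def)

lemma fst_nit_Suc: "fst (nit b u (Suc d)) =
    (snd (nit b u d))\<^sup>2 + u * fst (nit b u d) * snd (nit b u d) + (fst (nit b u d))\<^sup>2"
  and snd_nit_Suc: "snd (nit b u (Suc d)) = b * fst (nit b u d) * snd (nit b u d)"
  by (simp_all add: nit_def fst_qit_Suc snd_qit_Suc)

lemma (in comm_ring_hom) hom_nit:
  "hom (fst (nit b u d)) = fst (nit (hom b) (hom u) d)" "hom (snd (nit b u d)) = snd (nit (hom b) (hom u) d)"
  by (simp_all add: nit_def hom_fst_qit hom_snd_qit)

lemma (in comm_ring_hom) hom_asq: "hom (asq b u d) = asq (hom b) (hom u) d"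
  by (simp add: asq_def hom_minus hom_nit)

text \<open>Since \<open>1\<close> is critical, \<open>(P, Q) \<mapsto> P Q (P\<^sub>1, Q\<^sub>1) + ((P - Q)\<^sup>2, 0)\<close>: a return close to \<open>1\<close> restarts
  the orbit up to a second-order error.\<close>

lemma nit_shift:
  assumes "j > 0"
  shows "(asq b u m)\<^sup>2 dvd fst (nit b u (m + j)) -
           (fst (nit b u m) * snd (nit b u m)) ^ 2 ^ (j - 1) * fst (nit b u j)"
    and "(asq b u m)\<^sup>2 dvd snd (nit b u (m + j)) -
           (fst (nit b u m) * snd (nit b u m)) ^ 2 ^ (j - 1) * snd (nit b u j)"
proof -
  define N where "N = (asq b u m)\<^sup>2"
  define c where "c = fst (nit b u m) * snd (nit b u m)"
  have "N dvd fst (nit b u (m + Suc j)) - c ^ 2 ^ j * fst (nit b u (Suc j)) \<and>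
        N dvd snd (nit b u (m + Suc j)) - c ^ 2 ^ j * snd (nit b u (Suc j))" for j
  proof (induction j)
    case 0
    \<comment> \<open>From (1, 1) one step leads to (2 + u, b), and \<open>P\<^sup>2 + u * P * Q +
      Q\<^sup>2 = (2 + u) * P * Q + (P - Q)\<^sup>2\<close>.\<close>
    have "fst (nit b u (m + Suc 0)) - c ^ 2 ^ 0 * fst (nit b u (Suc 0)) = N"
      by (simp add: fst_nit_Suc nit_0 N_def c_def asq_def power2_eq_square algebra_simps)
    moreover have "snd (nit b u (m + Suc 0)) - c ^ 2 ^ 0 * snd (nit b u (Suc 0)) = 0"
      by (simp add: snd_nit_Suc nit_0 c_def algebra_simps)
    ultimately show ?case by simp
  next
    case (Suc j)
    define P Q P' Q' k where PQ: "P = fst (nit b u (m + Suc j))" "Q = snd (nit b u (m + Suc j))"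
      "P' = fst (nit b u (Suc j))" "Q' = snd (nit b u (Suc j))" "k = c ^ 2 ^ j"
    from Suc have IH: "N dvd P - k * P'" "N dvd Q - k * Q'" by (simp_all add: PQ)
    have k2: "c ^ 2 ^ Suc j = k\<^sup>2" by (simp add: PQ power_mult[symmetric] mult.commute)
    have "fst (nit b u (m + Suc (Suc j))) - c ^ 2 ^ Suc j * fst (nit b u (Suc (Suc j))) =
        (Q - k * Q') * (Q + k * Q') + u * (P - k * P') * Q + u * k * P' * (Q - k * Q') +
        (P - k * P') * (P + k * P')"
      unfolding k2 add_Suc_right fst_nit_Suc[of b u "Suc _"]
      by (simp only: PQ(1-4)[symmetric, unfolded add_Suc_right]) (simp add: power2_eq_square algebra_simps)
    moreover have "snd (nit b u (m + Suc (Suc j))) - c ^ 2 ^ Suc j * snd (nit b u (Suc (Suc j))) =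
        b * (P - k * P') * Q + b * k * P' * (Q - k * Q')"
      unfolding k2 add_Suc_right snd_nit_Suc[of b u "Suc _"]
      by (simp only: PQ(1-4)[symmetric, unfolded add_Suc_right]) (simp add: power2_eq_square algebra_simps)
    ultimately show ?case using IH by (auto intro!: dvd_add dvd_mult dvd_mult2)
  qed
  from this[of "j - 1"] assms show
    "(asq b u m)\<^sup>2 dvd fst (nit b u (m + j)) -
           (fst (nit b u m) * snd (nit b u m)) ^ 2 ^ (j - 1) * fst (nit b u j)"
    "(asq b u m)\<^sup>2 dvd snd (nit b u (m + j)) -
           (fst (nit b u m) * snd (nit b u m)) ^ 2 ^ (j - 1) * snd (nit b u j)"
    by (simp_all add: N_def c_def)
qed

lemma asq_shift:
  assumes "j > 0"
  shows "(asq b u m)\<^sup>2 dvd asq b u (m + j) - (fst (nit b u m) * snd (nit b u m)) ^ 2 ^ (j - 1) * asq b u j"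
  using dvd_diff[OF nit_shift[OF assms, of b u m]] by (simp add: asq_def algebra_simps)

lemma multiplicity_cong:
  fixes p :: "'a :: {factorial_semiring, comm_ring_1}"
  assumes p: "prime_elem p" and "x \<noteq> 0" and "\<not> p dvd c" and "p ^ k dvd y - c * x" and "multiplicity p x < k"
  shows "multiplicity p y = multiplicity p x"
proof (rule multiplicity_eqI)
  let ?e = "multiplicity p x"
  have c: "c \<noteq> 0" using assms(3) by auto
  have mc: "multiplicity p (c * x) = ?e"
    using prime_elem_multiplicity_mult_distrib[OF p c assms(2)] not_dvd_imp_multiplicity_0[OF assms(3)] by simp
  have nu: "\<not> is_unit p" using p by (simp add: prime_elem_def)
  have dv: "p ^ Suc ?e dvd y - c * x"
    using assms(4,5) by (meson Suc_leI dvd_trans le_imp_power_dvd)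
  have "p ^ ?e dvd c * x" using multiplicity_dvd[of p "c * x"] mc by simp
  moreover have "p ^ ?e dvd y - c * x" using dv by (meson dvd_trans le_imp_power_dvd lessI less_imp_le)
  ultimately have "p ^ ?e dvd (y - c * x) + c * x" by (rule dvd_add[rotated])
  thus "p ^ ?e dvd y" by simp
  show "\<not> p ^ Suc ?e dvd y"
  proof
    assume "p ^ Suc ?e dvd y"
    hence "p ^ Suc ?e dvd y - (y - c * x)" using dv by (rule dvd_diff)
    hence "p ^ Suc ?e dvd c * x" by simp
    hence "Suc ?e \<le> multiplicity p (c * x)"
      by (rule multiplicity_geI[rotated 2]) (use nu c assms in auto)
    thus False using mc by simp
  qed
qed

lemma asq_rigid_shift:
  fixes b u :: "'a :: {factorial_semiring, comm_ring_1}"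
  assumes p: "prime_elem p" and cop: "\<And>d. \<not> (p dvd fst (nit b u d) \<and> p dvd snd (nit b u d))"
    and nz: "\<And>d. d > 0 \<Longrightarrow> asq b u d \<noteq> 0"
    and "m > 0" "j > 0" "p dvd asq b u m"
    and lt: "multiplicity p (asq b u j) < 2 * multiplicity p (asq b u m)"
  shows "multiplicity p (asq b u (m + j)) = multiplicity p (asq b u j)"
proof (rule multiplicity_cong[OF p nz[OF assms(5)] _ _ lt])
  let ?c = "(fst (nit b u m) * snd (nit b u m)) ^ 2 ^ (j - 1)"
  \<comment> \<open>Modulo p the two coordinates agree, so a prime dividing their product divides
    both.\<close>
  show "\<not> p dvd ?c"
  proof
    assume "p dvd ?c"
    hence "p dvd fst (nit b u m) \<or> p dvd snd (nit b u m)"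
      using p by (metis prime_elem_dvd_mult_iff prime_elem_dvd_power)
    moreover have "p dvd fst (nit b u m) - snd (nit b u m)" using assms(6) by (simp add: asq_def)
    ultimately have "p dvd fst (nit b u m) \<and> p dvd snd (nit b u m)"
      by (metis add.commute diff_add_cancel dvd_add_right_iff)
    with cop show False by blast
  qed
  have "p ^ (2 * multiplicity p (asq b u m)) dvd (asq b u m)\<^sup>2"
    unfolding mult.commute[of 2] power_mult by (intro dvd_power_same multiplicity_dvd)
  thus "p ^ (2 * multiplicity p (asq b u m)) dvd asq b u (m + j) - ?c * asq b u j"
    using asq_shift[OF assms(5), of b u m] dvd_trans by blast
qed

text \<open>Backwards along the orbit: p divides b P Q, hence P or Q, and then
  \<open>P\<^sup>2 + u * P * Q + Q\<^sup>2\<close> forces the other one.\<close>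

lemma nit_coprime:
  fixes b u :: "'a :: {factorial_semiring, comm_ring_1}"
  assumes p: "prime_elem p" and "\<not> p dvd b"
  shows "\<not> (p dvd fst (nit b u d) \<and> p dvd snd (nit b u d))"
proof (induction d)
  case 0
  thus ?case using p by (auto simp: nit_0 prime_elem_def)
next
  case (Suc d)
  define P Q where "P = fst (nit b u d)" "Q = snd (nit b u d)"
  show ?case
  proof
    assume a: "p dvd fst (nit b u (Suc d)) \<and> p dvd snd (nit b u (Suc d))"
    hence "p dvd b * P * Q" by (simp add: snd_nit_Suc P_Q_def)
    hence "p dvd P \<or> p dvd Q" using assms by (simp add: prime_elem_dvd_mult_iff)
    moreover have s: "p dvd Q\<^sup>2 + u * P * Q + P\<^sup>2" using a by (simp add: fst_nit_Suc P_Q_def)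
    ultimately consider "p dvd P" | "p dvd Q" by blast
    hence "p dvd P \<and> p dvd Q"
    proof cases
      case 1
      hence "p dvd u * P * Q + P\<^sup>2" by (simp add: power2_eq_square)
      hence "p dvd Q\<^sup>2" using s dvd_add_left_iff[of p "u * P * Q + P\<^sup>2" "Q\<^sup>2"] by (simp add: add.assoc)
      thus ?thesis using 1 prime_elem_dvd_power[OF p] by blast
    next
      case 2
      hence "p dvd Q\<^sup>2 + u * P * Q" by (simp add: power2_eq_square)
      hence "p dvd P\<^sup>2" using s dvd_add_right_iff by blast
      thus ?thesis using 2 prime_elem_dvd_power[OF p] by blast
    qed
    with Suc show False by (simp add: P_Q_def)
  qed
qed

text \<open>The good parameter \<open>(b, u) = (1, 0)\<close>, i.e. the map \<open>x + 1/x\<close>.\<close>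

lemma asq_1_0_nonzero:
  assumes "d > 0"
  shows "asq (1 :: 'a :: {comm_ring_1, ring_char_0}) 0 d \<noteq> 0"
proof -
  have pos: "fst (nit 1 0 d) > (0 :: int) \<and> snd (nit 1 0 d) > (0 :: int)" for d
    by (induction d) (simp_all add: nit_0 fst_nit_Suc snd_nit_Suc power2_eq_square add_pos_pos)
  have "asq 1 0 d \<noteq> (0 :: int)"
  proof -
    obtain e where e: "d = Suc e" using assms by (cases d) auto
    define P Q where "P = fst (nit 1 0 e :: int \<times> int)" "Q = snd (nit 1 0 e :: int \<times> int)"
    have "asq 1 0 d = (P - Q)\<^sup>2 + P * Q"
      by (simp add: asq_def e fst_nit_Suc snd_nit_Suc P_Q_def power2_eq_square algebra_simps)
    moreover have "P * Q > 0" using pos[of e] unfolding P_Q_def by simp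
    ultimately show ?thesis using zero_le_power2[of "P - Q"] by linarith
  qed
  moreover have "asq (1 :: 'a) 0 d = of_int (asq 1 0 d)" by (simp add: of_int_hom.hom_asq)
  ultimately show ?thesis by simp
qed

subsection \<open>Evaluation of integer polynomials in two variables\<close>

lemma comm_ring_hom_poly_map:
  assumes "comm_ring_hom h"
  shows "comm_ring_hom (\<lambda>p. poly (map_poly h p) a)"
proof -
  interpret h: comm_ring_hom h by fact
  interpret p: map_poly_comm_ring_hom h ..
  show ?thesis by unfold_locales (auto simp: hom_distribs)
qed

lemma comm_ring_hom_of_int: "comm_ring_hom (of_int :: int \<Rightarrow> 'a :: comm_ring_1)"
  by unfold_locales auto

lemma comm_ring_hom_eval2: "comm_ring_hom (\<lambda>F. eval2 F a b)"
  unfolding eval2_def by (intro comm_ring_hom_poly_map comm_ring_hom_of_int)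

lemma eval2_var [simp]: "eval2 [:[:0, 1:]:] a b = a" "eval2 [:0, 1:] a b = b"
  by (simp_all add: eval2_def map_poly_pCons)

lemma (in comm_ring_hom) hom_poly_map_poly:
  assumes "k 0 = 0"
  shows "hom (poly (map_poly k p) a) = poly (map_poly (\<lambda>c. hom (k c)) p) (hom a)"
  by (induction p) (simp_all add: map_poly_pCons assms hom_distribs)

lemma (in comm_ring_hom) hom_eval2: "hom (eval2 F a b) = eval2 F (hom a) (hom b)"
  unfolding eval2_def by (simp add: hom_poly_map_poly hom_distribs)

lemma eval2_asq: "eval2 (asq [:[:0, 1:]:] [:0, 1:] d) b u = asq b u d"
proof -
  interpret e: comm_ring_hom "\<lambda>F. eval2 F b u" by (rule comm_ring_hom_eval2)
  show ?thesis by (simp only: e.hom_asq eval2_var)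
qed

subsection \<open>The quotient \<open>\<Prod> a\<^sub>d ^ \<mu> (n / d)\<close>\<close>

lemma (in comm_ring_hom) hom_mob:
  "hom (mob_pos n f) = mob_pos n (\<lambda>d. hom (f d))" "hom (mob_neg n f) = mob_neg n (\<lambda>d. hom (f d))"
  unfolding mob_pos_def mob_neg_def by (simp_all add: hom_prod)

text \<open>Modulo b the orbit collapses to \<infinity>. This settles the primes dividing b, which
  \<open>nit_coprime\<close> excludes.\<close>

lemma nit_mod_b:
  "b dvd fst (nit b u (Suc d)) - (2 + u) ^ 2 ^ d" "b dvd snd (nit b u (Suc d))"
proof -
  show snd: "b dvd snd (nit b u (Suc d))" for d by (simp add: snd_nit_Suc mult.assoc)
  show "b dvd fst (nit b u (Suc d)) - (2 + u) ^ 2 ^ d"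
  proof (induction d)
    case 0
    show ?case by (simp add: fst_nit_Suc nit_0)
  next
    case (Suc d)
    define P Q k where "P = fst (nit b u (Suc d))" "Q = snd (nit b u (Suc d))" "k = (2 + u) ^ 2 ^ d"
    have k2: "(2 + u) ^ 2 ^ Suc d = k\<^sup>2" by (simp add: P_Q_k_def power_mult[symmetric] mult.commute)
    have "fst (nit b u (Suc (Suc d))) - (2 + u) ^ 2 ^ Suc d = (P - k) * (P + k) + (Q + u * P) * Q"
      unfolding k2 fst_nit_Suc[of b u "Suc d"] P_Q_k_def(1,2)[symmetric]
      by (simp add: power2_eq_square algebra_simps)
    thus ?case using Suc.IH snd[of d] by (simp add: P_Q_k_def)
  qed
qed

lemma nit_coprime_generic:
  fixes p :: "int poly poly"
  assumes p: "prime_elem p"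
  shows "\<not> (p dvd fst (nit [:[:0, 1:]:] [:0, 1:] d) \<and> p dvd snd (nit [:[:0, 1:]:] [:0, 1:] d))"
proof (cases "p dvd [:[:0, 1:]:]")
  case False
  thus ?thesis by (rule nit_coprime[OF p])
next
  case True
  let ?b = "[:[:0, 1:]:] :: int poly poly" and ?u = "[:0, 1:] :: int poly poly"
  have nu: "\<not> is_unit p" using p by (simp add: prime_elem_def)
  have "degree p = 0" using dvd_imp_degree_le[OF True] by simp
  then obtain c where c: "p = [:c:]" by (metis degree_eq_zeroE)
  \<comment> \<open>p is constant in u, whereas 2 + u has leading coefficient 1 in u.\<close>
  have "\<not> p dvd 2 + ?u"
  proof
    assume "p dvd 2 + ?u"
    hence "c dvd coeff (2 + ?u) 1" unfolding c by (simp only: const_poly_dvd_iff)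
    hence "c dvd 1" by (simp add: numeral_poly)
    thus False using nu c by (simp add: is_unit_const_poly_iff)
  qed
  show ?thesis
  proof (cases d)
    case 0
    thus ?thesis using nu by (simp add: nit_0)
  next
    case (Suc e)
    show ?thesis
    proof
      assume "p dvd fst (nit ?b ?u d) \<and> p dvd snd (nit ?b ?u d)"
      moreover have "p dvd fst (nit ?b ?u d) - (2 + ?u) ^ 2 ^ e"
        using nit_mod_b(1)[of ?b ?u e] True dvd_trans unfolding Suc by blast
      ultimately have "p dvd fst (nit ?b ?u d) - (fst (nit ?b ?u d) - (2 + ?u) ^ 2 ^ e)"
        using dvd_diff by blast
      hence "p dvd (2 + ?u) ^ 2 ^ e" by simp
      with \<open>\<not> p dvd 2 + ?u\<close> show False using prime_elem_dvd_power[OF p] by blast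
    qed
  qed
qed

lemma asq_generic_nonzero: "d > 0 \<Longrightarrow> asq [:[:0, 1:]:] [:0, 1:] d \<noteq> (0 :: int poly poly)"
  using eval2_asq[of d "1 :: int" 0] asq_1_0_nonzero[where 'a = int, of d] by (auto simp: eval2_def)

text \<open>Encoded as an identity without division over \<int>[b][u], b being the inner variable,
  so that it passes to every commutative ring.\<close>

definition asq_quotient :: "nat \<Rightarrow> int poly poly \<Rightarrow> bool" where
  "asq_quotient n A \<longleftrightarrow> A * mob_neg n (asq [:[:0, 1:]:] [:0, 1:]) = mob_pos n (asq [:[:0, 1:]:] [:0, 1:])"

lemma asq_quotient_ex:
  assumes "n > 0"
  obtains A where "asq_quotient n A"
proof -
  obtain A :: "int poly poly" where
    "A * mob_neg n (asq [:[:0, 1:]:] [:0, 1:]) = mob_pos n (asq [:[:0, 1:]:] [:0, 1:])"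
  proof (rule mob_quotient[OF assms asq_generic_nonzero])
    fix p :: "int poly poly" assume p: "prime_elem p"
    show "\<exists>m e. rigid_at p (asq [:[:0, 1:]:] [:0, 1:]) m e"
      by (rule rigid_at_ex[OF p asq_generic_nonzero
            asq_rigid_shift[OF p nit_coprime_generic[OF p] asq_generic_nonzero]])
  qed
  thus ?thesis using that by (simp only: asq_quotient_def)
qed

lemma eval2_asq_quotient:
  assumes "asq_quotient n A"
  shows "eval2 A b u * mob_neg n (asq b u) = mob_pos n (asq b u)"
proof -
  interpret e: comm_ring_hom "\<lambda>F. eval2 F b u" by (rule comm_ring_hom_eval2)
  have "eval2 (A * mob_neg n (asq [:[:0, 1:]:] [:0, 1:])) b u = eval2 (mob_pos n (asq [:[:0, 1:]:] [:0, 1:])) b u"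
    using assms by (simp only: asq_quotient_def)
  thus ?thesis by (simp only: e.hom_mult e.hom_mob eval2_asq)
qed

text \<open>The quotient may be \<open>0/0\<close> at the given point, so the point is approached along the line
  towards the good parameter \<open>(1, 0)\<close>.\<close>

lemma asq_quotient_zero_iff:
  fixes b u :: "'a :: {field_gcd, field_char_0}"
  assumes n: "n > 0" and A: "asq_quotient n A" and b: "b \<noteq> 0"
  shows "eval2 A b u = 0 \<longleftrightarrow> asq b u n = 0 \<and> (\<forall>m. 0 < m \<and> m < n \<longrightarrow> asq b u m \<noteq> 0)"
proof -
  define bt ut where "bt = [:b, 1 - b:]" "ut = [:u, - u:]"
  define p where "p = ([:0, 1:] :: 'a poly)"
  let ?f = "asq bt ut"
  have ev: "comm_ring_hom (\<lambda>q. poly q t)" for t :: 'a by unfold_locales auto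
  have at: "poly (?f d) t = asq (poly bt t) (poly ut t) d" for d t
    by (rule comm_ring_hom.hom_asq[OF ev])
  have nz: "?f d \<noteq> 0" if "d > 0" for d
    using at[of d 1] asq_1_0_nonzero[OF that, where 'a = 'a] by (auto simp: bt_ut_def)
  \<comment> \<open>Multiplicity at this prime is the order of vanishing at t = 0. It gives a
    meaning to 0/0: the quotient vanishes at the point exactly when the rank of apparition of p is
    n.\<close>
  have p: "prime_elem p"
    unfolding p_def by (rule prime_elem_linear_field_poly) simp
  have pdvd: "p dvd q \<longleftrightarrow> poly q 0 = 0" for q
    using poly_eq_0_iff_dvd[of q 0] by (simp add: p_def)
  have cop: "\<not> (p dvd fst (nit bt ut d) \<and> p dvd snd (nit bt ut d))" for d
    by (rule nit_coprime[OF p]) (use b in \<open>simp only: pdvd, simp add: bt_ut_def\<close>)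
  have a0: "p dvd ?f d \<longleftrightarrow> asq b u d = 0" for d
    by (simp only: pdvd at) (simp add: bt_ut_def)
  note shift = asq_rigid_shift[OF p cop nz]
  define At where "At = eval2 A bt ut"
  have At: "At * mob_neg n ?f = mob_pos n ?f"
    unfolding At_def by (rule eval2_asq_quotient[OF A])
  have At0: "poly At 0 = eval2 A b u"
    unfolding At_def by (simp add: comm_ring_hom.hom_eval2[OF ev]) (simp add: bt_ut_def)
  show ?thesis
  proof (cases "\<exists>d>0. asq b u d = 0")
    case True
    define m where "m = (LEAST d. d > 0 \<and> asq b u d = 0)"
    have m: "m > 0" "asq b u m = 0" using LeastI_ex[of "\<lambda>d. d > 0 \<and> asq b u d = 0"] True
      by (auto simp: m_def)
    have lst: "asq b u d \<noteq> 0" if "0 < d" "d < m" for d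
      using not_less_Least[of d "\<lambda>d. d > 0 \<and> asq b u d = 0"] that by (auto simp: m_def)
    have r: "rigid_at p ?f m (multiplicity p (?f m))" "multiplicity p (?f m) > 0"
      by (rule rigid_atI[OF p nz shift]; use m lst a0 in blast)+
    have "eval2 A b u = 0 \<longleftrightarrow> multiplicity p At > 0"
      using prime_multiplicity_gt_zero_iff[OF p multiplicity_mob_quotient(1)[OF n p nz r(1) At]] pdvd At0
      by simp
    also have "\<dots> \<longleftrightarrow> m = n"
      using multiplicity_mob_quotient(2)[OF n p nz r(1) At] r(2) by (simp split: if_splits)
    also have "\<dots> \<longleftrightarrow> asq b u n = 0 \<and> (\<forall>m. 0 < m \<and> m < n \<longrightarrow> asq b u m \<noteq> 0)"
      using m lst n by (metis linorder_neqE_nat)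
    finally show ?thesis .
  next
    case False
    have "multiplicity p (?f d) = 0" if "d > 0" for d
      by (rule not_dvd_imp_multiplicity_0) (use that False a0 in blast)
    hence r: "rigid_at p ?f 1 0" by (simp add: rigid_at_def)
    have "\<not> p dvd At"
      using prime_multiplicity_gt_zero_iff[OF p multiplicity_mob_quotient(1)[OF n p nz r At]]
        multiplicity_mob_quotient(2)[OF n p nz r At] by (simp split: if_splits)
    hence "eval2 A b u \<noteq> 0" using pdvd At0 by simp
    thus ?thesis using False n by blast
  qed
qed

lemma poly_even_odd:
  fixes p :: "'a :: comm_ring_1 poly"
  obtains p0 p1 where "p = pcompose p0 [:0, 0, 1:] + [:0, 1:] * pcompose p1 [:0, 0, 1:]"
proof -
  have "\<exists>p0 p1. p = pcompose p0 [:0, 0, 1:] + [:0, 1:] * pcompose p1 [:0, 0, 1:]"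
  proof (induction p)
    case 0
    show ?case by (intro exI[of _ 0]) simp
  next
    case (pCons c p)
    then obtain p0 p1 where p: "p = pcompose p0 [:0, 0, 1:] + [:0, 1:] * pcompose p1 [:0, 0, 1:]" by blast
    have "pCons c p = [:c:] + [:0, 1:] * p" by simp
    also have "\<dots> = pcompose (pCons c p1) [:0, 0, 1:] + [:0, 1:] * pcompose p0 [:0, 0, 1:]"
      unfolding p by (simp add: pcompose_pCons algebra_simps)
    finally show ?case by blast
  qed
  thus ?thesis using that by blast
qed

lemma eval2_pCons: "eval2 (pCons c F) a t = poly (map_poly of_int c) a + t * eval2 F a t"
  unfolding eval2_def by (cases "c = 0 \<and> F = 0") (auto simp: map_poly_pCons)

lemma eval2_0 [simp]: "eval2 0 a b = 0"
  by (simp add: eval2_def)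

lemma eval2_pcompose:
  "eval2 (pcompose F G) a b = eval2 F a (eval2 G a b)"
proof -
  interpret e: comm_ring_hom "\<lambda>F. eval2 F a b" by (rule comm_ring_hom_eval2)
  show ?thesis
  proof (induction F)
    case (pCons c F)
    thus ?case by (simp add: pcompose_pCons e.hom_add e.hom_mult eval2_pCons)
  qed simp
qed

text \<open>The product of a polynomial with its reflection is a polynomial in the square; the quantification
  over all rings is replaced by an identity in \<open>\<int>[b][u]\<close>.\<close>

lemma reflection_product:
  obtains E :: "int poly poly" where "A * pcompose A [:0, -1:] = pcompose E [:0, 0, 1:]"
proof -
  obtain p0 p1 where A: "A = pcompose p0 [:0, 0, 1:] + [:0, 1:] * pcompose p1 [:0, 0, 1:]"
    using poly_even_odd by blast
  have sq: "pcompose [:0, 0, 1:] [:0, -1:] = ([:0, 0, 1:] :: int poly poly)"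
    by (simp add: pcompose_pCons)
  have eq: "pcompose A [:0, -1:] = pcompose p0 [:0, 0, 1:] - [:0, 1:] * pcompose p1 [:0, 0, 1:]"
    by (subst A) (simp only: pcompose_add pcompose_mult pcompose_assoc[symmetric] sq, simp add: pcompose_pCons)
  have gen: "(x + t * y) * (x - t * y) = x\<^sup>2 - (t * t) * y\<^sup>2" for x y t :: "int poly poly"
    by (simp add: power2_eq_square algebra_simps)
  from arg_cong2[OF A eq, of "(*)"]
  have "A * pcompose A [:0, -1:] = (pcompose p0 [:0, 0, 1:])\<^sup>2 - ([:0, 1:] * [:0, 1:]) * (pcompose p1 [:0, 0, 1:])\<^sup>2"
    unfolding gen .
  also have "[:0, 1:] * [:0, 1:] = ([:0, 0, 1:] :: int poly poly)" by simp
  also have "(pcompose p0 [:0, 0, 1:])\<^sup>2 - [:0, 0, 1:] * (pcompose p1 [:0, 0, 1:])\<^sup>2 = pcompose (p0\<^sup>2 - [:0, 1:] * p1\<^sup>2) [:0, 0, 1:]"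
    by (simp add: pcompose_diff pcompose_mult power2_eq_square pcompose_pCons)
  finally show ?thesis using that by blast
qed

lemma eval2_reflection:
  assumes "A * pcompose A [:0, -1:] = pcompose E [:0, 0, 1:]"
  shows "eval2 A b u * eval2 A b (- u) = eval2 E b (u\<^sup>2)"
proof -
  interpret e: comm_ring_hom "\<lambda>F. eval2 F b u" by (rule comm_ring_hom_eval2)
  have "eval2 (A * pcompose A [:0, -1:]) b u = eval2 A b u * eval2 A b (eval2 [:0, -1:] b u)"
    by (simp only: e.hom_mult eval2_pcompose)
  also have "eval2 [:0, -1:] b u = - u"
  proof -
    have "[:0, -1:] = - ([:0, 1:] :: int poly poly)" by (rule poly_eqI) (simp add: coeff_pCons split: nat.split)
    thus ?thesis by (simp only: e.hom_uminus eval2_var)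
  qed
  finally have "eval2 A b u * eval2 A b (- u) = eval2 (pcompose E [:0, 0, 1:]) b u"
    using assms by simp
  also have "\<dots> = eval2 E b (eval2 [:0, 0, 1:] b u)" by (rule eval2_pcompose)
  also have "eval2 [:0, 0, 1:] b u = u\<^sup>2" by (simp add: eval2_pCons power2_eq_square)
  finally show ?thesis .
qed

subsection \<open>Rational functions\<close>

lemma rf_quot_spec:
  fixes \<phi> :: "'k :: field_gcd poly fract"
  shows "rf_den \<phi> \<noteq> 0" "coprime (rf_num \<phi>) (rf_den \<phi>)" "\<phi> = Fract (rf_num \<phi>) (rf_den \<phi>)"
proof -
  obtain a b where ab: "\<phi> = Fract a b" "b \<noteq> 0" by (cases \<phi>) auto
  define g where "g = gcd a b"
  have g: "g \<noteq> 0" using ab by (simp add: g_def)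
  obtain a' b' where ab': "a = a' * g" "b = b' * g" "coprime a' b'"
    using gcd_coprime_exists[of a b] g unfolding g_def by blast
  have "b' \<noteq> 0" using ab(2) ab'(2) by auto
  moreover from this have "\<phi> = Fract a' b'"
    using ab(2) unfolding ab(1) by (subst eq_fract) (auto simp: ab'(1,2))
  ultimately have "\<exists>pq. case pq of (p, q) \<Rightarrow> q \<noteq> 0 \<and> coprime p q \<and> \<phi> = Fract p q"
    using ab'(3) by (intro exI[of _ "(a', b')"]) simp
  hence "case rf_quot \<phi> of (p, q) \<Rightarrow> q \<noteq> 0 \<and> coprime p q \<and> \<phi> = Fract p q"
    unfolding rf_quot_def by (rule someI_ex)
  thus "rf_den \<phi> \<noteq> 0" "coprime (rf_num \<phi>) (rf_den \<phi>)" "\<phi> = Fract (rf_num \<phi>) (rf_den \<phi>)"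
    by (auto simp: rf_num_def rf_den_def split: prod.splits)
qed

lemma coprime_fract_unique:
  fixes p q p' q' :: "'k :: field_gcd poly"
  assumes "coprime p q" "coprime p' q'" "q \<noteq> 0" "q' \<noteq> 0" "p * q' = p' * q"
  obtains c where "c \<noteq> 0" "p' = smult c p" "q' = smult c q"
proof -
  have "q dvd q'" using assms(1,5) by (metis coprime_commute coprime_dvd_mult_right_iff dvd_triv_right)
  then obtain k where k: "q' = q * k" by blast
  have "q' dvd q" using assms(2,5) by (metis coprime_commute coprime_dvd_mult_right_iff dvd_triv_right)
  hence "is_unit k" using k assms(3,4) by (metis dvd_mult_cancel_left dvd_triv_left mult.right_neutral mult_eq_0_iff)
  then obtain c where c: "k = [:c:]" "c \<noteq> 0" by (metis is_unit_poly_iff not_is_unit_0)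
  have "smult c p * q = p' * q" using assms(5) k c by simp
  hence "p' = smult c p" using assms(3) mult_right_cancel[of q "smult c p" p'] by blast
  moreover have "q' = smult c q" using k c by simp
  ultimately show ?thesis using that c by blast
qed

lemma rf_Fract:
  fixes p q :: "'k :: field_gcd poly"
  assumes "coprime p q" "q \<noteq> 0"
  obtains c where "c \<noteq> 0" "rf_num (Fract p q) = smult c p" "rf_den (Fract p q) = smult c q"
proof -
  have "p * rf_den (Fract p q) = rf_num (Fract p q) * q"
    by (rule iffD1[OF eq_fract(1)[OF assms(2) rf_quot_spec(1)] rf_quot_spec(3)])
  from coprime_fract_unique[OF assms(1) rf_quot_spec(2) assms(2) rf_quot_spec(1) this]
  show ?thesis using that by blast
qed

section \<open>Binary quadratic forms, their resultant and Jacobian\<close>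

definition pq :: "'a :: zero \<times> 'a \<times> 'a \<Rightarrow> 'a poly" where
  "pq f = (case f of (a, b, c) \<Rightarrow> [:a, b, c:])"

abbreviation cst :: "'a :: zero \<times> 'a \<times> 'a \<Rightarrow> 'a poly \<times> 'a poly \<times> 'a poly" where
  "cst \<equiv> map3 (\<lambda>c. [:c:])"

text \<open>The resultant of the two binary forms, written as a Bezout determinant.\<close>

definition res :: "'a :: comm_ring_1 \<times> 'a \<times> 'a \<Rightarrow> 'a \<times> 'a \<times> 'a \<Rightarrow> 'a" where
  "res f g = (case f of (f0, f1, f2) \<Rightarrow> case g of (g0, g1, g2) \<Rightarrow>
     (f2 * g0 - f0 * g2)\<^sup>2 - (f2 * g1 - f1 * g2) * (f1 * g0 - f0 * g1))"

text \<open>Half the Jacobian determinant of the homogeneous map.\<close>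

definition jac :: "'a :: comm_ring_1 \<times> 'a \<times> 'a \<Rightarrow> 'a \<times> 'a \<times> 'a \<Rightarrow> 'a \<Rightarrow> 'a \<Rightarrow> 'a" where
  "jac f g x y = (case f of (f0, f1, f2) \<Rightarrow> case g of (g0, g1, g2) \<Rightarrow>
     (f2 * g1 - f1 * g2) * x\<^sup>2 + 2 * (f2 * g0 - f0 * g2) * x * y + (f1 * g0 - f0 * g1) * y\<^sup>2)"

lemma pq_simp [simp]: "pq (a, b, c) = [:a, b, c:]"
  by (simp add: pq_def)

lemma res_simp [simp]: "res (f0, f1, f2) (g0, g1, g2) =
    (f2 * g0 - f0 * g2)\<^sup>2 - (f2 * g1 - f1 * g2) * (f1 * g0 - f0 * g1)"
  by (simp add: res_def)

lemma jac_simp [simp]: "jac (f0, f1, f2) (g0, g1, g2) x y =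
    (f2 * g1 - f1 * g2) * x\<^sup>2 + 2 * (f2 * g0 - f0 * g2) * x * y + (f1 * g0 - f0 * g1) * y\<^sup>2"
  by (simp add: jac_def)

lemma (in comm_ring_hom) hom_res: "hom (res f g) = res (map3 hom f) (map3 hom g)"
  by (cases f; cases g) (simp add: hom_distribs)

lemma (in comm_ring_hom) hom_jac: "hom (jac f g x y) = jac (map3 hom f) (map3 hom g) (hom x) (hom y)"
  by (cases f; cases g) (simp add: hom_distribs)

lemma comm_ring_hom_const: "comm_ring_hom (\<lambda>c :: 'a :: comm_ring_1. [:c:])"
  by unfold_locales (auto simp: one_pCons)

lemma comm_ring_hom_poly: "comm_ring_hom (\<lambda>p :: 'a :: comm_ring_1 poly. poly p x)"
  by unfold_locales auto

lemma poly_pq: "poly (pq f) x = qf f x 1"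
  by (cases f) (simp add: power2_eq_square algebra_simps)

lemma map3_ident_map3 [simp]: "map3 (\<lambda>x. x) f = f" "map3 h (map3 k f) = map3 (\<lambda>x. h (k x)) f"
  by (cases f; simp)+

lemma pderiv_pq: "pderiv (pq f) * pq g - pq f * pderiv (pq g) = jac (cst f) (cst g) [:0, 1:] 1"
  by (cases f; cases g) (simp add: pderiv_pCons power2_eq_square numeral_poly algebra_simps)

lemma prime_dvd_qmap:
  fixes f g :: "'a :: {factorial_semiring, idom} \<times> 'a \<times> 'a"
  assumes p: "prime_elem p" and r: "\<not> p dvd res f g" and d: "p dvd qf f x y" "p dvd qf g x y"
  shows "p dvd x \<and> p dvd y"
proof -
  obtain f0 f1 f2 where f: "f = (f0, f1, f2)" by (cases f)
  obtain g0 g1 g2 where g: "g = (g0, g1, g2)" by (cases g)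
  define F G where "F = f0 * y\<^sup>2 + f1 * x * y + f2 * x\<^sup>2" "G = g0 * y\<^sup>2 + g1 * x * y + g2 * x\<^sup>2"
  have FG: "p dvd F" "p dvd G" using d by (simp_all add: f g F_G_def)
  \<comment> \<open>The combinations \<open>g0 * F - f0 * G\<close> and
    \<open>f2 * G - g2 * F\<close> lack the y^2 and the x^2 term respectively; one more elimination
    leaves the resultant.\<close>
  have 1: "res f g * x\<^sup>2 * y = (f2 * g0 - f0 * g2) * y * (g0 * F - f0 * G) - (f1 * g0 - f0 * g1) * x * (f2 * G - g2 * F)"
    by (simp add: f g F_G_def power2_eq_square algebra_simps)
  have 2: "p dvd g0 * F - f0 * G" "p dvd f2 * G - g2 * F"
    by (rule dvd_diff; rule dvd_mult; rule FG)+
  have "p dvd res f g * x\<^sup>2 * y" unfolding 1 by (rule dvd_diff; rule dvd_mult; rule 2)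
  hence xy: "p dvd x \<or> p dvd y"
    using p r by (auto simp: prime_elem_dvd_mult_iff dest: prime_elem_dvd_power)
  show ?thesis
  proof (cases "p dvd x")
    case True
    have "p dvd F - (f1 * x * y + f2 * x\<^sup>2)" "p dvd G - (g1 * x * y + g2 * x\<^sup>2)"
      using FG True by (auto intro!: dvd_diff dvd_add simp: power2_eq_square)
    hence "p dvd f0 * y\<^sup>2" "p dvd g0 * y\<^sup>2" by (simp_all add: F_G_def)
    moreover have "\<not> (p dvd f0 \<and> p dvd g0)"
    proof
      assume "p dvd f0 \<and> p dvd g0"
      hence "p dvd res f g" by (auto simp: f g power2_eq_square intro!: dvd_diff dvd_mult dvd_mult2)
      with r show False by simp
    qed
    ultimately have "p dvd y\<^sup>2" using p by (auto simp: prime_elem_dvd_mult_iff)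
    thus ?thesis using True prime_elem_dvd_power[OF p] by blast
  next
    case False
    hence y: "p dvd y" using xy by blast
    have "p dvd F - (f1 * x * y + f0 * y\<^sup>2)" "p dvd G - (g1 * x * y + g0 * y\<^sup>2)"
      using FG y by (auto intro!: dvd_diff dvd_add simp: power2_eq_square)
    hence "p dvd f2 * x\<^sup>2" "p dvd g2 * x\<^sup>2" by (simp_all add: F_G_def algebra_simps)
    moreover have "\<not> (p dvd f2 \<and> p dvd g2)"
    proof
      assume "p dvd f2 \<and> p dvd g2"
      hence "p dvd res f g" by (auto simp: f g power2_eq_square intro!: dvd_diff dvd_mult dvd_mult2)
      with r show False by simp
    qed
    ultimately have "p dvd x\<^sup>2" using p by (auto simp: prime_elem_dvd_mult_iff)
    thus ?thesis using False prime_elem_dvd_power[OF p] by blast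
  qed
qed

lemma coprime_if_no_prime:
  fixes a b :: "'a :: {factorial_semiring_gcd}"
  assumes "\<And>p. prime_elem p \<Longrightarrow> p dvd a \<Longrightarrow> p dvd b \<Longrightarrow> False" "a \<noteq> 0 \<or> b \<noteq> 0"
  shows "coprime a b"
proof (rule ccontr)
  assume "\<not> coprime a b"
  hence "\<not> is_unit (gcd a b)" using is_unit_gcd[of a b] by blast
  moreover have "gcd a b \<noteq> 0" using assms(2) by simp
  ultimately obtain p where "prime p" "p dvd gcd a b" using prime_divisor_exists by blast
  thus False using assms(1)[of p] by auto
qed

lemma const_prime_not_dvd:
  fixes p :: "'k :: field_gcd poly"
  assumes "prime_elem p" "c \<noteq> 0"
  shows "\<not> p dvd [:c:]"
proof
  assume "p dvd [:c:]"
  moreover have "is_unit [:c:]" using assms(2) by (simp add: is_unit_const_poly_iff dvd_field_iff)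
  ultimately show False using assms(1) dvd_trans unfolding prime_elem_def by blast
qed

lemma coprime_pq:
  fixes f g :: "'k :: field_gcd \<times> 'k \<times> 'k"
  assumes "res f g \<noteq> 0"
  shows "coprime (pq f) (pq g)"
proof (rule coprime_if_no_prime)
  show "pq f \<noteq> 0 \<or> pq g \<noteq> 0" using assms by (cases f; cases g) (auto simp: pCons_eq_0_iff)
  fix p :: "'k poly" assume p: "prime_elem p" "p dvd pq f" "p dvd pq g"
  have "res (cst f) (cst g) = [:res f g:]"
    by (simp add: comm_ring_hom.hom_res[OF comm_ring_hom_const, of f g])
  hence "\<not> p dvd res (cst f) (cst g)" using const_prime_not_dvd[OF p(1) assms] by simp
  moreover have "qf (cst f) [:0, 1:] 1 = pq f" "qf (cst g) [:0, 1:] 1 = pq g"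
    by (cases f; cases g; simp add: power2_eq_square)+
  ultimately have "p dvd 1" using prime_dvd_qmap[OF p(1), of "cst f" "cst g" "[:0, 1:]" 1] p by simp
  thus False using p(1) unfolding prime_elem_def by blast
qed

definition rf_q :: "'k :: field \<times> 'k \<times> 'k \<Rightarrow> 'k \<times> 'k \<times> 'k \<Rightarrow> 'k poly fract" where
  "rf_q f g = Fract (pq f) (pq g)"

lemma comm_ring_hom_to_fract_const: "comm_ring_hom (\<lambda>c :: 'k :: field. to_fract [:c:])"
proof
  fix x y :: 'k
  have "[:x + y:] = [:x:] + [:y:]" "[:x * y:] = [:x:] * [:y:]" "[:1:] = (1 :: 'k poly)" by simp_all
  thus "to_fract [:x + y:] = to_fract [:x:] + to_fract [:y:]"
    "to_fract [:x * y:] = to_fract [:x:] * to_fract [:y:]" "to_fract [:1 :: 'k:] = 1"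
    by (simp_all only: to_fract_add to_fract_mult to_fract_1)
qed simp

text \<open>By homogeneity, clearing denominators multiplies numerator and denominator of the
  composition by the same factor.\<close>

lemma rf_comp_Fract:
  fixes f g :: "'k :: field_gcd \<times> 'k \<times> 'k"
  assumes "coprime (pq f) (pq g)" "pq g \<noteq> 0" "Q \<noteq> 0"
  shows "rf_comp (rf_q f g) (Fract P Q) = Fract (qf (cst f) P Q) (qf (cst g) P Q)"
proof -
  obtain c where c: "c \<noteq> 0" "rf_num (Fract (pq f) (pq g)) = smult c (pq f)"
      "rf_den (Fract (pq f) (pq g)) = smult c (pq g)"
    by (rule rf_Fract[OF assms(1,2)])
  have ev: "poly (map_poly (\<lambda>c. to_fract [:c:]) (smult c (pq h))) (Fract P Q) =
      to_fract [:c:] / (to_fract Q)\<^sup>2 * to_fract (qf (cst h) P Q)" for h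
  proof -
    obtain h0 h1 h2 where h: "h = (h0, h1, h2)" by (cases h)
    interpret t: comm_ring_hom "\<lambda>c :: 'k. to_fract [:c:]" by (rule comm_ring_hom_to_fract_const)
    have "poly (map_poly (\<lambda>c. to_fract [:c:]) (smult c (pq h))) t =
      to_fract [:c:] * (to_fract [:h0:] + t * (to_fract [:h1:] + t * to_fract [:h2:]))" for t :: "'k poly fract"
      by (simp only: h pq_simp t.map_poly_hom_smult poly_smult t.map_poly_pCons_hom poly_pCons map_poly_0 poly_0 mult_zero_right add_0_right)
    moreover have "to_fract (smult k Y) = to_fract [:k:] * to_fract Y" for k :: 'k and Y
    proof -
      have "smult k Y = [:k:] * Y" by simp
      thus ?thesis by (simp only: to_fract_mult)
    qed
    ultimately show ?thesis using assms(3)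
      by (simp add: h Fract_conv_to_fract power2_eq_square field_simps)
  qed
  show ?thesis unfolding rf_comp_def rf_q_def c(2,3) ev using c(1) assms(3)
    by (simp add: Fract_conv_to_fract)
qed

subsection \<open>Periodic-point polynomials\<close>

lemma qit_cong:
  assumes "p dvd x - x'" "p dvd y - y'"
  shows "p dvd fst (qit f g d (x, y)) - fst (qit f g d (x', y'))"
    and "p dvd snd (qit f g d (x, y)) - snd (qit f g d (x', y'))"
proof -
  have qf: "p dvd qf h a b - qf h a' b'" if "p dvd a - a'" "p dvd b - b'" for h a b a' b'
  proof -
    obtain h0 h1 h2 where h: "h = (h0, h1, h2)" by (cases h)
    have "qf h a b - qf h a' b' = (a - a') * (h1 * b + h2 * (a + a')) + (b - b') * (h0 * (b + b') + h1 * a')"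
      by (simp add: h power2_eq_square algebra_simps)
    thus ?thesis using that by simp
  qed
  have "p dvd fst (qit f g d (x, y)) - fst (qit f g d (x', y')) \<and>
        p dvd snd (qit f g d (x, y)) - snd (qit f g d (x', y'))"
  proof (induction d)
    case (Suc d)
    thus ?case using qf unfolding fst_qit_Suc snd_qit_Suc by blast
  qed (use assms in simp)
  thus "p dvd fst (qit f g d (x, y)) - fst (qit f g d (x', y'))"
    "p dvd snd (qit f g d (x, y)) - snd (qit f g d (x', y'))" by blast+
qed

text \<open>The homogeneous iterates of the generic point [x : 1], i.e. numerator and denominator of
  the d-th iterate as polynomials in x.\<close>

definition pit where "pit f g d = qit (cst f) (cst g) d ([:0, 1:], 1)"

definition per_poly where "per_poly f g d = [:0, 1:] * snd (pit f g d) - fst (pit f g d)"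

text \<open>The wedge product of a vector with its d-th iterate: a form of degree 2^d + 1 that
  vanishes at the points fixed by the d-th iterate. \<open>per_poly\<close> is its
  dehomogenisation.\<close>

definition per_form where
  "per_form f g d x y = x * snd (qit f g d (x, y)) - y * fst (qit f g d (x, y))"

lemma poly_pit:
  "poly (fst (pit f g d)) x = fst (qit f g d (x, 1))" "poly (snd (pit f g d)) x = snd (qit f g d (x, 1))"
  unfolding pit_def
  by (simp_all add: comm_ring_hom.hom_fst_qit[OF comm_ring_hom_poly] comm_ring_hom.hom_snd_qit[OF comm_ring_hom_poly])

lemma poly_per_poly: "poly (per_poly f g d) x = per_form f g d x 1"
  by (simp add: per_poly_def per_form_def poly_pit)

lemma per_form_scale: "per_form f g d (c * x) (c * y) = c ^ (2 ^ d + 1) * per_form f g d x y"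
  unfolding per_form_def qit_scale by (simp add: algebra_simps)

lemma coeff_mult_bound:
  assumes "degree p \<le> m" "degree q \<le> n"
  shows "coeff (p * q) (m + n) = coeff p m * coeff q n"
proof (cases "degree p = m \<and> degree q = n")
  case True
  thus ?thesis using coeff_mult_degree_sum by blast
next
  case False
  hence "degree p + degree q < m + n" using assms by linarith
  hence "degree (p * q) < m + n" using degree_mult_le[of p q] by linarith
  hence "coeff (p * q) (m + n) = 0" by (rule coeff_eq_0)
  moreover have "coeff p m = 0 \<or> coeff q n = 0" using False assms
    using coeff_eq_0[of p m] coeff_eq_0[of q n] by linarith
  ultimately show ?thesis by auto
qed

text \<open>The coefficient of x^(2^d) is the value of the form at [1 : 0], so the top coefficients
  of the iterates record the orbit of \<infinity>.\<close>

lemma pit_degree: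
  fixes f g :: "'a :: comm_ring_1 \<times> 'a \<times> 'a"
  shows
  "degree (fst (pit f g d)) \<le> 2 ^ d" "degree (snd (pit f g d)) \<le> 2 ^ d"
  "coeff (fst (pit f g d)) (2 ^ d) = fst (qit f g d (1, 0))"
  "coeff (snd (pit f g d)) (2 ^ d) = snd (qit f g d (1, 0))"
proof -
  have "degree (fst (pit f g d)) \<le> 2 ^ d \<and> degree (snd (pit f g d)) \<le> 2 ^ d \<and>
    coeff (fst (pit f g d)) (2 ^ d) = fst (qit f g d (1, 0)) \<and>
    coeff (snd (pit f g d)) (2 ^ d) = snd (qit f g d (1, 0))"
  proof (induction d)
    case (Suc d)
    define P Q where "P = fst (pit f g d)" "Q = snd (pit f g d)"
    have dg: "degree P \<le> 2 ^ d" "degree Q \<le> 2 ^ d" using Suc by (simp_all add: P_Q_def)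
    have step: "degree (qf (cst h) P Q) \<le> 2 ^ Suc d \<and>
        coeff (qf (cst h) P Q) (2 ^ Suc d) = qf h (coeff P (2 ^ d)) (coeff Q (2 ^ d))" for h
    proof -
      obtain a b c where h: "h = (a, b, c)" by (cases h)
      have e: "qf (cst h) P Q = smult a (Q * Q) + smult b (P * Q) + smult c (P * P)"
        by (simp add: h power2_eq_square)
      have two: "2 ^ Suc d = (2 ^ d + 2 ^ d :: nat)" by simp
      have m: "degree (R * S) \<le> 2 ^ d + 2 ^ d" "coeff (R * S) (2 ^ d + 2 ^ d) = coeff R (2 ^ d) * coeff S (2 ^ d)"
        if "degree R \<le> 2 ^ d" "degree S \<le> 2 ^ d" for R S :: "'a poly"
        using that degree_mult_le[of R S] coeff_mult_bound[OF that] by linarith+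
      show ?thesis unfolding e two
      proof
        show "degree (smult a (Q * Q) + smult b (P * Q) + smult c (P * P)) \<le> 2 ^ d + 2 ^ d"
          by (intro degree_add_le order_trans[OF degree_smult_le] m dg)
        show "coeff (smult a (Q * Q) + smult b (P * Q) + smult c (P * P)) (2 ^ d + 2 ^ d) =
            qf h (coeff P (2 ^ d)) (coeff Q (2 ^ d))"
          by (simp only: coeff_add coeff_smult m dg) (simp add: h power2_eq_square)
      qed
    qed
    have "pit f g (Suc d) = qmap (cst f) (cst g) (P, Q)" by (simp add: pit_def qit_Suc P_Q_def)
    thus ?case using step Suc.IH by (simp add: P_Q_def qit_Suc qmap_def)
  qed (simp add: pit_def)
  thus "degree (fst (pit f g d)) \<le> 2 ^ d" "degree (snd (pit f g d)) \<le> 2 ^ d"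
    "coeff (fst (pit f g d)) (2 ^ d) = fst (qit f g d (1, 0))"
    "coeff (snd (pit f g d)) (2 ^ d) = snd (qit f g d (1, 0))" by blast+
qed

lemma per_poly_degree:
  assumes "snd (qit f g d (1, 0)) \<noteq> 0"
  shows "degree (per_poly f g d) = 2 ^ d + 1" "lead_coeff (per_poly f g d) = snd (qit f g d (1, 0))"
    "per_poly f g d \<noteq> 0"
proof -
  have "coeff (fst (pit f g d)) (2 ^ d + 1) = 0"
    by (rule coeff_eq_0) (use pit_degree(1)[of f g d] in linarith)
  hence c: "coeff (per_poly f g d) (2 ^ d + 1) = snd (qit f g d (1, 0))"
    by (simp add: per_poly_def pit_degree)
  have le: "degree (per_poly f g d) \<le> 2 ^ d + 1"
    unfolding per_poly_def using pit_degree(1,2)[of f g d]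
    by (intro degree_diff_le) (auto intro!: order_trans[OF degree_pCons_le])
  show deg: "degree (per_poly f g d) = 2 ^ d + 1"
    using le le_degree[of "per_poly f g d" "2 ^ d + 1"] c assms by simp
  thus "lead_coeff (per_poly f g d) = snd (qit f g d (1, 0))" using c by simp
  thus "per_poly f g d \<noteq> 0" using assms by auto
qed

lemma pit_coprime:
  fixes f g :: "'k :: field_gcd \<times> 'k \<times> 'k"
  assumes "res f g \<noteq> 0"
  shows "coprime (fst (pit f g d)) (snd (pit f g d))"
proof -
  have no: "\<not> (p dvd fst (pit f g d) \<and> p dvd snd (pit f g d))" if p: "prime_elem p" for p
  proof (induction d)
    case 0
    have "snd (pit f g 0) = 1" by (simp add: pit_def)
    thus ?case using p unfolding prime_elem_def by metis
  next
    case (Suc d)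
    have "res (cst f) (cst g) = [:res f g:]"
      by (simp add: comm_ring_hom.hom_res[OF comm_ring_hom_const, of f g])
    hence "\<not> p dvd res (cst f) (cst g)" using const_prime_not_dvd[OF p assms] by simp
    from prime_dvd_qmap[OF p this] Suc show ?case
      unfolding pit_def fst_qit_Suc snd_qit_Suc by blast
  qed
  have "fst (pit f g d) \<noteq> 0 \<or> snd (pit f g d) \<noteq> 0"
  proof (rule ccontr)
    assume "\<not> ?thesis"
    moreover have "prime_elem ([:0, 1:] :: 'k poly)" by (rule prime_elem_linear_field_poly) simp
    ultimately show False using no[of "[:0, 1:]"] by auto
  qed
  thus ?thesis using coprime_if_no_prime[of "fst (pit f g d)" "snd (pit f g d)"] no by blast
qed

lemma (in comm_ring_hom) comm_ring_hom_map_poly: "comm_ring_hom (map_poly hom)"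
proof -
  interpret p: map_poly_comm_ring_hom hom ..
  show ?thesis by (rule p.comm_ring_hom_axioms)
qed

lemma (in comm_ring_hom) map_poly_per_poly: "map_poly hom (per_poly f g d) = per_poly (map3 hom f) (map3 hom g) d"
proof -
  interpret m: comm_ring_hom "map_poly hom" by (rule comm_ring_hom_map_poly)
  have c: "map3 (map_poly hom) (cst h) = cst (map3 hom h)" for h
    by (cases h) (simp add: hom_distribs)
  have X: "map_poly hom [:0, 1:] = [:0, 1:]" by (simp add: hom_distribs)
  show ?thesis unfolding per_poly_def pit_def
    by (simp only: m.hom_minus m.hom_mult m.hom_fst_qit m.hom_snd_qit c map_prod_simp X m.hom_one)
qed

text \<open>The assumption \<open>infty\<close> says that \<infinity> is not periodic, so that no
  periodic point is lost on dehomogenising and all degrees are known.\<close>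

locale quad_map =
  fixes f g :: "'k :: {field_gcd, field_char_0} \<times> 'k \<times> 'k"
  assumes res: "res f g \<noteq> 0"
    and infty: "\<And>d. d > 0 \<Longrightarrow> snd (qit f g d (1, 0)) \<noteq> 0"
begin

abbreviation \<phi> where "\<phi> \<equiv> rf_q f g"
abbreviation PP where "PP \<equiv> per_poly f g"

lemma pq_g_nonzero: "pq g \<noteq> 0"
  using infty[of 1] by (cases g) (simp add: qit_Suc)

lemma snd_pit_nonzero: "snd (pit f g d) \<noteq> 0"
proof (cases "d = 0")
  case False
  thus ?thesis using infty[of d] pit_degree(4)[of f g d] by auto
qed (simp add: pit_def)

lemma rf_iter_eq: "rf_iter d \<phi> = Fract (fst (pit f g d)) (snd (pit f g d))"
proof (induction d)
  case 0
  show ?case by (simp add: rf_iter_def rf_X_def pit_def to_fract_def)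
next
  case (Suc d)
  have "rf_iter (Suc d) \<phi> = rf_comp \<phi> (Fract (fst (pit f g d)) (snd (pit f g d)))"
    using Suc by (simp add: rf_iter_def)
  also have "\<dots> = Fract (qf (cst f) (fst (pit f g d)) (snd (pit f g d))) (qf (cst g) (fst (pit f g d)) (snd (pit f g d)))"
    by (rule rf_comp_Fract[OF coprime_pq[OF res] pq_g_nonzero snd_pit_nonzero])
  finally show ?case by (simp add: pit_def fst_qit_Suc snd_qit_Suc)
qed

lemma rf_iter_scaled:
  obtains c where "c \<noteq> 0"
    "[:0, 1:] * rf_den (rf_iter d \<phi>) - rf_num (rf_iter d \<phi>) = smult c (PP d)"
proof -
  obtain c where "c \<noteq> 0" "rf_num (rf_iter d \<phi>) = smult c (fst (pit f g d))"
      "rf_den (rf_iter d \<phi>) = smult c (snd (pit f g d))"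
    unfolding rf_iter_eq by (rule rf_Fract[OF pit_coprime[OF res] snd_pit_nonzero])
  thus ?thesis using that by (simp add: per_poly_def smult_diff_right)
qed

text \<open>Modulo a prime factor of \<open>PP m\<close> the m-th iterate sends (x, 1) to Q (x, 1);
  homogeneity turns the scalar Q into a power of Q, which p does not divide because P and Q are
  coprime.\<close>

lemma PP_shift:
  assumes "prime_elem p" "p dvd PP m"
  shows "p dvd PP (m + j) \<longleftrightarrow> p dvd PP j"
proof -
  define P Q where "P = fst (pit f g m)" "Q = snd (pit f g m)"
  let ?F = "cst f" and ?G = "cst g"
  have "p dvd P - Q * [:0, 1:]" "p dvd Q - Q * 1"
    using assms(2) dvd_minus_iff[of p "PP m"] by (simp_all add: per_poly_def P_Q_def mult.commute)
  note c = qit_cong[OF this, of ?F ?G j]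
  have pm: "pit f g (m + j) = qit ?F ?G j (P, Q)" by (simp add: pit_def qit_add P_Q_def)
  have pj: "qit ?F ?G j (Q * [:0, 1:], Q * 1) = (Q ^ 2 ^ j * fst (pit f g j), Q ^ 2 ^ j * snd (pit f g j))"
    unfolding qit_scale by (simp add: pit_def)
  have "p dvd [:0, 1:] * (snd (pit f g (m + j)) - Q ^ 2 ^ j * snd (pit f g j)) -
        (fst (pit f g (m + j)) - Q ^ 2 ^ j * fst (pit f g j))"
    by (rule dvd_diff[OF dvd_mult[OF c(2)] c(1), unfolded pm[symmetric] pj fst_conv snd_conv])
  also have "[:0, 1:] * (snd (pit f g (m + j)) - Q ^ 2 ^ j * snd (pit f g j)) -
        (fst (pit f g (m + j)) - Q ^ 2 ^ j * fst (pit f g j)) = PP (m + j) - Q ^ 2 ^ j * PP j"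
    by (simp add: per_poly_def algebra_simps)
  finally have d: "p dvd PP (m + j) - Q ^ 2 ^ j * PP j" .
  have "\<not> p dvd Q"
  proof
    assume "p dvd Q"
    hence "p dvd Q * [:0, 1:]" by (rule dvd_mult2)
    hence "p dvd (P - Q * [:0, 1:]) + Q * [:0, 1:]"
      using \<open>p dvd P - Q * [:0, 1:]\<close> by (rule dvd_add[rotated])
    hence "p dvd P" by simp
    hence "p dvd 1" using \<open>p dvd Q\<close> pit_coprime[OF res, of m] unfolding P_Q_def coprime_def by blast
    thus False using assms(1) unfolding prime_elem_def by blast
  qed
  hence "\<not> p dvd Q ^ 2 ^ j" using prime_elem_dvd_power[OF assms(1)] by blast
  hence "p dvd Q ^ 2 ^ j * PP j \<longleftrightarrow> p dvd PP j" using assms(1) by (simp add: prime_elem_dvd_mult_iff)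
  moreover have "p dvd PP (m + j) \<longleftrightarrow> p dvd Q ^ 2 ^ j * PP j"
    using dvd_add_right_iff[OF d, of "Q ^ 2 ^ j * PP j"] by simp
  ultimately show ?thesis by simp
qed

end

text \<open>Separability makes all multiplicities 0 or 1; then \<open>PP_shift\<close>, which only
  speaks of divisibility, already gives rigid divisibility.\<close>

locale separable_quad_map = quad_map f g
  for f g :: "'k :: {field_gcd, field_char_0} \<times> 'k \<times> 'k" +
  assumes sep: "\<And>d. d > 0 \<Longrightarrow> coprime (PP d) (pderiv (PP d))"
begin

lemma PP_nonzero: "d > 0 \<Longrightarrow> PP d \<noteq> 0"
  using per_poly_degree(3) infty by blast

lemma multiplicity_PP:
  assumes p: "prime_elem p" and d: "d > 0"
  shows "multiplicity p (PP d) = (if p dvd PP d then 1 else 0)"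
proof -
  have "\<not> p\<^sup>2 dvd PP d"
  proof
    assume "p\<^sup>2 dvd PP d"
    then obtain q where "PP d = p\<^sup>2 * q" by (elim dvdE)
    hence q: "PP d = p * (p * q)" by (simp add: power2_eq_square mult.assoc)
    hence "pderiv (PP d) = p * (pderiv (p * q) + pderiv p * q)"
      by (simp add: pderiv_mult algebra_simps)
    hence "p dvd PP d" "p dvd pderiv (PP d)" using q by simp_all
    hence "p dvd 1" using sep[OF d] unfolding coprime_def by blast
    thus False using p unfolding prime_elem_def by blast
  qed
  hence "\<not> multiplicity p (PP d) \<ge> 2" using multiplicity_dvd'[of 2 p "PP d"] by blast
  moreover have "multiplicity p (PP d) > 0 \<longleftrightarrow> p dvd PP d"
    by (rule prime_multiplicity_gt_zero_iff[OF p PP_nonzero[OF d]])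
  ultimately show ?thesis by auto
qed

lemma PP_rigid:
  assumes p: "prime_elem p"
  shows "\<exists>m e. rigid_at p PP m e"
proof (rule rigid_at_ex[OF p PP_nonzero])
  fix m j :: nat assume "m > 0" "j > 0" "p dvd PP m"
  thus "multiplicity p (PP (m + j)) = multiplicity p (PP j)"
    using multiplicity_PP[OF p] PP_shift[OF p] by simp
qed

text \<open>The reduced numerator and denominator of an iterate are determined only up to a common
  constant; \<open>scale\<close> records the constants that enter the dynatomic polynomial.\<close>

definition scale where
  "scale d = (SOME c. c \<noteq> 0 \<and> [:0, 1:] * rf_den (rf_iter d \<phi>) - rf_num (rf_iter d \<phi>) = smult c (PP d))"

lemma scale: "scale d \<noteq> 0" "[:0, 1:] * rf_den (rf_iter d \<phi>) - rf_num (rf_iter d \<phi>) = smult (scale d) (PP d)"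
proof -
  have "\<exists>c. c \<noteq> 0 \<and> [:0, 1:] * rf_den (rf_iter d \<phi>) - rf_num (rf_iter d \<phi>) = smult c (PP d)"
    by (rule rf_iter_scaled[of d]) blast
  from someI_ex[OF this] show "scale d \<noteq> 0"
    "[:0, 1:] * rf_den (rf_iter d \<phi>) - rf_num (rf_iter d \<phi>) = smult (scale d) (PP d)"
    by (simp_all add: scale_def)
qed

lemma dynatomic_mult:
  assumes n: "n > 0"
  obtains c where "c \<noteq> 0" "dynatomic n \<phi> * mob_neg n PP = smult c (mob_pos n PP)"
proof -
  define Ps where "Ps d = smult (scale d) (PP d)" for d
  have mob_smult: "mob_pos n Ps = smult (mob_pos n scale) (mob_pos n PP)"
    "mob_neg n Ps = smult (mob_neg n scale) (mob_neg n PP)"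
    unfolding mob_pos_def mob_neg_def Ps_def
    by (simp_all add: prod_smult)
  have s: "mob_pos n scale \<noteq> 0" "mob_neg n scale \<noteq> 0"
    by (rule mob_nonzero[OF scale(1) n])+
  obtain A where A: "A * mob_neg n PP = mob_pos n PP"
    by (rule mob_quotient[OF n PP_nonzero PP_rigid])
  define c where "c = mob_pos n scale / mob_neg n scale"
  have cA: "smult c A * mob_neg n Ps = mob_pos n Ps"
    using A s by (simp add: mob_smult c_def mult_smult_left)
  have t: "comm_ring_hom (to_fract :: 'k poly \<Rightarrow> _)" by unfold_locales auto
  have nz: "to_fract (Ps d) \<noteq> 0" if "d > 0" for d
    using PP_nonzero[OF that] scale(1) by (simp add: Ps_def)
  have "to_fract (smult c A) = (\<Prod>d | d dvd n. to_fract (Ps d) powi moebius (n div d))"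
  proof -
    have "to_fract (smult c A) * mob_neg n (\<lambda>d. to_fract (Ps d)) = mob_pos n (\<lambda>d. to_fract (Ps d))"
      unfolding comm_ring_hom.hom_mob[OF t, symmetric] by (simp only: cA flip: to_fract_mult)
    also have "\<dots> = (\<Prod>d | d dvd n. to_fract (Ps d) powi moebius (n div d)) * mob_neg n (\<lambda>d. to_fract (Ps d))"
      by (rule prod_powi_moebius[symmetric, OF n nz])
    finally show ?thesis using mob_nonzero(2)[OF nz n] by simp
  qed
  note eq = this
  have "dynatomic n \<phi> = smult c A"
    unfolding dynatomic_def scale(2) Ps_def[symmetric]
  proof (rule the_equality)
    fix q assume "to_fract q = (\<Prod>d | d dvd n. to_fract (Ps d) powi moebius (n div d))"
    hence "to_fract q = to_fract (smult c A)" by (simp only: eq)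
    thus "q = smult c A" by (simp only: to_fract_eq_iff)
  qed (rule eq)
  moreover have "c \<noteq> 0" using s by (simp add: c_def)
  ultimately show ?thesis using that[of c] A by simp
qed

lemma dynatomic_nonzero:
  assumes n: "n > 0"
  shows "dynatomic n \<phi> \<noteq> 0"
proof
  assume 0: "dynatomic n \<phi> = 0"
  obtain c where "c \<noteq> 0" "dynatomic n \<phi> * mob_neg n PP = smult c (mob_pos n PP)"
    by (rule dynatomic_mult[OF n])
  thus False using mob_nonzero(1)[OF PP_nonzero n] by (simp add: 0)
qed

text \<open>In characteristic 0 a prime p does not divide its own derivative, so a common factor p
  would occur twice. But at p the Moebius quotient of the squarefree \<open>PP d\<close> has
  multiplicity at most 1.\<close>

lemma dynatomic_coprime_pderiv:
  assumes n: "n > 0"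
  shows "coprime (dynatomic n \<phi>) (pderiv (dynatomic n \<phi>))"
proof (rule coprime_if_no_prime)
  show "dynatomic n \<phi> \<noteq> 0 \<or> pderiv (dynatomic n \<phi>) \<noteq> 0" using dynatomic_nonzero[OF n] by blast
  fix p assume p: "prime_elem p" "p dvd dynatomic n \<phi>" "p dvd pderiv (dynatomic n \<phi>)"
  obtain c where c: "c \<noteq> 0" "dynatomic n \<phi> * mob_neg n PP = smult c (mob_pos n PP)"
    by (rule dynatomic_mult[OF n])
  obtain m e where r: "rigid_at p PP m e" using PP_rigid[OF p(1)] by blast
  have "smult (1 / c) (dynatomic n \<phi>) * mob_neg n PP = mob_pos n PP" using c by simp
  note mq = multiplicity_mob_quotient[OF n p(1) PP_nonzero r this]
  have "multiplicity p (smult (1 / c) (dynatomic n \<phi>)) \<le> 1"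
  proof (cases "m = n")
    case True
    have "e = multiplicity p (PP m)" using r n True by (auto simp: rigid_at_def)
    also have "\<dots> \<le> 1" using multiplicity_PP[OF p(1), of m] n True by simp
    finally show ?thesis using mq(2) by simp
  qed (use mq(2) in simp)
  moreover obtain q where q: "dynatomic n \<phi> = p * q" using p(2) by blast
  have "p dvd q"
  proof -
    have "pderiv (dynatomic n \<phi>) = p * pderiv q + pderiv p * q" by (simp add: q pderiv_mult algebra_simps)
    hence "p dvd pderiv p * q" using p(3) dvd_add_right_iff[of p "p * pderiv q" "pderiv p * q"] by simp
    moreover have "\<not> p dvd pderiv p"
    proof
      assume "p dvd pderiv p"
      have "degree p > 0"
      proof (rule ccontr)
        assume "\<not> degree p > 0"
        then obtain k where "p = [:k:]" using degree_eq_zeroE[of p] by blast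
        thus False using p(1) by (auto simp: prime_elem_def is_unit_const_poly_iff dvd_field_iff)
      qed
      moreover from this have "pderiv p \<noteq> 0" by (simp add: pderiv_eq_0_iff)
      ultimately have "degree p \<le> degree (pderiv p)" using \<open>p dvd pderiv p\<close> dvd_imp_degree_le by blast
      thus False using \<open>degree p > 0\<close> by (simp add: degree_pderiv)
    qed
    ultimately show ?thesis using p(1) by (simp add: prime_elem_dvd_mult_iff)
  qed
  then obtain q' where "q = p * q'" by blast
  hence "p ^ 2 dvd smult (1 / c) (dynatomic n \<phi>)" using q
    by (intro dvd_smult) (simp add: power2_eq_square mult.assoc[symmetric])
  hence "2 \<le> multiplicity p (smult (1 / c) (dynatomic n \<phi>))"
    using mq(1) p(1) by (intro multiplicity_geI) (auto simp: prime_elem_def)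
  ultimately show False by simp
qed

end

subsection \<open>Products of multipliers over periodic points\<close>

lemma per_poly_prod:
  fixes f g :: "'l :: alg_closed_field \<times> 'l \<times> 'l"
  assumes l: "snd (qit f g d (1, 0)) \<noteq> 0"
  shows "(\<Prod>x\<in>#proots (per_poly f g d). c - x) = per_form f g d c 1 / snd (qit f g d (1, 0))"
    and "size (proots (per_poly f g d)) = 2 ^ d + 1"
proof -
  note deg = per_poly_degree[OF l]
  have "per_form f g d c 1 = snd (qit f g d (1, 0)) * (\<Prod>x\<in>#proots (per_poly f g d). c - x)"
    using poly_alg_closed_eq_prod[OF deg(3), of c] unfolding deg(2) poly_per_poly .
  thus "(\<Prod>x\<in>#proots (per_poly f g d). c - x) = per_form f g d c 1 / snd (qit f g d (1, 0))"
    using l by simp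
  show "size (proots (per_poly f g d)) = 2 ^ d + 1"
    using alg_closed_proots_factor(2)[OF deg(3)] deg by simp
qed

lemma per_poly_prod_linear:
  fixes f g :: "'l :: alg_closed_field \<times> 'l \<times> 'l"
  assumes l: "snd (qit f g d (1, 0)) \<noteq> 0" and w: "w \<noteq> 0"
  shows "(\<Prod>x\<in>#proots (per_poly f g d). v - w * x) = per_form f g d v w / snd (qit f g d (1, 0))"
proof -
  have "(\<Prod>x\<in>#proots (per_poly f g d). v - w * x) = (\<Prod>x\<in>#proots (per_poly f g d). w * (v / w - x))"
    using w by (simp add: algebra_simps)
  also have "\<dots> = w ^ (2 ^ d + 1) * (per_form f g d (v / w) 1 / snd (qit f g d (1, 0)))"
    by (simp only: prod_mset_const_mult per_poly_prod[OF l])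
  also have "w ^ (2 ^ d + 1) * per_form f g d (v / w) 1 = per_form f g d v w"
    using per_form_scale[of f g d w "v / w" 1] w by simp
  hence "w ^ (2 ^ d + 1) * (per_form f g d (v / w) 1 / snd (qit f g d (1, 0))) = per_form f g d v w / snd (qit f g d (1, 0))"
    by (simp only: times_divide_eq_right)
  finally show ?thesis .
qed

lemma prod_mset_mult3:
  "(\<Prod>x\<in>#A. c * f x * h x) = c ^ size A * (\<Prod>x\<in>#A. f x) * (\<Prod>x\<in>#A. h x :: 'a :: comm_monoid_mult)"
  by (induction A) (auto simp: mult_ac)

text \<open>If \<open>z\<close> runs over the two poles, \<open>z \<and> \<phi>\<^sup>d(z) = z \<and> \<phi>\<^bsup>d-1\<^esup>(\<infinity>)\<close> up to scaling,
  and the product over both poles is the second coordinate of \<open>\<phi>\<^sup>d(\<infinity>)\<close>.\<close>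

lemma per_poly_prod_den:
  fixes f g :: "'l :: alg_closed_field \<times> 'l \<times> 'l"
  assumes l: "snd (qit f g d (1, 0)) \<noteq> 0" and g: "g = (g0, g1, g2)" "g2 \<noteq> 0" and d: "d > 0"
  shows "(\<Prod>x\<in>#proots (per_poly f g d). qf g x 1) = res f g ^ 2 ^ (d - 1) / snd (qit f g d (1, 0))"
proof -
  obtain f0 f1 f2 where f: "f = (f0, f1, f2)" by (cases f)
  have "degree [:g0, g1, g2:] > 0" using g by simp
  then obtain z1 where z1: "poly [:g0, g1, g2:] z1 = 0" using alg_closed_imp_poly_has_root by blast
  define z2 where "z2 = - g1 / g2 - z1"
  have g1: "g1 = - g2 * (z1 + z2)" using g by (simp add: z2_def field_simps)
  have g0: "g0 = g2 * z1 * z2" using z1 unfolding g1 by (simp add: algebra_simps)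
  have gf: "qf g x y = g2 * (x - z1 * y) * (x - z2 * y)" for x y
    by (simp add: g g0 g1 power2_eq_square algebra_simps)
  obtain e where e: "d = Suc e" using d by (cases d) auto
  define p q where "p = fst (qit f g e (1, 0))" "q = snd (qit f g e (1, 0))"
  define L where "L = snd (qit f g d (1, 0))"
  have L: "L = g2 * (p - z1 * q) * (p - z2 * q)"
    unfolding L_def e snd_qit_Suc gf p_q_def ..
  define F where "F z = qf f z 1" for z
  have pf: "per_form f g d z 1 = F z ^ 2 ^ e * (z * q - p)" if "qf g z 1 = 0" for z
  proof -
    have "qit f g d (z, 1) = qit f g e (F z * 1, F z * 0)"
      using that by (simp add: e qit_Suc' F_def)
    thus ?thesis unfolding per_form_def qit_scale p_q_def by (simp add: algebra_simps)
  qed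
  \<comment> \<open>The resultant as the product of the values of f at the roots of g.\<close>
  have rs: "g2\<^sup>2 * (F z1 * F z2) = res f g"
    unfolding f g res_simp F_def qf_simp g0 g1 by (simp add: power2_eq_square algebra_simps)
  let ?A = "proots (per_poly f g d)"
  define N where "N = (2::nat) ^ d"
  have sz: "size ?A = N + 1" using per_poly_prod(2)[OF l] by (simp add: N_def)
  have minus: "(\<Prod>x\<in>#?A. x - z) = (-1) ^ (N + 1) * (per_form f g d z 1 / L)" for z
  proof -
    have "(\<Prod>x\<in>#?A. x - z) = (\<Prod>x\<in>#?A. (-1) * (z - x))" by simp
    also have "\<dots> = (-1) ^ (N + 1) * (per_form f g d z 1 / L)"
      by (simp only: prod_mset_const_mult per_poly_prod(1)[OF l] sz L_def)
    finally show ?thesis .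
  qed
  have "(\<Prod>x\<in>#?A. qf g x 1) = (\<Prod>x\<in>#?A. g2 * (x - z1) * (x - z2))" by (simp add: gf)
  also have "\<dots> = g2 ^ (N + 1) * (per_form f g d z1 1 / L) * (per_form f g d z2 1 / L)"
    by (simp only: prod_mset_mult3 minus sz) (simp flip: power_add power_mult_distrib add: mult_ac)
  also have "\<dots> = g2 ^ N * (F z1 * F z2) ^ 2 ^ e * (g2 * (p - z1 * q) * (p - z2 * q)) / L\<^sup>2"
    using l by (simp add: pf gf power_mult_distrib power2_eq_square L_def[symmetric] field_simps)
  also have "\<dots> = g2 ^ N * (F z1 * F z2) ^ 2 ^ e / L"
    unfolding L[symmetric] using l by (simp add: L_def power2_eq_square)
  also have "g2 ^ N * (F z1 * F z2) ^ 2 ^ e = res f g ^ 2 ^ e"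
    by (simp add: rs[symmetric] power_mult_distrib N_def e power_mult[symmetric] mult.commute)
  finally show ?thesis by (simp add: e L_def)
qed

text \<open>The derivative of f / g at the affine point x.\<close>

definition mult_at :: "'a :: field \<times> 'a \<times> 'a \<Rightarrow> 'a \<times> 'a \<times> 'a \<Rightarrow> 'a \<Rightarrow> 'a" where
  "mult_at f g x = jac f g x 1 / (qf g x 1)\<^sup>2"

text \<open>Here multipliers turn into critical orbits: the Jacobian splits into linear forms
  vanishing at the critical points [v1 : w1] and [v2 : w2], and the product of v - w x over the
  points fixed by the d-th iterate is the form \<open>per_form\<close> at (v, w), up to the leading
  coefficient L. The powers of L cancel.\<close>

lemma per_poly_prod_mult:
  fixes f g :: "'l :: alg_closed_field \<times> 'l \<times> 'l"
  assumes l: "snd (qit f g d (1, 0)) \<noteq> 0" and g: "g = (g0, g1, g2)" "g2 \<noteq> 0" and d: "d > 0"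
    and j: "\<And>x y. jac f g x y = k * (v1 * y - w1 * x) * (v2 * y - w2 * x)" and w: "w1 \<noteq> 0" "w2 \<noteq> 0"
  shows "(\<Prod>x\<in>#proots (per_poly f g d). mult_at f g x) =
    k ^ (2 ^ d + 1) * per_form f g d v1 w1 * per_form f g d v2 w2 / res f g ^ 2 ^ d"
proof -
  let ?A = "proots (per_poly f g d)"
  define L where "L = snd (qit f g d (1, 0))"
  have div: "(\<Prod>x\<in>#A. a x / (b x)\<^sup>2) = (\<Prod>x\<in>#A. a x) / ((\<Prod>x\<in>#A. b x)\<^sup>2 :: 'l)" for A and a b :: "'l \<Rightarrow> 'l"
    by (induction A) (auto simp: power_mult_distrib)
  have pow: "2 ^ (d - 1) * 2 = (2 :: nat) ^ d" using d by (cases d) auto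
  have "(\<Prod>x\<in>#?A. mult_at f g x) = (\<Prod>x\<in>#?A. jac f g x 1) / (\<Prod>x\<in>#?A. qf g x 1)\<^sup>2"
    unfolding mult_at_def by (rule div)
  also have "(\<Prod>x\<in>#?A. jac f g x 1) = (\<Prod>x\<in>#?A. k * (v1 - w1 * x) * (v2 - w2 * x))" by (simp add: j)
  also have "\<dots> = k ^ (2 ^ d + 1) * (per_form f g d v1 w1 / L) * (per_form f g d v2 w2 / L)"
    by (simp only: prod_mset_mult3 per_poly_prod(2)[OF l] per_poly_prod_linear[OF l w(1)] per_poly_prod_linear[OF l w(2)] L_def)
  also have "(\<Prod>x\<in>#?A. qf g x 1)\<^sup>2 = res f g ^ 2 ^ d / L\<^sup>2"
    by (simp only: per_poly_prod_den[OF l g d] power_divide L_def power_mult[symmetric] pow)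
  also have "k ^ (2 ^ d + 1) * (per_form f g d v1 w1 / L) * (per_form f g d v2 w2 / L) / (res f g ^ 2 ^ d / L\<^sup>2) =
     k ^ (2 ^ d + 1) * per_form f g d v1 w1 * per_form f g d v2 w2 / res f g ^ 2 ^ d"
    using l by (simp add: L_def power2_eq_square)
  finally show ?thesis .
qed

section \<open>Passage to the algebraic closure and the product formula for U\<close>

interpretation ac: inj_comm_ring_hom "to_ac :: 'k :: field \<Rightarrow> _"
  by unfold_locales auto

lemma to_ac_powi: "to_ac (x powi k) = to_ac x powi k"
  by (cases "k \<ge> 0") (auto simp: power_int_def)

lemma coprime_no_common_root:
  fixes a b :: "'k :: field_gcd poly"
  assumes "coprime a b" "poly (map_poly to_ac a) x = 0"
  shows "poly (map_poly to_ac b) x \<noteq> 0"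
proof
  assume b: "poly (map_poly to_ac b) x = 0"
  interpret h: comm_ring_hom "\<lambda>p. poly (map_poly to_ac p) x"
    by (rule comm_ring_hom_poly_map) (rule ac.comm_ring_hom_axioms)
  have "fst (bezout_coefficients a b) * a + snd (bezout_coefficients a b) * b = 1"
    using bezout_coefficients_fst_snd[of a b] assms(1) by simp
  from arg_cong[OF this, of "\<lambda>p. poly (map_poly to_ac p) x"] show False
    using assms(2) b by (simp add: h.hom_add h.hom_mult h.hom_one)
qed

lemma resultant_to_ac:
  fixes a b :: "'k :: field poly"
  assumes "a \<noteq> 0" "b \<noteq> 0"
  shows "to_ac (resultant a b) = to_ac (lead_coeff a) ^ degree b *
    (\<Prod>x\<in>#proots (map_poly to_ac a). poly (map_poly to_ac b) x)"
proof -
  have "map_poly to_ac a \<noteq> 0" "map_poly to_ac b \<noteq> 0" using assms by simp_all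
  from resultant_poisson[OF this] show ?thesis
    by (simp add: ac.resultant_hom)
qed

lemma prod_proots_prod:
  fixes t :: "'a :: idom \<Rightarrow> 'b :: comm_monoid_mult"
  assumes "finite S" "\<And>d. d \<in> S \<Longrightarrow> F d \<noteq> 0"
  shows "(\<Prod>x\<in>#proots (\<Prod>d\<in>S. F d). t x) = (\<Prod>d\<in>S. \<Prod>x\<in>#proots (F d). t x)"
  using assms
proof (induction S rule: finite_induct)
  case (insert d S)
  hence "(\<Prod>d\<in>S. F d) \<noteq> 0" by (auto simp: prod_zero_iff)
  thus ?case using insert by (simp add: proots_mult)
qed simp

context separable_quad_map
begin

lemma discriminant_nonzero:
  assumes n: "n > 0"
  shows "poly_discriminant (dynatomic n \<phi>) \<noteq> 0"
proof -
  define A where "A = dynatomic n \<phi>"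
  have A0: "A \<noteq> 0" using dynatomic_nonzero[OF n] by (simp add: A_def)
  have "resultant A (pderiv A) \<noteq> 0"
  proof (cases "pderiv A = 0")
    case True
    then obtain c where "A = [:c:]" using pderiv_iszero by blast
    thus ?thesis by simp
  next
    case False
    have "poly (map_poly to_ac (pderiv A)) x \<noteq> 0" if "x \<in># proots (map_poly to_ac A)" for x
      using that A0 coprime_no_common_root[OF dynatomic_coprime_pderiv[OF n], of x] by (simp add: A_def)
    hence "to_ac (resultant A (pderiv A)) \<noteq> 0"
      using A0 by (auto simp: resultant_to_ac[OF A0 False] prod_mset_zero_iff)
    thus ?thesis by simp
  qed
  thus ?thesis using A0 by (simp add: poly_discriminant_def A_def)
qed

abbreviation fL where "fL \<equiv> map3 to_ac f"
abbreviation gL where "gL \<equiv> map3 to_ac g"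
abbreviation PL where "PL \<equiv> per_poly fL gL"

lemma PL_eq: "map_poly to_ac (PP d) = PL d"
  by (rule ac.map_poly_per_poly)

lemma infty_L: "d > 0 \<Longrightarrow> snd (qit fL gL d (1, 0)) \<noteq> 0"
  using infty[of d] ac.hom_snd_qit[of f g d "(1, 0)"] by auto

lemma jac_nonzero: "jac (cst f) (cst g) [:0, 1:] 1 \<noteq> 0"
proof
  obtain f0 f1 f2 where f: "f = (f0, f1, f2)" by (cases f)
  obtain g0 g1 g2 where g: "g = (g0, g1, g2)" by (cases g)
  assume 0: "jac (cst f) (cst g) [:0, 1:] 1 = 0"
  have j: "jac (cst f) (cst g) [:0, 1:] 1 = [:f1 * g0 - f0 * g1, 2 * (f2 * g0 - f0 * g2), f2 * g1 - f1 * g2:]"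
    by (simp add: f g power2_eq_square numeral_poly)
  have "f1 * g0 - f0 * g1 = 0" "f2 * g0 - f0 * g2 = 0" "f2 * g1 - f1 * g2 = 0"
    using 0 unfolding j by simp_all
  hence "res f g = 0" by (simp add: f g)
  thus False using res by simp
qed

text \<open>The Jacobian and the square of the denominator can have a common factor, for example
  when the denominator has a double root, so the reduced derivative is compared with them by cross
  multiplication.\<close>

lemma rf_deriv_cross:
  "rf_num (rf_deriv \<phi>) * (pq g)\<^sup>2 = jac (cst f) (cst g) [:0, 1:] 1 * rf_den (rf_deriv \<phi>)"
proof -
  obtain c where c: "c \<noteq> 0" "rf_num \<phi> = smult c (pq f)" "rf_den \<phi> = smult c (pq g)"
    unfolding rf_q_def by (rule rf_Fract[OF coprime_pq[OF res] pq_g_nonzero])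
  have "rf_deriv \<phi> = Fract (smult (c\<^sup>2) (jac (cst f) (cst g) [:0, 1:] 1)) (smult (c\<^sup>2) ((pq g)\<^sup>2))"
    unfolding rf_deriv_def c pderiv_pq[symmetric]
    by (simp add: pderiv_smult smult_diff_right power2_eq_square)
  also have "\<dots> = Fract (jac (cst f) (cst g) [:0, 1:] 1) ((pq g)\<^sup>2)"
    using c(1) pq_g_nonzero by (simp add: eq_fract)
  finally have "Fract (rf_num (rf_deriv \<phi>)) (rf_den (rf_deriv \<phi>)) = Fract (jac (cst f) (cst g) [:0, 1:] 1) ((pq g)\<^sup>2)"
    by (rule trans[OF sym[OF rf_quot_spec(3)]])
  thus ?thesis using rf_quot_spec(1)[of "rf_deriv \<phi>"] pq_g_nonzero by (simp add: eq_fract)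
qed

text \<open>The power of the leading coefficient in \<open>U\<close> cancels those in Poisson's
  formula for the two resultants. What remains is the product of the derivative over the roots of
  the dynatomic polynomial, insensitive to its scaling, and this product is multiplicative in the
  polynomial.\<close>

lemma U_product:
  assumes n: "n > 0" and g2: "snd (snd g) \<noteq> 0"
  shows "to_ac (U n \<phi>) * mob_neg n (\<lambda>d. \<Prod>x\<in>#proots (PL d). mult_at fL gL x) =
    mob_pos n (\<lambda>d. \<Prod>x\<in>#proots (PL d). mult_at fL gL x)"
proof -
  define A where "A = dynatomic n \<phi>"
  define p q where "p = rf_num (rf_deriv \<phi>)" "q = rf_den (rf_deriv \<phi>)"
  have A0: "A \<noteq> 0" using dynatomic_nonzero[OF n] by (simp add: A_def)
  have q0: "q \<noteq> 0" unfolding p_q_def by (rule rf_quot_spec)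
  have cop: "coprime p q" unfolding p_q_def by (rule rf_quot_spec)
  have cross: "p * (pq g)\<^sup>2 = jac (cst f) (cst g) [:0, 1:] 1 * q"
    unfolding p_q_def by (rule rf_deriv_cross)
  have p0: "p \<noteq> 0"
  proof
    assume "p = 0"
    hence "jac (cst f) (cst g) [:0, 1:] 1 * q = 0" using cross by simp
    thus False using jac_nonzero q0 by simp
  qed
  let ?R = "proots (map_poly to_ac A)"
  let ?t = "\<lambda>x. poly (map_poly to_ac p) x / poly (map_poly to_ac q) x"
  have div: "(\<Prod>x\<in>#M. a x / b x) = (\<Prod>x\<in>#M. a x) / (\<Prod>x\<in>#M. b x)" for M and a b :: "'k alg_closure \<Rightarrow> 'k alg_closure"
    by (induction M) auto
  define l where "l = to_ac (lead_coeff A)"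
  have l0: "l \<noteq> 0" using A0 by (simp add: l_def)
  have "to_ac (U n \<phi>) = l ^ degree p * (\<Prod>x\<in>#?R. poly (map_poly to_ac p) x) /
     (l ^ degree q * (\<Prod>x\<in>#?R. poly (map_poly to_ac q) x)) * l powi (int (degree q) - int (degree p))"
    unfolding U_def Let_def A_def[symmetric] p_q_def[symmetric]
    by (simp add: resultant_to_ac[OF A0 p0] resultant_to_ac[OF A0 q0] to_ac_powi l_def)
  also have "\<dots> = (\<Prod>x\<in>#?R. ?t x) * (l ^ degree p / l ^ degree q * l powi (int (degree q) - int (degree p)))"
    by (simp add: div mult_ac)
  also have "l ^ degree p / l ^ degree q * l powi (int (degree q) - int (degree p)) = 1"
    using l0 by (simp add: power_int_diff)
  finally have U: "to_ac (U n \<phi>) = (\<Prod>x\<in>#?R. ?t x)" by simp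
  obtain c where c: "c \<noteq> 0" "A * mob_neg n PP = smult c (mob_pos n PP)"
    unfolding A_def by (rule dynatomic_mult[OF n])
  interpret m: comm_ring_hom "map_poly (to_ac :: 'k \<Rightarrow> _)" by (rule ac.comm_ring_hom_map_poly)
  have cL: "map_poly to_ac A * mob_neg n PL = smult (to_ac c) (mob_pos n PL)"
  proof -
    have "map_poly to_ac (A * mob_neg n PP) = map_poly to_ac (smult c (mob_pos n PP))" by (simp only: c)
    thus ?thesis by (simp only: m.hom_mult m.hom_mob PL_eq ac.map_poly_hom_smult)
  qed
  have PL0: "PL d \<noteq> 0" if "d > 0" for d using per_poly_degree(3)[OF infty_L[OF that]] .
  have fin0: "finite {d. d dvd n}" using n by (simp add: finite_divisors_nat)
  have fin: "finite {d. d dvd n \<and> P d}" for P by (rule finite_subset[OF _ fin0]) auto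
  have dpos: "d > 0" if "d dvd n" for d using that n by (rule dvd_pos_nat[rotated])
  \<comment> \<open>No root is a pole: the product of the denominators over all roots is a power of
    the resultant divided by the leading coefficient.\<close>
  have gnz: "qf gL x 1 \<noteq> 0" if "d > 0" "x \<in># proots (PL d)" for d x
  proof -
    have "res fL gL \<noteq> 0" using res ac.hom_res[of f g] to_ac_eq_0_iff[of "res f g"] by simp
    moreover obtain g0 g1 g2 where g: "gL = (g0, g1, g2)" "g2 \<noteq> 0" using g2 by (cases g) auto
    ultimately have "(\<Prod>x\<in>#proots (PL d). qf gL x 1) \<noteq> 0"
      using per_poly_prod_den[OF infty_L[OF that(1)] g that(1)] infty_L[OF that(1)] by simp
    thus ?thesis using that(2) by (auto simp: prod_mset_zero_iff)
  qed
  have tm: "?t x = mult_at fL gL x" if "x \<in># ?R" for x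
  proof -
    have "poly (map_poly to_ac A) x = 0" using that A0 by simp
    hence "poly (smult (to_ac c) (mob_pos n PL)) x = 0" unfolding cL[symmetric] by simp
    hence "poly (mob_pos n PL) x = 0" using c(1) by simp
    then obtain d where d: "d dvd n" "poly (PL d) x = 0"
      unfolding mob_pos_def poly_prod by (subst (asm) prod_zero_iff[OF fin]) blast
    hence "x \<in># proots (PL d)" using PL0[OF dpos] by simp
    hence gx: "qf gL x 1 \<noteq> 0" using gnz dpos[OF d(1)] by blast
    interpret h: comm_ring_hom "\<lambda>p. poly (map_poly to_ac p) x"
      by (rule comm_ring_hom_poly_map) (rule ac.comm_ring_hom_axioms)
    have hc: "map3 (\<lambda>p. poly (map_poly to_ac p) x) (cst h) = map3 to_ac h" for h :: "'k \<times> 'k \<times> 'k"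
      by (cases h) (simp add: ac.map_poly_pCons_hom)
    have hg: "poly (map_poly to_ac (pq g)) x = qf gL x 1"
      by (cases g) (simp add: ac.map_poly_pCons_hom power2_eq_square algebra_simps)
    have hX: "poly (map_poly to_ac [:0, 1:]) x = x" by (simp add: ac.map_poly_pCons_hom)
    have "poly (map_poly to_ac (p * (pq g)\<^sup>2)) x = poly (map_poly to_ac (jac (cst f) (cst g) [:0, 1:] 1 * q)) x"
      by (simp only: cross)
    hence eq: "poly (map_poly to_ac p) x * (qf gL x 1)\<^sup>2 = jac fL gL x 1 * poly (map_poly to_ac q) x"
      by (simp only: h.hom_mult h.hom_power h.hom_jac hc hg hX h.hom_one)
    moreover have "poly (map_poly to_ac q) x \<noteq> 0"
    proof
      assume q: "poly (map_poly to_ac q) x = 0"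
      hence "poly (map_poly to_ac p) x = 0" using eq gx by simp
      thus False using coprime_no_common_root[OF cop] q by blast
    qed
    ultimately show ?thesis using gx by (simp add: mult_at_def field_simps)
  qed
  have "to_ac (U n \<phi>) = (\<Prod>x\<in>#?R. mult_at fL gL x)"
    unfolding U using tm by (intro arg_cong[of _ _ prod_mset] image_mset_cong) auto
  moreover have "(\<Prod>x\<in>#?R. mult_at fL gL x) * (\<Prod>x\<in>#proots (mob_neg n PL). mult_at fL gL x) =
      (\<Prod>x\<in>#proots (mob_pos n PL). mult_at fL gL x)"
  proof -
    have "map_poly to_ac A \<noteq> 0" using A0 by simp
    hence "?R + proots (mob_neg n PL) = proots (mob_pos n PL)"
      using proots_mult[of "map_poly to_ac A" "mob_neg n PL"] mob_nonzero(2)[OF PL0 n] c(1)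
      unfolding cL by simp
    from arg_cong[OF this, of "\<lambda>M. \<Prod>x\<in>#M. mult_at fL gL x"] show ?thesis by simp
  qed
  moreover have "(\<Prod>x\<in>#proots (mob_neg n PL). mult_at fL gL x) = mob_neg n (\<lambda>d. \<Prod>x\<in>#proots (PL d). mult_at fL gL x)"
    "(\<Prod>x\<in>#proots (mob_pos n PL). mult_at fL gL x) = mob_pos n (\<lambda>d. \<Prod>x\<in>#proots (PL d). mult_at fL gL x)"
    unfolding mob_neg_def mob_pos_def
    by (rule prod_proots_prod[OF fin], rule PL0[OF dpos], simp)+
  ultimately show ?thesis by simp
qed

end

subsection \<open>Specialisation to the Chebyshev map\<close>

text \<open>The chain rule: the Wronskian of an iterate is the product of the Jacobians along the
  orbit.\<close>

lemma pit_wronskian: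
  fixes f g :: "'a :: idom \<times> 'a \<times> 'a"
  shows
  "pderiv (fst (pit f g d)) * snd (pit f g d) - fst (pit f g d) * pderiv (snd (pit f g d)) =
    (\<Prod>i<d. jac (cst f) (cst g) (fst (pit f g i)) (snd (pit f g i)))"
proof (induction d)
  case (Suc d)
  obtain f0 f1 f2 where f: "f = (f0, f1, f2)" by (cases f)
  obtain g0 g1 g2 where g: "g = (g0, g1, g2)" by (cases g)
  define P Q where "P = fst (pit f g d)" "Q = snd (pit f g d)"
  have S: "fst (pit f g (Suc d)) = qf (cst f) P Q" "snd (pit f g (Suc d)) = qf (cst g) P Q"
    by (simp_all add: pit_def fst_qit_Suc snd_qit_Suc P_Q_def)
  have "pderiv (qf (cst f) P Q) * qf (cst g) P Q - qf (cst f) P Q * pderiv (qf (cst g) P Q) =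
      (pderiv P * Q - P * pderiv Q) * jac (cst f) (cst g) P Q"
  proof -
    have p: "pderiv (qf (cst h) P Q) = [:h0:] * (2 * Q * pderiv Q) +
        [:h1:] * (pderiv P * Q + P * pderiv Q) + [:h2:] * (2 * P * pderiv P)" if "h = (h0, h1, h2)" for h h0 h1 h2
      using that by (simp add: power2_eq_square pderiv_add pderiv_mult pderiv_smult smult_add_right algebra_simps numeral_poly)
    have c: "jac (cst f) (cst g) P Q = ([:f2:] * [:g1:] - [:f1:] * [:g2:]) * P\<^sup>2 +
      2 * ([:f2:] * [:g0:] - [:f0:] * [:g2:]) * P * Q + ([:f1:] * [:g0:] - [:f0:] * [:g1:]) * Q\<^sup>2"
      "qf (cst f) P Q = [:f0:] * Q\<^sup>2 + [:f1:] * P * Q + [:f2:] * P\<^sup>2"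
      "qf (cst g) P Q = [:g0:] * Q\<^sup>2 + [:g1:] * P * Q + [:g2:] * P\<^sup>2"
      unfolding f g by (simp_all only: map3_simp qf_simp jac_simp)
    have ring: "(A0 * (2 * Q * Q1) + A1 * (P1 * Q + P * Q1) + A2 * (2 * P * P1)) * (B0 * Q\<^sup>2 + B1 * P * Q + B2 * P\<^sup>2) -
        (A0 * Q\<^sup>2 + A1 * P * Q + A2 * P\<^sup>2) * (B0 * (2 * Q * Q1) + B1 * (P1 * Q + P * Q1) + B2 * (2 * P * P1)) =
        (P1 * Q - P * Q1) * ((A2 * B1 - A1 * B2) * P\<^sup>2 + 2 * (A2 * B0 - A0 * B2) * P * Q + (A1 * B0 - A0 * B1) * Q\<^sup>2)"
      for P1 Q1 A0 A1 A2 B0 B1 B2 :: "'a poly"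
      by (simp add: power2_eq_square algebra_simps)
    show ?thesis unfolding p[OF f] p[OF g] unfolding c by (rule ring)
  qed
  thus ?case using Suc.IH by (simp add: S P_Q_def mult.commute)
qed (simp add: pit_def pderiv_pCons)

text \<open>A double root is a point at which the d-th iterate has derivative 1; the equation is
  this condition cleared of denominators.\<close>

lemma double_root_wronskian:
  fixes f g :: "'a :: field \<times> 'a \<times> 'a"
  assumes "poly (per_poly f g d) x = 0" "poly (pderiv (per_poly f g d)) x = 0"
  shows "(\<Prod>i<d. jac f g (fst (qit f g i (x, 1))) (snd (qit f g i (x, 1)))) = (snd (qit f g d (x, 1)))\<^sup>2"
proof -
  define P Q where "P = fst (pit f g d)" "Q = snd (pit f g d)"
  have p: "poly P x = x * poly Q x" using assms(1) by (simp add: per_poly_def P_Q_def)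
  have "pderiv (per_poly f g d) = Q + [:0, 1:] * pderiv Q - pderiv P"
    by (simp add: per_poly_def P_Q_def pderiv_diff pderiv_mult pderiv_pCons)
  hence e: "poly Q x + x * poly (pderiv Q) x - poly (pderiv P) x = 0" using assms(2) by simp
  have "poly (\<Prod>i<d. jac (cst f) (cst g) (fst (pit f g i)) (snd (pit f g i))) x =
      poly (pderiv P) x * poly Q x - poly P x * poly (pderiv Q) x"
    unfolding pit_wronskian[symmetric] P_Q_def by simp
  also have "\<dots> = (poly Q x)\<^sup>2"
  proof -
    have e': "poly (pderiv P) x = poly Q x + x * poly (pderiv Q) x" using e by simp
    show ?thesis unfolding e' p by (simp add: power2_eq_square algebra_simps)
  qed
  also have "poly (\<Prod>i<d. jac (cst f) (cst g) (fst (pit f g i)) (snd (pit f g i))) x =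
      (\<Prod>i<d. jac f g (fst (qit f g i (x, 1))) (snd (qit f g i (x, 1))))"
    unfolding poly_prod
    by (intro prod.cong refl) (simp add: comm_ring_hom.hom_jac[OF comm_ring_hom_poly] poly_pit)
  finally show ?thesis by (simp add: P_Q_def poly_pit)
qed

text \<open>At \<open>(r, s) = (2, -8)\<close> the substitution \<open>v = 1 + 4/x\<close> turns the map into \<open>v\<^sup>2 - 2\<close>,
  which is semiconjugate to squaring by \<open>v = z + 1/z\<close>; every multiplier of a finite cycle is \<open>\<plusminus>2\<^sup>d\<close>, \<open>4\<^sup>d\<close> or \<open>0\<close>.\<close>

lemma chebyshev_prod:
  fixes v :: "nat \<Rightarrow> complex"
  assumes "\<And>i. v (Suc i) = (v i)\<^sup>2 - 2" "v d = v 0" "d > 0"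
  shows "(\<Prod>i<d. v i) \<in> {1, -1, 2 ^ d}"
proof -
  have "degree [:1, - v 0, 1:] > 0" by simp
  then obtain z where "poly [:1, - v 0, 1:] z = 0" using alg_closed_imp_poly_has_root by blast
  hence q: "1 - v 0 * z + z\<^sup>2 = 0" by (simp add: power2_eq_square algebra_simps)
  hence z0: "z \<noteq> 0" by auto
  have v: "v i = z ^ 2 ^ i + 1 / z ^ 2 ^ i" for i
  proof (induction i)
    case 0
    have "v 0 * z = (z + 1 / z) * z" using q z0 by (simp add: algebra_simps power2_eq_square)
    thus ?case using z0 by simp
  next
    case (Suc i)
    have e: "z ^ 2 ^ Suc i = (z ^ 2 ^ i)\<^sup>2" by (simp add: power_mult[symmetric] mult.commute)
    have sq: "(w + 1 / w)\<^sup>2 - 2 = w\<^sup>2 + 1 / w\<^sup>2" if "w \<noteq> 0" for w :: complex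
      using that by (simp add: power2_sum power_one_over)
    show ?case unfolding assms(1) Suc e by (rule sq) (use z0 in simp)
  qed
  define Z where "Z = z ^ 2 ^ d"
  have Z0: "Z \<noteq> 0" using z0 by (simp add: Z_def)
  have "Z + 1 / Z = z + 1 / z" using v[of d] v[of 0] assms(2) by (simp add: Z_def)
  hence "(Z + 1 / Z) * (Z * z) = (z + 1 / z) * (Z * z)" by simp
  hence "(Z * Z + 1) * z = (z * z + 1) * Z" using z0 Z0 by (simp add: algebra_simps)
  hence "(Z - z) * (Z * z - 1) = 0" by (simp add: algebra_simps)
  hence Zz: "Z = z \<or> Z * z = 1" by auto
  \<comment> \<open>The factors \<open>z ^ 2 ^ i + 1 / z ^ 2 ^ i\<close> telescope by the difference
    of two squares.\<close>
  have tel: "(z - 1 / z) * (\<Prod>i<e. v i) = z ^ 2 ^ e - 1 / z ^ 2 ^ e" for e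
  proof (induction e)
    case (Suc e)
    have e: "z ^ 2 ^ Suc e = (z ^ 2 ^ e)\<^sup>2" by (simp add: power_mult[symmetric] mult.commute)
    have p: "(z - 1 / z) * (\<Prod>i<Suc e. v i) = (z ^ 2 ^ e - 1 / z ^ 2 ^ e) * v e"
      unfolding prod.lessThan_Suc Suc[symmetric] by (rule mult.assoc[symmetric])
    have sq: "(w - 1 / w) * (w + 1 / w) = w\<^sup>2 - 1 / w\<^sup>2" for w :: complex
      by (simp add: power2_eq_square algebra_simps)
    show ?case unfolding p unfolding e v by (rule sq)
  qed simp
  show ?thesis
  proof (cases "z\<^sup>2 = 1")
    case True
    have "even ((2::nat) ^ d)" using assms(3) by simp
    then obtain k where k: "(2::nat) ^ d = 2 * k" by blast
    \<comment> \<open>This excludes z = -1, since Z is z or its inverse. Only the fixed point v = 2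
      remains, with product 2^d.\<close>
    have "Z = 1" unfolding Z_def k power_mult True by simp
    hence "z = 1" using Zz by auto
    hence "v i = 2" for i by (simp add: v)
    thus ?thesis by simp
  next
    case False
    have nz: "z - 1 / z \<noteq> 0"
    proof
      assume "z - 1 / z = 0"
      hence "(z - 1 / z) * z = 0" by simp
      thus False using False z0 by (simp add: algebra_simps power2_eq_square)
    qed
    have e1: "(z - 1 / z) * (\<Prod>i<d. v i) = Z - 1 / Z" using tel[of d] by (simp add: Z_def)
    have e2: "Z - 1 / Z = (z - 1 / z) * 1 \<or> Z - 1 / Z = (z - 1 / z) * (-1)"
      using Zz
    proof
      assume "Z * z = 1"
      hence "Z = 1 / z" using z0 by (simp add: eq_divide_eq)
      thus ?thesis by simp
    qed simp
    have "(\<Prod>i<d. v i) = 1 \<or> (\<Prod>i<d. v i) = -1"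
      using e2 unfolding e1[symmetric] mult_left_cancel[OF nz] .
    thus ?thesis by auto
  qed
qed

lemma chebyshev_no_double_root:
  assumes d: "d > 0" and "poly (per_poly (0, 0, 2) (8, 4, -1) d) x = 0"
  shows "poly (pderiv (per_poly (0, 0, 2) (8, 4, -1) d)) (x :: complex) \<noteq> 0"
proof
  let ?f = "(0, 0, 2) :: complex \<times> complex \<times> complex" and ?g = "(8, 4, -1) :: complex \<times> complex \<times> complex"
  assume "poly (pderiv (per_poly ?f ?g d)) x = 0"
  note W = double_root_wronskian[OF assms(2) this]
  define p q where "p i = fst (qit ?f ?g i (x, 1))" "q i = snd (qit ?f ?g i (x, 1))" for i
  have rec: "p 0 = x" "q 0 = 1" "p (Suc i) = 2 * (p i)\<^sup>2" "q (Suc i) = 8 * (q i)\<^sup>2 + 4 * p i * q i - (p i)\<^sup>2" for i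
    by (simp_all add: p_q_def fst_qit_Suc snd_qit_Suc)
  have W: "(\<Prod>i<d. 8 * p i * (p i + 4 * q i)) = (q d)\<^sup>2"
    using W by (simp add: p_q_def power2_eq_square algebra_simps)
  have per: "x * q d = p d" using assms(2) by (simp add: poly_per_poly per_form_def p_q_def)
  show False
  proof (cases "x = 0")
    case True
    have "p i = 0 \<and> q i \<noteq> 0" for i by (induction i) (auto simp: rec True)
    moreover from this have "(\<Prod>i<d. 8 * p i * (p i + 4 * q i)) = 0" using d by (auto simp: prod_zero_iff)
    ultimately show False using W zero_eq_power2[of "q d"] by metis
  next
    case False
    have p0: "p i \<noteq> 0" for i by (induction i) (auto simp: rec False)
    define v where "v i = 1 + 4 * q i / p i" for i
    have vp: "v i * p i = p i + 4 * q i" for i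
      using p0[of i] by (simp add: v_def algebra_simps)
    have v: "v (Suc i) = (v i)\<^sup>2 - 2" for i
    proof -
      have "((v i)\<^sup>2 - 2) * p (Suc i) = 2 * (v i * p i)\<^sup>2 - 4 * (p i)\<^sup>2"
        by (simp add: rec(3) power2_eq_square algebra_simps)
      also have "\<dots> = v (Suc i) * p (Suc i)"
        unfolding vp by (simp add: rec(3,4) power2_eq_square algebra_simps)
      finally show ?thesis using p0[of "Suc i"] by simp
    qed
    have qd: "q d \<noteq> 0" using per p0[of d] by auto
    have "v d = v 0" using False qd by (simp add: v_def rec(1,2) per[symmetric])
    from chebyshev_prod[of v, OF v this d] have pv: "(\<Prod>i<d. v i) \<in> {1, -1, 2 ^ d}" .
    \<comment> \<open>The Jacobian along the orbit is
      \<open>8 * p i * (p i + 4 * q i) = 2 * (2 * p i)\<^sup>2 * v i\<close>, and the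
      \<open>2 * p i\<close> multiply to \<open>p d / x = q d\<close>. So a double root would make
      2^d times the product of the \<open>v i\<close> equal to 1.\<close>
    have pp: "(\<Prod>i<e. 2 * p i) * x = p e" for e
      by (induction e) (simp_all add: rec power2_eq_square mult_ac)
    have "(q d)\<^sup>2 = (\<Prod>i<d. 2 * (2 * p i)\<^sup>2 * v i)"
      unfolding W[symmetric] vp[symmetric]
      by (intro prod.cong refl) (simp add: power2_eq_square)
    also have "\<dots> = 2 ^ d * (\<Prod>i<d. 2 * p i)\<^sup>2 * (\<Prod>i<d. v i)"
      by (simp only: prod.distrib prod_power_distrib[symmetric] prod_constant card_lessThan)
    also have "(\<Prod>i<d. 2 * p i) = q d"
      using pp[of d] False by (simp add: per[symmetric] mult.commute)
    finally have "1 = 2 ^ d * (\<Prod>i<d. v i)" using qd by simp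
    from arg_cong[OF this, of norm] have "1 = 2 ^ d * norm (\<Prod>i<d. v i)"
      by (simp only: norm_mult norm_numeral norm_one norm_power)
    moreover have "norm (\<Prod>i<d. v i) \<ge> 1" using pv by (auto simp: norm_power)
    moreover have "(2::real) ^ d > 1" using d by simp
    ultimately show False using mult_mono[of "1 :: real" "2 ^ d" 1 "norm (\<Prod>i<d. v i)"] mult_left_mono[of 1 "norm (\<Prod>i<d. v i)" "2 ^ d :: real"] by linarith
  qed
qed

subsection \<open>The generic map\<close>

definition rR :: "int poly poly" where "rR = [:[:0, 1:]:]"
definition sR :: "int poly poly" where "sR = [:0, 1:]"

lemma eval2_rs [simp]: "eval2 rR a b = a" "eval2 sR a b = b"
  unfolding rR_def sR_def by (rule eval2_var)+

abbreviation to_K where "to_K F \<equiv> eval2 F r_var s_var"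

definition frs :: "'a :: comm_ring_1 \<Rightarrow> 'a \<Rightarrow> 'a \<times> 'a \<times> 'a" where
  "frs r s = (2 - r, 2 - r, 2)"
definition grs :: "'a :: comm_ring_1 \<Rightarrow> 'a \<Rightarrow> 'a \<times> 'a \<times> 'a" where
  "grs r s = (2 - r - s, 2 + r, - 1)"

lemma (in comm_ring_hom) hom_frs: "map3 hom (frs r s) = frs (hom r) (hom s)"
  and hom_grs: "map3 hom (grs r s) = grs (hom r) (hom s)"
  by (simp_all add: frs_def grs_def hom_distribs)

lemma phi_rs_eq: "phi_rs = rf_q (frs r_var s_var) (grs r_var s_var)"
  by (simp add: phi_rs_def rf_q_def frs_def grs_def)

lemma to_K_inj: "to_K F = 0 \<longleftrightarrow> F = 0"
proof
  assume F: "to_K F = 0"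
  have t: "comm_ring_hom (to_fract :: rat poly poly \<Rightarrow> _)" by unfold_locales auto
  have c: "poly (map_poly of_int p) [:[:0, 1:]:] = ([:map_poly of_int p:] :: rat poly poly)" for p :: "int poly"
  proof (induction p)
    case (pCons a p)
    thus ?case by (simp add: of_int_poly algebra_simps)
  qed simp
  have e: "eval2 F [:[:0, 1:]:] [:0, 1:] = (map_poly (map_poly of_int) F :: rat poly poly)" for F
  proof (induction F)
    case (pCons a F)
    show ?case unfolding eval2_pCons c pCons.IH using pCons.hyps by (simp add: map_poly_pCons)
  qed simp
  have "to_K F = to_fract (eval2 F [:[:0, 1:]:] [:0, 1:])"
    by (simp only: comm_ring_hom.hom_eval2[OF t] r_var_def s_var_def)
  hence z: "map_poly (map_poly of_int) F = (0 :: rat poly poly)"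
    unfolding F e by simp
  have "map_poly of_int (coeff F i) = (0 :: rat poly)" for i
  proof -
    have "coeff (map_poly (map_poly of_int) F) i = (0 :: rat poly)" by (simp only: z coeff_0)
    thus ?thesis by (simp add: coeff_map_poly)
  qed
  hence "coeff F i = 0" for i using of_int_poly_hom.hom_0_iff[of "coeff F i"] by simp
  thus "F = 0" by (simp add: poly_eq_iff)
qed simp

lemma comm_ring_hom_to_K: "inj_comm_ring_hom to_K"
proof -
  interpret e: comm_ring_hom to_K by (rule comm_ring_hom_eval2)
  show ?thesis by unfold_locales (simp add: to_K_inj)
qed

interpretation K: inj_comm_ring_hom to_K by (rule comm_ring_hom_to_K)

text \<open>In the specialised map \<infinity> is sent to -2, which is fixed; c is the scalar by
  which the lift differs from (2, -1).\<close>

lemma spec_infty: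
  assumes "d > 0"
  shows "snd (qit (0, 0, 2) (8, 4, -1) d (1, 0)) \<noteq> (0 :: complex)"
proof -
  obtain e where e: "d = Suc e" using assms by (cases d) auto
  have "\<exists>c. c \<noteq> 0 \<and> qit (0, 0, 2) (8, 4, -1) (Suc e) (1, 0) = (2 * c, - c :: complex)"
  proof (induction e)
    case 0
    show ?case by (intro exI[of _ 1]) (simp add: qit_Suc)
  next
    case (Suc e)
    then obtain c where c: "c \<noteq> 0" "qit (0, 0, 2) (8, 4, -1) (Suc e) (1, 0) = (2 * c, - c :: complex)" by blast
    have "qit (0, 0, 2) (8, 4, -1) (Suc (Suc e)) (1, 0) = (2 * (4 * c\<^sup>2), - (4 * c\<^sup>2))"
      unfolding qit_Suc[of _ _ "Suc e"] c(2) by (simp add: power2_eq_square)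
    thus ?case using c(1) by (intro exI[of _ "4 * c\<^sup>2"]) simp
  qed
  thus ?thesis by (auto simp: e)
qed

lemma spec_eq: "frs (2 :: complex) (-8) = (0, 0, 2)" "grs (2 :: complex) (-8) = (8, 4, -1)"
  by (simp_all add: frs_def grs_def)

lemma infty_R:
  assumes "d > 0"
  shows "snd (qit (frs rR sR) (grs rR sR) d (1, 0)) \<noteq> 0"
proof
  interpret e: comm_ring_hom "\<lambda>F. eval2 F 2 (-8 :: complex)" by (rule comm_ring_hom_eval2)
  assume "snd (qit (frs rR sR) (grs rR sR) d (1, 0)) = 0"
  hence "eval2 (snd (qit (frs rR sR) (grs rR sR) d (1, 0))) 2 (-8 :: complex) = 0" by simp
  thus False using spec_infty[OF assms]
    by (simp only: e.hom_snd_qit e.hom_frs e.hom_grs eval2_rs spec_eq map_prod_simp e.hom_one e.hom_zero)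
qed

lemma res_R: "res (frs rR sR) (grs rR sR) \<noteq> 0"
proof
  interpret e: comm_ring_hom "\<lambda>F. eval2 F 2 (-8 :: complex)" by (rule comm_ring_hom_eval2)
  assume "res (frs rR sR) (grs rR sR) = 0"
  hence "eval2 (res (frs rR sR) (grs rR sR)) 2 (-8 :: complex) = 0" by simp
  thus False by (simp only: e.hom_res e.hom_frs e.hom_grs eval2_rs spec_eq) simp
qed

lemma coprime_if_resultant_nonzero:
  fixes a b :: "'k :: field_gcd poly"
  assumes "a \<noteq> 0" "b \<noteq> 0" "resultant a b \<noteq> 0"
  shows "coprime a b"
proof (rule ccontr)
  assume "\<not> coprime a b"
  hence "\<not> is_unit (gcd a b)" using is_unit_gcd[of a b] by blast
  moreover have g0: "gcd a b \<noteq> 0" using assms by simp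
  ultimately have "degree (gcd a b) > 0" using is_unit_iff_degree[of "gcd a b"] by blast
  hence "degree (map_poly to_ac (gcd a b)) > 0" by simp
  then obtain x where x: "poly (map_poly to_ac (gcd a b)) x = 0" using alg_closed_imp_poly_has_root by blast
  interpret m: comm_ring_hom "map_poly (to_ac :: 'k \<Rightarrow> _)" by (rule ac.comm_ring_hom_map_poly)
  have root: "poly (map_poly to_ac c) x = 0" if dv: "gcd a b dvd c" for c
  proof -
    obtain k where "c = gcd a b * k" using dv by blast
    hence "map_poly to_ac c = map_poly to_ac (gcd a b) * map_poly to_ac k"
      by (simp only: m.hom_mult)
    thus ?thesis using x by simp
  qed
  have "x \<in># proots (map_poly to_ac a)" using root[of a] assms(1) by simp
  moreover have "poly (map_poly to_ac b) x = 0" using root[of b] by simp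
  ultimately have "to_ac (resultant a b) = 0"
    unfolding resultant_to_ac[OF assms(1,2)] by (auto simp: prod_mset_zero_iff)
  thus False using assms(3) by simp
qed

text \<open>The resultant lies in \<int>[r, s], so it suffices that it is nonzero at (2, -8). No
  degree drops there, because the leading coefficient is a coordinate of the orbit of \<infinity>,
  which stays nonzero.\<close>

lemma resultant_pderiv_R:
  assumes d: "d > 0"
  shows "resultant (per_poly (frs rR sR) (grs rR sR) d) (pderiv (per_poly (frs rR sR) (grs rR sR) d)) \<noteq> 0"
proof
  let ?P = "per_poly (frs rR sR) (grs rR sR) d"
  let ?h = "\<lambda>F. eval2 F 2 (-8 :: complex)"
  let ?Q = "per_poly (0, 0, 2) (8, 4, -1) d :: complex poly"
  interpret e: comm_ring_hom ?h by (rule comm_ring_hom_eval2)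
  assume 0: "resultant ?P (pderiv ?P) = 0"
  have PQ: "map_poly ?h ?P = ?Q"
    by (simp only: e.map_poly_per_poly e.hom_frs e.hom_grs eval2_rs spec_eq)
  have degP: "degree ?P = 2 ^ d + 1" by (rule per_poly_degree(1)[OF infty_R[OF d]])
  have degQ: "degree ?Q = 2 ^ d + 1" "?Q \<noteq> 0" by (rule per_poly_degree[OF spec_infty[OF d]])+
  have pd: "map_poly ?h (pderiv ?P) = pderiv ?Q"
    unfolding PQ[symmetric] by (rule idom_hom.map_poly_pderiv[OF idom_hom.intro[OF comm_ring_hom_eval2]])
  have "degree (map_poly ?h ?P) = degree ?P" unfolding PQ degP degQ ..
  moreover have "degree (map_poly ?h (pderiv ?P)) = degree (pderiv ?P)"
    unfolding pd degree_pderiv degP degQ ..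
  ultimately have "resultant ?Q (pderiv ?Q) = ?h (resultant ?P (pderiv ?P))"
    using e.resultant_map_poly[of ?P "pderiv ?P"] unfolding PQ pd by blast
  hence "resultant ?Q (pderiv ?Q) = 0" using 0 by simp
  moreover have "pderiv ?Q \<noteq> 0" using degQ by (simp add: pderiv_eq_0_iff)
  ultimately obtain x where "poly ?Q x = 0" "poly (pderiv ?Q) x = 0"
    using resultant_eq_0_iff_common_root[OF degQ(2)] by blast
  thus False using chebyshev_no_double_root[OF d] by blast
qed

interpretation rs: separable_quad_map "frs r_var s_var" "grs r_var s_var"
proof
  have h: "map3 to_K (frs rR sR) = frs r_var s_var" "map3 to_K (grs rR sR) = grs r_var s_var"
    by (simp_all only: K.hom_frs K.hom_grs eval2_rs)
  show "res (frs r_var s_var) (grs r_var s_var) \<noteq> 0"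
    using res_R K.hom_res[of "frs rR sR" "grs rR sR"]
      to_K_inj[of "res (frs rR sR) (grs rR sR)"] by (simp add: h)
  show inf: "snd (qit (frs r_var s_var) (grs r_var s_var) d (1, 0)) \<noteq> 0" if "d > 0" for d
    using infty_R[OF that] K.hom_snd_qit[of "frs rR sR" "grs rR sR" d "(1, 0)"]
      to_K_inj[of "snd (qit (frs rR sR) (grs rR sR) d (1, 0))"] by (simp add: h)
  fix d :: nat assume d: "d > 0"
  let ?P = "per_poly (frs rR sR) (grs rR sR) d"
  have P: "map_poly to_K ?P = per_poly (frs r_var s_var) (grs r_var s_var) d"
    by (simp only: K.map_poly_per_poly h)
  note nz = per_poly_degree(1,3)[OF inf[OF d]]
  show "coprime (per_poly (frs r_var s_var) (grs r_var s_var) d) (pderiv (per_poly (frs r_var s_var) (grs r_var s_var) d))"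
  proof (rule coprime_if_resultant_nonzero)
    show "pderiv (per_poly (frs r_var s_var) (grs r_var s_var) d) \<noteq> 0"
      using nz by (simp add: pderiv_eq_0_iff)
    show "resultant (per_poly (frs r_var s_var) (grs r_var s_var) d) (pderiv (per_poly (frs r_var s_var) (grs r_var s_var) d)) \<noteq> 0"
      using resultant_pderiv_R[OF d] K.resultant_hom[of ?P "pderiv ?P"]
      by (simp add: idom_hom.map_poly_pderiv[OF idom_hom.intro[OF comm_ring_hom_eval2]] P to_K_inj)
  qed (rule nz)
qed

subsection \<open>Conjugation to the normal form\<close>

text \<open>In every step the accumulated scalar is squared and gains one more factor l, whence the
  exponent 2^d - 1; the wedge product contributes the determinant.\<close>

lemma per_form_conj:
  fixes f g f' g' :: "'a :: comm_ring_1 \<times> 'a \<times> 'a"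
  assumes f: "\<And>x y. qf f (m11 * x + m12 * y) (m21 * x + m22 * y) = l * (m11 * qf f' x y + m12 * qf g' x y)"
    and g: "\<And>x y. qf g (m11 * x + m12 * y) (m21 * x + m22 * y) = l * (m21 * qf f' x y + m22 * qf g' x y)"
  shows "per_form f g d (m11 * x + m12 * y) (m21 * x + m22 * y) =
    l ^ (2 ^ d - 1) * (m11 * m22 - m12 * m21) * per_form f' g' d x y"
proof -
  let ?M = "\<lambda>v. (m11 * fst v + m12 * snd v, m21 * fst v + m22 * snd v)"
  define e where "e d = l ^ (2 ^ d - 1)" for d :: nat
  have e: "e (Suc d) = l * (e d)\<^sup>2" for d
  proof -
    obtain k where "(2::nat) ^ d = Suc k" by (metis not0_implies_Suc power_not_zero zero_neq_numeral)
    hence "(2::nat) ^ Suc d - 1 = Suc ((2 ^ d - 1) * 2)" by simp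
    thus ?thesis by (simp only: e_def power_Suc power_mult)
  qed
  have it: "qit f g d (m11 * x + m12 * y, m21 * x + m22 * y) = (e d * fst (?M (qit f' g' d (x, y))), e d * snd (?M (qit f' g' d (x, y))))" for d
  proof (induction d)
    case 0
    show ?case by (simp add: e_def)
  next
    case (Suc d)
    obtain p q where pq: "qit f' g' d (x, y) = (p, q)" by fastforce
    have "qit f g (Suc d) (m11 * x + m12 * y, m21 * x + m22 * y) = qmap f g (e d * (m11 * p + m12 * q), e d * (m21 * p + m22 * q))"
      unfolding qit_Suc[of f g] Suc pq fst_conv snd_conv ..
    also have "\<dots> = (e (Suc d) * (m11 * qf f' p q + m12 * qf g' p q), e (Suc d) * (m21 * qf f' p q + m22 * qf g' p q))"
      unfolding qmap_simp qf_scale f g e by (simp add: mult_ac)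
    finally show ?case unfolding qit_Suc[of f' g'] pq by simp
  qed
  show ?thesis
    using it[of d] unfolding per_form_def e_def by (simp add: algebra_simps)
qed

text \<open>The substitution x \<mapsto> -x replaces u by -u and carries the critical point -1 to
  1.\<close>

lemma per_form_nit:
  assumes "d > 0"
  shows "per_form (1, u, 1) (0, b, 0) d 1 1 = - asq b u d"
    and "per_form (1, u, 1) (0, b, 0) d (-1) 1 = - asq b (- u) d"
proof -
  show "per_form (1, u, 1) (0, b, 0) d 1 1 = - asq b u d"
    by (simp add: per_form_def asq_def nit_def)
  obtain e where e: "d = Suc e" using assms by (cases d) auto
  have "qit (1, u, 1) (0, b, 0) (Suc e) (-1, 1) = (fst (nit b (- u) (Suc e)), - snd (nit b (- u) (Suc e)))"
  proof (induction e)
    case 0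
    show ?case by (simp add: qit_Suc fst_nit_Suc snd_nit_Suc nit_0)
  next
    case (Suc e)
    show ?case unfolding qit_Suc[of _ _ "Suc e"] Suc
      by (simp add: fst_nit_Suc[of _ _ "Suc e"] snd_nit_Suc[of _ _ "Suc e"])
  qed
  thus "per_form (1, u, 1) (0, b, 0) d (-1) 1 = - asq b (- u) d"
    by (simp add: per_form_def asq_def e)
qed

text \<open>The parameters \<open>(r, s)\<close> of the normal form. The columns of the conjugating matrix are a
  multiple of the fixed point \<open>b\<close> of the generic map and its other preimage, which correspond to
  \<open>\<infinity>\<close> and \<open>0\<close> in the normal form.\<close>

definition r_of :: "'a :: field \<Rightarrow> 'a \<Rightarrow> 'a" where
  "r_of b u = b + (4 - 2 * b - u\<^sup>2) / b"

definition s_of :: "'a :: field \<Rightarrow> 'a \<Rightarrow> 'a" where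
  "s_of b u = 4 - 2 * b - u\<^sup>2 + ((2 - b)\<^sup>2 - u\<^sup>2) / b\<^sup>2"

text \<open>The critical points 1 and -1 of the normal form go to the sum and the difference of the
  columns, which gives the factorisation of the Jacobian; its coefficient of x^2 is 6 + r, so r
  \<noteq> -6 keeps both critical points finite. The matrix degenerates only for u S = 0, which is
  where the resultant vanishes.\<close>

lemma generic_conj:
  fixes b u :: "'a :: field"
  assumes b: "b \<noteq> 0"
  defines "S \<equiv> (b - 1) * (b + 2)\<^sup>2 + u\<^sup>2 * (b + 1)"
  defines "m11 \<equiv> u * b\<^sup>2" and "m12 \<equiv> b\<^sup>2 * (b + 2) - S" and "m21 \<equiv> u * b" and "m22 \<equiv> b * (b + 2)"
  defines "f \<equiv> frs (r_of b u) (s_of b u)" and "g \<equiv> grs (r_of b u) (s_of b u)"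
  shows "qf f (m11 * x + m12 * y) (m21 * x + m22 * y) =
      u * S / b * (m11 * qf (1, u, 1) x y + m12 * qf (0, b, 0) x y)"
    and "qf g (m11 * x + m12 * y) (m21 * x + m22 * y) =
      u * S / b * (m21 * qf (1, u, 1) x y + m22 * qf (0, b, 0) x y)"
    and "res f g = u\<^sup>2 * S\<^sup>2 / b ^ 4"
    and "jac f g x y = 1 / b ^ 3 * ((m11 + m12) * y - (m21 + m22) * x) * ((m12 - m11) * y - (m22 - m21) * x)"
    and "(m21 + m22) * (m22 - m21) = b ^ 3 * (6 + r_of b u)"
    and "m11 * m22 - m12 * m21 = u * b * S"
proof -
  define c where "c = 1 / b"
  have bc: "b * c = 1" using b by (simp add: c_def)
  have r: "r_of b u = b + (4 - 2 * b - u * u) * c" by (simp add: r_of_def c_def power2_eq_square)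
  have s: "s_of b u = 4 - 2 * b - u * u + ((2 - b) * (2 - b) - u * u) * (c * c)"
    by (simp add: s_of_def c_def power2_eq_square)
  show "qf f (m11 * x + m12 * y) (m21 * x + m22 * y) =
      u * S / b * (m11 * qf (1, u, 1) x y + m12 * qf (0, b, 0) x y)"
    using b unfolding f_def frs_def qf_simp m11_def m12_def m21_def m22_def S_def r_of_def
    by (simp add: field_simps power2_eq_square)
  show "qf g (m11 * x + m12 * y) (m21 * x + m22 * y) =
      u * S / b * (m21 * qf (1, u, 1) x y + m22 * qf (0, b, 0) x y)"
    using b unfolding g_def grs_def qf_simp m11_def m12_def m21_def m22_def S_def r_of_def s_of_def
    by (simp add: field_simps power2_eq_square)
  show "res f g = u\<^sup>2 * S\<^sup>2 / b ^ 4"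
    using b unfolding f_def g_def frs_def grs_def res_simp S_def r_of_def s_of_def
    by (simp add: field_simps power2_eq_square power4_eq_xxxx)
  show "jac f g x y = 1 / b ^ 3 * ((m11 + m12) * y - (m21 + m22) * x) * ((m12 - m11) * y - (m22 - m21) * x)"
    using b unfolding f_def g_def frs_def grs_def jac_simp m11_def m12_def m21_def m22_def S_def r_of_def s_of_def
    by (simp add: field_simps power2_eq_square power3_eq_cube)
  show "(m21 + m22) * (m22 - m21) = b ^ 3 * (6 + r_of b u)"
    using b unfolding m21_def m22_def r_of_def
    by (simp add: field_simps power2_eq_square power3_eq_cube)
  show "m11 * m22 - m12 * m21 = u * b * S"
    by (simp add: m11_def m12_def m21_def m22_def power2_eq_square algebra_simps)
qed

lemma generic_periodic_product:
  fixes b u :: "'l :: alg_closed_field"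
  assumes b: "b \<noteq> 0" and d: "d > 0"
  defines "f \<equiv> frs (r_of b u) (s_of b u)" and "g \<equiv> grs (r_of b u) (s_of b u)"
  assumes res: "res f g \<noteq> 0" and l: "snd (qit f g d (1, 0)) \<noteq> 0" and r6: "6 + r_of b u \<noteq> 0"
  shows "(\<Prod>x\<in>#proots (per_poly f g d). mult_at f g x) * b ^ (2 ^ d - 1) = asq b u d * asq b (- u) d"
proof -
  define S where "S = (b - 1) * (b + 2)\<^sup>2 + u\<^sup>2 * (b + 1)"
  define m11 m12 m21 m22 where m: "m11 = u * b\<^sup>2" "m12 = b\<^sup>2 * (b + 2) - S" "m21 = u * b" "m22 = b * (b + 2)"
  define lam where "lam = u * S / b"
  define E where "E = (2::nat) ^ d - 1"
  have E: "2 ^ d = E + 1" "2 ^ d + 1 = E + 2" by (simp_all add: E_def)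
  note gc = generic_conj[OF b, of u, folded S_def m f_def g_def lam_def]
  note pf = per_form_conj[of f m11 m12 m21 m22 lam "(1, u, 1)" "(0, b, 0)" g d, OF gc(1,2), folded E_def, unfolded gc(6)]
  have rs: "res f g = u\<^sup>2 * S\<^sup>2 / b ^ 4" by (rule gc(3))
  have uS: "u \<noteq> 0" "S \<noteq> 0" using res rs by auto
  have w: "m21 + m22 \<noteq> 0" "m22 - m21 \<noteq> 0" using gc(5) b r6 by auto
  have pf1: "per_form f g d (m11 + m12) (m21 + m22) = - (lam ^ E * (u * b * S) * asq b u d)"
    using pf[of 1 1] per_form_nit(1)[OF d, of u b] by (simp add: m(3))
  have pf2: "per_form f g d (m12 - m11) (m22 - m21) = - (lam ^ E * (u * b * S) * asq b (- u) d)"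
    using pf[of "-1" 1] per_form_nit(2)[OF d, of u b] by (simp add: m(3))
  have g: "g = (2 - r_of b u - s_of b u, 2 + r_of b u, -1)" by (simp add: g_def grs_def)
  have "(\<Prod>x\<in>#proots (per_poly f g d). mult_at f g x) =
     (1 / b ^ 3) ^ (2 ^ d + 1) * per_form f g d (m11 + m12) (m21 + m22) *
     per_form f g d (m12 - m11) (m22 - m21) / res f g ^ 2 ^ d"
    by (rule per_poly_prod_mult[OF l g _ d gc(4) w]) simp
  \<comment> \<open>All constants are grouped into a power with exponent E, whose base turns out to
    be 1 / b, and a remaining factor, which turns out to be 1.\<close>
  also have "\<dots> = ((1 / b ^ 3) * lam\<^sup>2 / res f g) ^ E * ((1 / b ^ 3)\<^sup>2 * (u * b * S)\<^sup>2 / res f g) *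
      (asq b u d * asq b (- u) d)"
    unfolding pf1 pf2 E by (simp add: power_mult_distrib power_divide power_add power2_eq_square mult_ac)
  also have "(1 / b ^ 3) * lam\<^sup>2 / res f g = 1 / b"
    unfolding rs lam_def using uS b by (simp add: field_simps power2_eq_square power3_eq_cube power4_eq_xxxx)
  also have "(1 / b ^ 3)\<^sup>2 * (u * b * S)\<^sup>2 / res f g = 1"
    unfolding rs using uS b by (simp add: field_simps power2_eq_square power3_eq_cube power4_eq_xxxx)
  finally show ?thesis using b by (simp add: E_def power_divide)
qed

subsection \<open>Descent to integer polynomials\<close>

definition chi :: "'a :: comm_ring_1 \<Rightarrow> 'a \<Rightarrow> 'a poly" where
  "chi r s = [:2 - r, s, - r, 1:]"

lemma (in comm_ring_hom) hom_chi: "map_poly hom (chi r s) = chi (hom r) (hom s)"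
  by (simp add: chi_def hom_distribs)

lemma chi_degree [simp]: "degree (chi r s) = 3" "lead_coeff (chi r s) = 1" "chi r s \<noteq> 0"
  by (simp_all add: chi_def)

lemma chi_coeff3 [simp]: "coeff (chi r s) 3 = 1"
  using chi_degree(2)[of r s] unfolding chi_degree(1) .

lemma poly_chi: "poly (chi r s) b = b ^ 3 - r * b\<^sup>2 + s * b - (r - 2)"
  by (simp add: chi_def power2_eq_square power3_eq_cube algebra_simps)

lemma chi_root_params:
  fixes b u :: "'a :: field"
  assumes "b \<noteq> 0" "poly (chi r s) b = 0" "u\<^sup>2 = 4 - 2 * b - (r - b) * b"
  shows "r = r_of b u" "s = s_of b u"
proof -
  have rb: "r * b = b\<^sup>2 + 4 - 2 * b - u\<^sup>2" using assms(3) by (simp add: power2_eq_square algebra_simps)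
  thus r: "r = r_of b u" using assms(1) by (simp add: r_of_def field_simps power2_eq_square)
  have "s * b\<^sup>2 = (4 - 2 * b - u\<^sup>2) * b\<^sup>2 + ((2 - b)\<^sup>2 - u\<^sup>2)"
  proof -
    have "s * b\<^sup>2 = (r * b) - 2 * b - b ^ 3 * b + (r * b) * b\<^sup>2"
    proof -
      have "s * b = (r - 2) - b ^ 3 + r * b\<^sup>2" using assms(2) by (simp add: poly_chi algebra_simps)
      hence "s * b * b = ((r - 2) - b ^ 3 + r * b\<^sup>2) * b" by simp
      thus ?thesis by (simp add: power2_eq_square power3_eq_cube algebra_simps)
    qed
    thus ?thesis unfolding rb by (simp add: power2_eq_square power3_eq_cube algebra_simps)
  qed
  thus "s = s_of b u" using assms(1) by (simp add: s_of_def field_simps)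
qed

lemma chi_of_params:
  fixes b u :: "'a :: field"
  assumes "b \<noteq> 0"
  shows "poly (chi (r_of b u) (s_of b u)) b = 0" "u\<^sup>2 = 4 - 2 * b - (r_of b u - b) * b"
  using assms by (simp_all add: poly_chi r_of_def s_of_def field_simps power2_eq_square power3_eq_cube)

lemma monic_division:
  fixes p g :: "'a :: idom_divide poly"
  assumes "lead_coeff g = 1" "degree g > 0"
  obtains q r where "p = g * q + r" "degree r < degree g"
proof -
  obtain q r where qr: "pseudo_divmod p g = (q, r)" by fastforce
  have "g \<noteq> 0" using assms by auto
  from pseudo_divmod[OF this qr] show ?thesis using assms that[of q r] by auto
qed

text \<open>In \<open>R/\<pi>[T]\<close> a monic divisor of \<open>T\<^sup>k\<close> is a power of \<open>T\<close>.\<close>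

lemma monic_dvd_monom_mod_prime:
  fixes p :: "'a :: {factorial_semiring, idom}" and g q :: "'a poly"
  assumes p: "prime_elem p" and g: "lead_coeff g = 1"
    and d: "\<And>i. p dvd coeff (monom 1 k - g * q) i" and i: "i < degree g"
  shows "p dvd coeff g i"
proof (rule ccontr)
  assume ni: "\<not> p dvd coeff g i"
  have p1: "\<not> p dvd 1" using p unfolding prime_elem_def by blast
  have eqk: "p dvd coeff (monom 1 k) n \<longleftrightarrow> p dvd coeff (g * q) n" for n
  proof -
    have "p dvd coeff (monom 1 k) n - coeff (g * q) n" using d[of n] by simp
    from dvd_add_right_iff[OF this, of "coeff (g * q) n"] show ?thesis by simp
  qed
  have q: "\<exists>j. \<not> p dvd coeff q j"
  proof (rule ccontr)
    assume "\<not> ?thesis"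
    hence "p dvd coeff (g * q) k" unfolding coeff_mult by (intro dvd_sum dvd_mult) auto
    thus False using eqk[of k] p1 by simp
  qed
  have q_deg: "j \<le> degree q" if "\<not> p dvd coeff q j" for j
    using that by (metis coeff_eq_0 dvd_0_right not_le_imp_less)
  \<comment> \<open>Modulo p, a and c are the lowest indices in g and q, and degree g and m the
    highest. The lowest and highest terms of g q then sit at a + c and degree g + m; as g q is a
    monomial modulo p, both equal k, which is impossible for a < degree g.\<close>
  define a where "a = (LEAST i. \<not> p dvd coeff g i)"
  define c where "c = (LEAST j. \<not> p dvd coeff q j)"
  define m where "m = (GREATEST j. \<not> p dvd coeff q j)"
  have a: "\<not> p dvd coeff g a" "\<And>i. i < a \<Longrightarrow> p dvd coeff g i" "a \<le> i"
    unfolding a_def using LeastI[of "\<lambda>i. \<not> p dvd coeff g i" i] ni not_less_Least Least_le by auto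
  have c: "\<not> p dvd coeff q c" "\<And>i. i < c \<Longrightarrow> p dvd coeff q i"
    unfolding c_def using LeastI_ex[OF q] not_less_Least by auto
  have m: "\<not> p dvd coeff q m" "\<And>i. m < i \<Longrightarrow> p dvd coeff q i"
    unfolding m_def using GreatestI_ex_nat[OF q q_deg] Greatest_le_nat[of "\<lambda>j. \<not> p dvd coeff q j", OF _ q_deg]
    by (auto simp: not_le[symmetric])
  have "c \<le> m" using c(2)[of m] m(1) by (meson not_le_imp_less)
  have low: "\<not> p dvd coeff (g * q) (a + c)"
  proof
    assume dv: "p dvd coeff (g * q) (a + c)"
    have eq: "coeff (g * q) (a + c) = coeff g a * coeff q c + (\<Sum>i\<in>{..a + c} - {a}. coeff g i * coeff q (a + c - i))"
      unfolding coeff_mult by (subst sum.remove[of _ a]) auto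
    have sm: "p dvd (\<Sum>i\<in>{..a + c} - {a}. coeff g i * coeff q (a + c - i))"
    proof (rule dvd_sum)
      fix i assume i: "i \<in> {..a + c} - {a}"
      show "p dvd coeff g i * coeff q (a + c - i)"
      proof (cases "i < a")
        case True
        thus ?thesis using a(2) by simp
      next
        case False
        hence "a + c - i < c" using i by auto
        thus ?thesis using c(2) by simp
      qed
    qed
    have "p dvd coeff g a * coeff q c" using dv unfolding eq dvd_add_left_iff[OF sm] .
    thus False using p a(1) c(1) by (simp add: prime_elem_dvd_mult_iff)
  qed
  have high: "\<not> p dvd coeff (g * q) (degree g + m)"
  proof
    assume dv: "p dvd coeff (g * q) (degree g + m)"
    have eq: "coeff (g * q) (degree g + m) = coeff g (degree g) * coeff q m +
        (\<Sum>i\<in>{..degree g + m} - {degree g}. coeff g i * coeff q (degree g + m - i))"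
      unfolding coeff_mult by (subst sum.remove[of _ "degree g"]) auto
    have sm: "p dvd (\<Sum>i\<in>{..degree g + m} - {degree g}. coeff g i * coeff q (degree g + m - i))"
    proof (rule dvd_sum)
      fix i assume i: "i \<in> {..degree g + m} - {degree g}"
      show "p dvd coeff g i * coeff q (degree g + m - i)"
      proof (cases "i < degree g")
        case True
        hence "m < degree g + m - i" by simp
        thus ?thesis using m(2) by simp
      next
        case False
        hence "coeff g i = 0" using i by (intro coeff_eq_0) auto
        thus ?thesis by simp
      qed
    qed
    have "p dvd coeff g (degree g) * coeff q m" using dv unfolding eq dvd_add_left_iff[OF sm] .
    thus False using m(1) g by simp
  qed
  have "a + c = k" "degree g + m = k" using low high eqk[of "a + c"] eqk[of "degree g + m"]
    by (auto simp: coeff_monom split: if_splits)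
  thus False using \<open>c \<le> m\<close> a(3) i by linarith
qed

lemma rs_coprime:
  assumes "prime_elem p" "p dvd rR" "p dvd sR"
  shows False
proof -
  have nu: "\<not> is_unit p" using assms(1) by (simp add: prime_elem_def)
  have "degree p = 0" using dvd_imp_degree_le[OF assms(2)] by (simp add: rR_def)
  then obtain c where c: "p = [:c:]" by (elim degree_eq_zeroE)
  have "c dvd coeff sR 1" using assms(3) unfolding c by (simp only: const_poly_dvd_iff)
  hence "is_unit c" by (simp add: sR_def)
  thus False using nu c by (simp add: is_unit_const_poly_iff)
qed

text \<open>The suffix \<open>L\<close> refers to the algebraic closure of \<open>\<rat>(r, s)\<close>.\<close>

abbreviation rL where "rL \<equiv> to_ac r_var"
abbreviation sL where "sL \<equiv> to_ac s_var"

lemma to_ac_to_K: "to_ac (to_K F) = eval2 F rL sL"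
  by (rule ac.hom_eval2)

lemma frs_L: "map3 to_ac (frs r_var s_var) = frs rL sL" "map3 to_ac (grs r_var s_var) = grs rL sL"
  by (simp_all only: ac.hom_frs ac.hom_grs)

lemma rL_ne: "rL \<noteq> 2" "6 + rL \<noteq> 0"
proof -
  have "to_K (rR - 2) = r_var - 2" "to_K (6 + rR) = 6 + r_var"
    by (simp_all add: K.hom_minus K.hom_add K.hom_numeral)
  moreover have "rR - 2 \<noteq> 0" "6 + rR \<noteq> 0"
    by (simp_all add: rR_def numeral_poly)
  ultimately have "r_var - 2 \<noteq> 0" "6 + r_var \<noteq> 0"
    using to_K_inj by metis+
  hence "to_ac (r_var - 2) \<noteq> 0" "to_ac (6 + r_var) \<noteq> 0" by (simp_all only: to_ac_eq_0_iff not_False_eq_True)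
  thus "rL \<noteq> 2" "6 + rL \<noteq> 0" by auto
qed

lemma chi_root_nonzero:
  assumes "poly (chi rL sL) b = 0"
  shows "b \<noteq> 0"
  using assms rL_ne by (auto simp: poly_chi)

text \<open>Up to sign \<open>chi\<close> is the fixed-point polynomial of the generic map, so its
  separability is the case d = 1 of the Chebyshev specialisation.\<close>

lemma card_chi_roots: "card {b. poly (chi rL sL) b = 0} = 3"
proof -
  let ?P = "per_poly (frs r_var s_var) (grs r_var s_var) 1"
  have PP: "?P = - chi r_var s_var"
    by (rule poly_eqI)
      (simp add: per_poly_def pit_def qit_Suc frs_def grs_def chi_def power2_eq_square coeff_pCons split: nat.split)
  have "coprime (chi r_var s_var) (pderiv (chi r_var s_var))"
    using rs.sep[of 1] unfolding PP by (simp add: pderiv_minus)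
  note cop = coprime_no_common_root[OF this]
  have chiL: "map_poly to_ac (chi r_var s_var) = chi rL sL" by (rule ac.hom_chi)
  have pd: "map_poly to_ac (pderiv (chi r_var s_var)) = pderiv (chi rL sL)"
    unfolding chiL[symmetric] by (rule idom_hom.map_poly_pderiv[OF idom_hom.intro]) (rule ac.comm_ring_hom_axioms)
  have "order b (chi rL sL) = 1" if b: "poly (chi rL sL) b = 0" for b
  proof -
    have "poly (pderiv (chi rL sL)) b \<noteq> 0" using cop[of b] b by (simp add: chiL pd)
    hence "pderiv (chi rL sL) \<noteq> 0" "order b (pderiv (chi rL sL)) = 0" by (auto simp: order_root)
    thus ?thesis using order_pderiv[of "chi rL sL" b] b by (simp add: order_root)
  qed
  hence "card {b. poly (chi rL sL) b = 0} = size (proots (chi rL sL))"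
    unfolding size_multiset_overloaded_eq by simp
  also have "\<dots> = 3" by (simp add: alg_closed_proots_factor(2))
  finally show ?thesis .
qed

lemma zero_if_vanishing_at_chi_roots:
  fixes p :: "rat_rs poly"
  assumes "\<And>b. poly (chi rL sL) b = 0 \<Longrightarrow> poly (map_poly to_ac p) b = 0" "degree p < 3"
  shows "p = 0"
proof (rule ccontr)
  assume p: "p \<noteq> 0"
  hence "map_poly to_ac p \<noteq> 0" by simp
  note poly_roots_finite[OF this] card_poly_roots_bound[OF this]
  moreover from this have "card {b. poly (chi rL sL) b = 0} \<le> card {b. poly (map_poly to_ac p) b = 0}"
    using assms(1) by (intro card_mono) auto
  ultimately show False using assms(2) by (simp add: card_chi_roots)
qed

section \<open>Polynomials over \<int>[r, s] evaluated at the roots of the cubic\<close>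

definition eval3 :: "int poly poly poly \<Rightarrow> 'a :: comm_ring_1 \<Rightarrow> 'a \<Rightarrow> 'a \<Rightarrow> 'a" where
  "eval3 F r s t = poly (map_poly (\<lambda>c. eval2 c r s) F) t"

lemma comm_ring_hom_eval3: "comm_ring_hom (\<lambda>F. eval3 F r s t)"
  unfolding eval3_def by (intro comm_ring_hom_poly_map comm_ring_hom_eval2)

definition TR :: "int poly poly poly" where "TR = [:0, 1:]"

abbreviation chiR where "chiR \<equiv> chi rR sR"

lemma eval3_simps [simp]: "eval3 TR r s t = t" "eval3 [:rR:] r s t = r"
proof -
  interpret e: comm_ring_hom "\<lambda>F. eval2 F r s" by (rule comm_ring_hom_eval2)
  show "eval3 TR r s t = t" "eval3 [:rR:] r s t = r"
    unfolding eval3_def TR_def e.map_poly_pCons_hom by simp_all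
qed

lemma eval3_chi: "eval3 chiR r s t = poly (chi r s) t"
proof -
  interpret e: comm_ring_hom "\<lambda>F. eval2 F r s" by (rule comm_ring_hom_eval2)
  show ?thesis by (simp add: eval3_def e.hom_chi)
qed

lemma eval3_L: "eval3 F rL sL b = poly (map_poly to_ac (map_poly to_K F)) b"
  unfolding eval3_def
  by (subst map_poly_map_poly) (auto simp: o_def to_ac_to_K)

text \<open>As \<open>chiR\<close> is monic, division works over \<int>[r, s]; the remainder has
  degree below 3 and three distinct roots.\<close>

lemma chiR_dvd:
  assumes "\<And>b. poly (chi rL sL) b = 0 \<Longrightarrow> eval3 W rL sL b = 0"
  shows "chiR dvd W"
proof -
  obtain q w where W: "W = chiR * q + w" "degree w < 3"
    by (rule monic_division[of chiR W]) simp_all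
  have "eval3 w rL sL b = 0" if "poly (chi rL sL) b = 0" for b
  proof -
    interpret e: comm_ring_hom "\<lambda>F. eval3 F rL sL b" by (rule comm_ring_hom_eval3)
    show ?thesis using assms[OF that] that unfolding W(1) by (simp add: e.hom_add e.hom_mult eval3_chi)
  qed
  hence "map_poly to_K w = 0"
    by (intro zero_if_vanishing_at_chi_roots) (use W(2) in \<open>simp_all add: eval3_L\<close>)
  hence "w = 0" by simp
  thus ?thesis using W by simp
qed

section \<open>Elements of \<rat>(r, s) as fractions over \<int>[r, s]\<close>

definition int_frac :: "rat_rs \<Rightarrow> bool" where
  "int_frac x \<longleftrightarrow> (\<exists>M N. M \<noteq> 0 \<and> x * to_K M = to_K N)"

lemma int_fracI: "M \<noteq> 0 \<Longrightarrow> x * to_K M = to_K N \<Longrightarrow> int_frac x"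
  unfolding int_frac_def by blast

lemma int_frac_add: "int_frac x \<Longrightarrow> int_frac y \<Longrightarrow> int_frac (x + y)"
  and int_frac_mult: "int_frac x \<Longrightarrow> int_frac y \<Longrightarrow> int_frac (x * y)"
  and int_frac_divide: "int_frac x \<Longrightarrow> int_frac y \<Longrightarrow> int_frac (x / y)"
proof -
  assume "int_frac x" "int_frac y"
  then obtain M N M' N' where *: "M \<noteq> 0" "x * to_K M = to_K N" "M' \<noteq> 0" "y * to_K M' = to_K N'"
    unfolding int_frac_def by blast
  show "int_frac (x + y)"
    by (rule int_fracI[of "M * M'" _ "N * M' + N' * M"])
      (use *(1,3) in \<open>simp_all add: K.hom_mult K.hom_add *(2,4)[symmetric] algebra_simps\<close>)
  show "int_frac (x * y)"
    by (rule int_fracI[of "M * M'" _ "N * N'"])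
      (use *(1,3) in \<open>simp_all add: K.hom_mult K.hom_add *(2,4)[symmetric] algebra_simps\<close>)
  show "int_frac (x / y)"
  proof (cases "N' = 0")
    case True
    hence "y = 0" using *(3,4) by simp
    thus ?thesis by (intro int_fracI[of 1 _ 0]) simp_all
  next
    case False
    hence "y \<noteq> 0" using *(4) by (metis K.hom_zero mult_zero_left to_K_inj)
    thus ?thesis
      by (intro int_fracI[of "M * N'" _ "N * M'"])
        (use False *(1) in \<open>simp_all add: K.hom_mult *(2,4)[symmetric] field_simps\<close>)
  qed
qed

lemma int_frac_const: "int_frac (to_fract [:[:c:]:])"
proof -
  obtain n d where nd: "quotient_of c = (n, d)" by fastforce
  have d: "d > 0" "c * of_int d = of_int n"
    using quotient_of_denom_pos[OF nd] quotient_of_div[OF nd] by simp_all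
  have k: "to_K (of_int m) = to_fract [:[:of_int m:]:]" for m
  proof -
    have "to_K (of_int m) = of_int m" by (simp add: K.hom_of_int)
    also have "\<dots> = to_fract (of_int m)"
    proof -
      have "of_nat i = to_fract (of_nat i)" for i by (induction i) simp_all
      thus ?thesis by (cases m rule: int_cases2) simp_all
    qed
    also have "of_int m = [:[:of_int m :: rat:]:]" by (simp add: of_int_poly)
    finally show ?thesis .
  qed
  have "[:[:c:]:] * [:[:of_int d:]:] = [:[:of_int n :: rat:]:]" using d(2) by simp
  hence "to_fract [:[:c:]:] * to_K (of_int d) = to_K (of_int n)"
    unfolding k by (simp only: to_fract_mult[symmetric])
  thus ?thesis using d(1) by (intro int_fracI[of "of_int d"]) simp_all
qed

lemma int_frac_vars: "int_frac r_var" "int_frac s_var"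
  by (rule int_fracI[of 1 _ rR], simp_all, rule int_fracI[of 1 _ sR], simp_all)

lemma int_frac_all: "int_frac x"
proof -
  have 1: "int_frac (to_fract [:q:])" for q
  proof (induction q)
    case 0
    show ?case using int_frac_const[of 0] by simp
  next
    case (pCons a q)
    have "[:pCons a q:] = [:[:a:]:] + [:[:0, 1:]:] * [:q:]" by simp
    hence "to_fract [:pCons a q:] = to_fract [:[:a:]:] + r_var * to_fract [:q:]"
      by (simp only: to_fract_add to_fract_mult r_var_def)
    thus ?case using int_frac_add int_frac_mult int_frac_const int_frac_vars pCons.IH by metis
  qed
  have 2: "int_frac (to_fract p)" for p
  proof (induction p)
    case 0
    show ?case using int_frac_const[of 0] by simp
  next
    case (pCons q p)
    have "pCons q p = [:q:] + [:0, 1:] * p" by simp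
    hence "to_fract (pCons q p) = to_fract [:q:] + s_var * to_fract p"
      by (simp only: to_fract_add to_fract_mult s_var_def)
    thus ?case using int_frac_add int_frac_mult 1 int_frac_vars pCons.IH by metis
  qed
  obtain a b where "x = Fract a b" by (cases x) auto
  thus ?thesis using int_frac_divide[OF 2 2, of a b] by (simp only: Fract_conv_to_fract)
qed

lemma fract_representation:
  fixes x :: rat_rs
  obtains N M :: "int poly poly" where "M \<noteq> 0" "x * to_K M = to_K N" "coprime N M"
proof -
  obtain M N where MN: "M \<noteq> 0" "x * to_K M = to_K N"
    using int_frac_all[of x] unfolding int_frac_def by blast
  define g where "g = gcd N M"
  have g: "g \<noteq> 0" using MN(1) by (simp add: g_def)
  obtain N' M' where *: "N = N' * g" "M = M' * g" "coprime N' M'"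
    using gcd_coprime_exists[of N M] g unfolding g_def by blast
  have "x * to_K M' * to_K g = to_K N' * to_K g"
    using MN(2) unfolding * by (simp only: K.hom_mult mult.assoc)
  hence "x * to_K M' = to_K N'" using g by simp
  moreover have "M' \<noteq> 0" using MN(1) *(2) by auto
  ultimately show ?thesis using that *(3) by blast
qed

text \<open>If \<open>x \<in> \<rat>(r, s)\<close> times \<open>b\<^sup>k\<close> is an integral expression \<open>W(b)\<close> for all three roots \<open>b\<close>
  of \<open>\<chi>\<close>, then comparing remainders modulo \<open>\<chi>\<close> shows that a prime in the denominator of \<open>x\<close> divides
  \<open>T\<^sup>k\<close> modulo \<open>\<chi>\<close>, hence divides the coprime elements \<open>r\<close> and \<open>s\<close>.\<close>

lemma descent:
  fixes x :: rat_rs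
  assumes "\<And>b. poly (chi rL sL) b = 0 \<Longrightarrow> to_ac x * b ^ k = eval3 W rL sL b"
  obtains F where "x = to_K F" "chiR dvd W - smult F (TR ^ k)"
proof -
  obtain q1 w where W: "W = chiR * q1 + w" "degree w < 3"
    by (rule monic_division[of chiR W]) simp_all
  obtain q2 t where t: "TR ^ k = chiR * q2 + t" "degree t < 3"
    by (rule monic_division[of chiR "TR ^ k"]) simp_all
  have ev: "eval3 w rL sL b = to_ac x * eval3 t rL sL b" if b: "poly (chi rL sL) b = 0" for b
  proof -
    interpret e: comm_ring_hom "\<lambda>F. eval3 F rL sL b" by (rule comm_ring_hom_eval3)
    have "eval3 W rL sL b = eval3 w rL sL b" using b by (simp add: W(1) e.hom_add e.hom_mult eval3_chi)
    moreover have "b ^ k = eval3 (TR ^ k) rL sL b" by (simp add: e.hom_power)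
    hence "b ^ k = eval3 t rL sL b" using b by (simp add: t(1) e.hom_add e.hom_mult eval3_chi)
    ultimately show ?thesis using assms[OF b] by simp
  qed
  have "smult x (map_poly to_K t) - map_poly to_K w = 0"
  proof (rule zero_if_vanishing_at_chi_roots)
    interpret m: comm_ring_hom "map_poly (to_ac :: rat_rs \<Rightarrow> _)" by (rule ac.comm_ring_hom_map_poly)
    show "poly (map_poly to_ac (smult x (map_poly to_K t) - map_poly to_K w)) b = 0" if "poly (chi rL sL) b = 0" for b
      using ev[OF that] unfolding eval3_L by (simp add: m.hom_minus ac.map_poly_hom_smult)
    show "degree (smult x (map_poly to_K t) - map_poly to_K w) < 3"
      using W(2) t(2) by (intro degree_diff_less le_less_trans[OF degree_smult_le]) simp_all
  qed
  \<comment> \<open>t and w are the remainders of T^k and W modulo the cubic; agreement at its three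
    roots is agreement of coefficients.\<close>
  hence xt: "x * to_K (coeff t i) = to_K (coeff w i)" for i
    by (simp add: poly_eq_iff coeff_map_poly)
  obtain N M where NM: "M \<noteq> 0" "x * to_K M = to_K N" "coprime N M" by (rule fract_representation)
  have "M dvd coeff t i" for i
  proof -
    have "to_K (N * coeff t i) = to_K (M * coeff w i)"
      using NM(2) xt[of i] by (simp only: K.hom_mult NM(2)[symmetric] xt[of i, symmetric] mult_ac)
    hence "N * coeff t i = M * coeff w i" using K.eq_iff by blast
    hence "M dvd N * coeff t i" by simp
    thus ?thesis using NM(3) coprime_dvd_mult_right_iff[of M N "coeff t i"] by (simp add: coprime_commute)
  qed
  have "is_unit M"
  proof (rule ccontr)
    assume "\<not> is_unit M"
    then obtain p where p: "prime p" "p dvd M" using prime_divisor_exists[of M] NM(1) by blast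
    have pe: "prime_elem p" using p(1) by auto
    have tk: "monom 1 k - chiR * q2 = t" using t(1) unfolding TR_def by (simp add: monom_altdef)
    have pd: "p dvd coeff (monom 1 k - chiR * q2) i" for i
      unfolding tk using p(2) \<open>\<And>i. M dvd coeff t i\<close> dvd_trans by blast
    have "p dvd coeff chiR 1" "p dvd coeff chiR 2"
      by (rule monic_dvd_monom_mod_prime[OF pe _ pd]; simp)+
    hence "p dvd sR" "p dvd rR" by (simp_all add: chi_def numeral_2_eq_2)
    thus False using rs_coprime[OF pe] by blast
  qed
  then obtain M' where M': "M * M' = 1" by (metis dvdE)
  define F where "F = N * M'"
  have xF: "x = to_K F"
  proof -
    have "x * to_K (M * M') = to_K (N * M')" by (simp only: K.hom_mult mult.assoc[symmetric] NM(2))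
    thus ?thesis by (simp add: M' F_def)
  qed
  have "to_K (F * coeff t i) = to_K (coeff w i)" for i using xt[of i] by (simp only: K.hom_mult xF)
  hence "coeff w i = coeff (smult F t) i" for i using K.eq_iff by simp
  hence "w = smult F t" by (simp add: poly_eq_iff)
  hence "W - smult F (TR ^ k) = chiR * (q1 - smult F q2)"
    unfolding W(1) t(1) by (simp add: algebra_simps smult_add_right)
  thus ?thesis using that[OF xF] by simp
qed

subsection \<open>Integrality of \<open>U\<close>\<close>

text \<open>Stands for \<open>u\<^sup>2\<close>; through it an even polynomial in u becomes a
  polynomial in r and b.\<close>

definition discR :: "int poly poly poly" where
  "discR = 4 - 2 * TR - ([:rR:] - TR) * TR"

lemma eval3_discR: "eval3 (eval2 E TR discR) r s b = eval2 E b (4 - 2 * b - (r - b) * b)"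
proof -
  interpret e: comm_ring_hom "\<lambda>F. eval3 F r s b" by (rule comm_ring_hom_eval3)
  show ?thesis by (simp add: e.hom_eval2 discR_def e.hom_minus e.hom_mult e.hom_numeral)
qed

lemma eval3_const: "eval3 [:F:] r s t = eval2 F r s"
proof -
  interpret e: comm_ring_hom "\<lambda>F. eval2 F r s" by (rule comm_ring_hom_eval2)
  show ?thesis unfolding eval3_def e.map_poly_pCons_hom by simp
qed

definition T_prod :: "nat \<Rightarrow> rat_rs alg_closure" where
  "T_prod d = (\<Prod>x\<in>#proots (per_poly (frs rL sL) (grs rL sL) d). mult_at (frs rL sL) (grs rL sL) x)"

lemma T_prod_eq:
  assumes "d > 0" and b: "poly (chi rL sL) b = 0" and u: "u\<^sup>2 = 4 - 2 * b - (rL - b) * b"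
  shows "T_prod d * b ^ (2 ^ d - 1) = asq b u d * asq b (- u) d"
proof -
  have b0: "b \<noteq> 0" by (rule chi_root_nonzero[OF b])
  note rs = chi_root_params[OF b0 b u]
  have "res (frs rL sL) (grs rL sL) \<noteq> 0"
    using rs.res ac.hom_res[of "frs r_var s_var" "grs r_var s_var"]
      to_ac_eq_0_iff[of "res (frs r_var s_var) (grs r_var s_var)"] unfolding frs_L by simp
  moreover have "snd (qit (frs rL sL) (grs rL sL) d (1, 0)) \<noteq> 0"
    using rs.infty_L[OF assms(1)] unfolding frs_L .
  ultimately show ?thesis
    unfolding T_prod_def using generic_periodic_product[OF b0 assms(1), of u, folded rs] rL_ne by blast
qed

lemma disc_sqrt_exists: obtains u where "u\<^sup>2 = 4 - 2 * b - (r - b) * (b :: 'a :: alg_closed_field)"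
  using nth_root_exists[of 2 "4 - 2 * b - (r - b) * b"] by auto

text \<open>If it vanished, the cubic would divide the polynomial in T that expresses
  \<open>asq b u d * asq b (- u) d\<close>; one integral point refutes this.\<close>

lemma T_prod_nonzero:
  assumes d: "d > 0"
  shows "T_prod d \<noteq> 0"
proof
  assume 0: "T_prod d = 0"
  let ?A = "asq [:[:0, 1:]:] [:0, 1:] d :: int poly poly"
  obtain E where E: "?A * pcompose ?A [:0, -1:] = pcompose E [:0, 0, 1:]"
    by (rule reflection_product)
  note ev = eval2_reflection[OF E, unfolded eval2_asq]
  have "chiR dvd eval2 E TR discR"
  proof (rule chiR_dvd)
    fix b assume b: "poly (chi rL sL) b = 0"
    obtain u where u: "u\<^sup>2 = 4 - 2 * b - (rL - b) * b" by (rule disc_sqrt_exists)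
    show "eval3 (eval2 E TR discR) rL sL b = 0"
      unfolding eval3_discR u[symmetric] ev[symmetric] T_prod_eq[OF d b u, symmetric] 0 by simp
  qed
  then obtain q where q: "eval2 E TR discR = chiR * q" by (elim dvdE)
  \<comment> \<open>At (r, s) = (3, 3) the number 1 is a root of the cubic and \<open>discR\<close>
    vanishes there: this is the good parameter (b, u) = (1, 0).\<close>
  interpret e: comm_ring_hom "\<lambda>F. eval3 F 3 3 (1 :: int)" by (rule comm_ring_hom_eval3)
  have "eval3 (eval2 E TR discR) 3 3 (1 :: int) = 0"
    unfolding q by (simp add: e.hom_mult eval3_chi poly_chi)
  hence "eval2 E 1 (0\<^sup>2 :: int) = 0" unfolding eval3_discR by simp
  hence "asq 1 0 d * asq 1 (- 0) d = (0 :: int)" unfolding ev .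
  thus False using asq_1_0_nonzero[OF d, where 'a = int] by simp
qed

text \<open>The Moebius product of the identities \<open>T_prod_eq\<close>, cleared of denominators;
  the two signs of u contribute A(b, u) and A(b, -u).\<close>

lemma U_times_power:
  assumes n: "n > 0" and A: "asq_quotient n A"
    and b: "poly (chi rL sL) b = 0" and u: "u\<^sup>2 = 4 - 2 * b - (rL - b) * b"
  shows "to_ac (U n phi_rs) * mob_pos n (\<lambda>d. b ^ (2 ^ d - 1)) =
    eval2 A b u * eval2 A b (- u) * mob_neg n (\<lambda>d. b ^ (2 ^ d - 1))"
proof -
  let ?be = "\<lambda>d. b ^ (2 ^ d - 1)"
  have U: "to_ac (U n phi_rs) * mob_neg n T_prod = mob_pos n T_prod"
    using rs.U_product[OF n] unfolding frs_L phi_rs_eq T_prod_def by (simp add: grs_def)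
  have pos: "mob_pos n T_prod * mob_pos n ?be = mob_pos n (asq b u) * mob_pos n (asq b (- u))"
    unfolding mob_mult[symmetric] by (rule mob_cong[OF T_prod_eq[OF _ b u] n])
  have neg: "mob_neg n T_prod * mob_neg n ?be = mob_neg n (asq b u) * mob_neg n (asq b (- u))"
    unfolding mob_mult[symmetric] by (rule mob_cong[OF T_prod_eq[OF _ b u] n])
  have "to_ac (U n phi_rs) * mob_pos n ?be * mob_neg n T_prod = mob_pos n T_prod * mob_pos n ?be"
    by (simp add: U[symmetric] mult_ac)
  also have "\<dots> = eval2 A b u * mob_neg n (asq b u) * (eval2 A b (- u) * mob_neg n (asq b (- u)))"
    unfolding pos eval2_asq_quotient[OF A] ..
  also have "\<dots> = eval2 A b u * eval2 A b (- u) * (mob_neg n (asq b u) * mob_neg n (asq b (- u)))"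
    by (simp add: mult_ac)
  also have "\<dots> = eval2 A b u * eval2 A b (- u) * mob_neg n ?be * mob_neg n T_prod"
    unfolding neg[symmetric] by (simp add: mult_ac)
  finally show ?thesis using mob_nonzero(2)[OF T_prod_nonzero n] by simp
qed

lemma mob_power:
  "mob_pos n (\<lambda>d. b ^ f d) = b ^ (\<Sum>d | d dvd n \<and> moebius (n div d) = 1. f d)"
  "mob_neg n (\<lambda>d. b ^ f d) = b ^ (\<Sum>d | d dvd n \<and> moebius (n div d) = -1. f d)"
  by (simp_all add: mob_pos_def mob_neg_def power_sum)

text \<open>The identity over the closure of \<rat>(r, s) becomes a congruence modulo the cubic over
  \<int>[r, s], and in this form it specialises to every point. The powers of b stay on both sides,
  since b may specialise to 0.\<close>

lemma U_integral:
  assumes n: "n > 0" and A: "asq_quotient n A"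
  obtains F k k' where "U n phi_rs = to_K F"
    "\<And>r s b u :: rat alg_closure. poly (chi r s) b = 0 \<Longrightarrow> u\<^sup>2 = 4 - 2 * b - (r - b) * b \<Longrightarrow>
       eval2 F r s * b ^ k = eval2 A b u * eval2 A b (- u) * b ^ k'"
proof -
  define k where "k = (\<Sum>d | d dvd n \<and> moebius (n div d) = 1. 2 ^ d - 1 :: nat)"
  define k' where "k' = (\<Sum>d | d dvd n \<and> moebius (n div d) = -1. 2 ^ d - 1 :: nat)"
  obtain E where E: "A * pcompose A [:0, -1:] = pcompose E [:0, 0, 1:]"
    by (rule reflection_product)
  note ev = eval2_reflection[OF E]
  define W where "W = eval2 E TR discR * TR ^ k'"
  \<comment> \<open>Needed both over the closure of \<rat>(r, s) and at algebraic points, hence for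
    all rings.\<close>
  have W: "eval3 W r s b = eval2 E b (4 - 2 * b - (r - b) * b) * b ^ k'" for r s b :: "'b :: comm_ring_1"
  proof -
    interpret e: comm_ring_hom "\<lambda>F. eval3 F r s b" by (rule comm_ring_hom_eval3)
    show ?thesis by (simp add: W_def e.hom_mult e.hom_power eval3_discR)
  qed
  have "to_ac (U n phi_rs) * b ^ k = eval3 W rL sL b" if b: "poly (chi rL sL) b = 0" for b
  proof -
    obtain u where u: "u\<^sup>2 = 4 - 2 * b - (rL - b) * b" by (rule disc_sqrt_exists)
    show ?thesis
      using U_times_power[OF n A b u] unfolding mob_power k_def[symmetric] k'_def[symmetric] W u[symmetric] ev .
  qed
  from descent[OF this] obtain F where F: "U n phi_rs = to_K F" "chiR dvd W - smult F (TR ^ k)" by blast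
  obtain q where q: "W - smult F (TR ^ k) = chiR * q" using F(2) by (elim dvdE)
  have "eval2 F r s * b ^ k = eval2 A b u * eval2 A b (- u) * b ^ k'"
    if b: "poly (chi r s) b = 0" and u: "u\<^sup>2 = 4 - 2 * b - (r - b) * b" for r s b u :: "rat alg_closure"
  proof -
    interpret e: comm_ring_hom "\<lambda>F. eval3 F r s b" by (rule comm_ring_hom_eval3)
    have "W = chiR * q + [:F:] * TR ^ k" using q by (simp add: algebra_simps)
    hence "eval3 W r s b = eval2 F r s * b ^ k"
      using b by (simp only: e.hom_add e.hom_mult e.hom_power eval3_chi eval3_simps eval3_const) simp
    thus ?thesis unfolding W u[symmetric] ev by simp
  qed
  with F(1) show ?thesis using that by blast
qed

subsection \<open>Points of the projective line\<close>

definition lx :: "'k :: field proj1 \<Rightarrow> 'k" where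
  "lx P = (case P of Fin a \<Rightarrow> a | Infty \<Rightarrow> 1)"

definition ly :: "'k :: field proj1 \<Rightarrow> 'k" where
  "ly P = (case P of Fin a \<Rightarrow> 1 | Infty \<Rightarrow> 0)"

definition proj :: "'k :: field \<Rightarrow> 'k \<Rightarrow> 'k proj1" where
  "proj x y = (if y = 0 then Infty else Fin (x / y))"

lemma lift_simps [simp]: "lx (Fin a) = a" "ly (Fin a) = 1" "lx Infty = 1" "ly Infty = 0"
  by (simp_all add: lx_def ly_def)

lemma proj_lift [simp]: "proj (lx P) (ly P) = P"
  by (cases P) (simp_all add: proj_def)

lemma lift_nonzero: "lx P \<noteq> 0 \<or> ly P \<noteq> 0"
  by (cases P) simp_all

lemma proj_scale: "c \<noteq> 0 \<Longrightarrow> proj (c * x) (c * y) = proj x y"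
  by (simp add: proj_def)

lemma lift_proj:
  assumes "x \<noteq> 0 \<or> y \<noteq> 0"
  obtains c where "c \<noteq> 0" "lx (proj x y) = c * x" "ly (proj x y) = c * y"
proof (cases "y = 0")
  case True
  thus ?thesis using assms that[of "1 / x"] by (simp add: proj_def)
next
  case False
  thus ?thesis using that[of "1 / y"] by (simp add: proj_def)
qed

lemma proj_eq_Infty_iff [simp]: "proj x y = Infty \<longleftrightarrow> y = 0"
  by (simp add: proj_def)

lemma proj_eq_iff:
  assumes "x \<noteq> 0 \<or> y \<noteq> 0" "x' \<noteq> 0 \<or> y' \<noteq> 0"
  shows "proj x y = proj x' y' \<longleftrightarrow> x * y' = x' * y"
  using assms by (auto simp: proj_def field_simps)

text \<open>The elimination of \<open>prime_dvd_qmap\<close>, with vanishing in place of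
  divisibility by a prime.\<close>

lemma qmap_nonzero:
  fixes f g :: "'k :: field \<times> 'k \<times> 'k"
  assumes r: "res f g \<noteq> 0" and nz: "x \<noteq> 0 \<or> y \<noteq> 0"
  shows "qf f x y \<noteq> 0 \<or> qf g x y \<noteq> 0"
proof (rule ccontr)
  assume "\<not> ?thesis"
  hence 0: "qf f x y = 0" "qf g x y = 0" by simp_all
  obtain f0 f1 f2 where f: "f = (f0, f1, f2)" by (cases f)
  obtain g0 g1 g2 where g: "g = (g0, g1, g2)" by (cases g)
  have "res f g * x\<^sup>2 * y = (f2 * g0 - f0 * g2) * y * (g0 * qf f x y - f0 * qf g x y) -
      (f1 * g0 - f0 * g1) * x * (f2 * qf g x y - g2 * qf f x y)"
    by (simp add: f g power2_eq_square algebra_simps)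
  hence "x = 0 \<or> y = 0" using 0 r by simp
  thus False
  proof
    assume "x = 0"
    hence "f0 = 0" "g0 = 0" using 0 nz by (auto simp: f g)
    thus False using r by (simp add: f g)
  next
    assume "y = 0"
    hence "f2 = 0" "g2 = 0" using 0 nz by (auto simp: f g)
    thus False using r by (simp add: f g)
  qed
qed

lemma qit_nonzero:
  fixes f g :: "'k :: field \<times> 'k \<times> 'k"
  assumes r: "res f g \<noteq> 0" and nz: "x \<noteq> 0 \<or> y \<noteq> 0"
  shows "fst (qit f g d (x, y)) \<noteq> 0 \<or> snd (qit f g d (x, y)) \<noteq> 0"
proof (induction d)
  case (Suc d)
  show ?case unfolding fst_qit_Suc snd_qit_Suc by (rule qmap_nonzero[OF r Suc])
qed (use nz in simp)

lemma res_imp_pq_nonzero: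
  assumes "res f g \<noteq> 0"
  shows "pq f \<noteq> 0" "pq g \<noteq> 0"
  using assms by (cases f; cases g; auto)+

lemma rf_q_rep:
  fixes f g :: "'k :: field_gcd \<times> 'k \<times> 'k"
  assumes "res f g \<noteq> 0"
  obtains c where "c \<noteq> 0" "rf_num (rf_q f g) = smult c (pq f)" "rf_den (rf_q f g) = smult c (pq g)"
  unfolding rf_q_def by (rule rf_Fract[OF coprime_pq[OF assms] res_imp_pq_nonzero(2)[OF assms]])

lemma rf_map_q:
  fixes f g :: "'k :: field_gcd \<times> 'k \<times> 'k"
  assumes r: "res f g \<noteq> 0"
  shows "rf_map (rf_q f g) P = proj (qf f (lx P) (ly P)) (qf g (lx P) (ly P))"
proof -
  obtain c where c: "c \<noteq> 0" "rf_num (rf_q f g) = smult c (pq f)" "rf_den (rf_q f g) = smult c (pq g)"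
    by (rule rf_q_rep[OF r])
  show ?thesis
  proof (cases P)
    case (Fin a)
    thus ?thesis using c by (simp add: rf_map_def Let_def poly_pq proj_def)
  next
    case Infty
    obtain f0 f1 f2 where f: "f = (f0, f1, f2)" by (cases f)
    obtain g0 g1 g2 where g: "g = (g0, g1, g2)" by (cases g)
    show ?thesis
    proof (cases "g2 = 0")
      case True
      hence "f2 \<noteq> 0" using r by (auto simp: f g)
      hence "degree (pq f) = 2" "degree (pq g) < 2" using True by (simp_all add: f g)
      thus ?thesis using c True by (simp add: Infty rf_map_def Let_def proj_def g)
    next
      case False
      hence "degree (pq g) = 2" "degree (pq f) \<le> 2" by (simp_all add: f g)
      thus ?thesis using c False by (simp add: Infty rf_map_def Let_def proj_def g f numeral_2_eq_2)
    qed
  qed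
qed

lemma rf_map_proj:
  fixes f g :: "'k :: field_gcd \<times> 'k \<times> 'k"
  assumes r: "res f g \<noteq> 0" and nz: "x \<noteq> 0 \<or> y \<noteq> 0"
  shows "rf_map (rf_q f g) (proj x y) = proj (qf f x y) (qf g x y)"
proof -
  obtain c where "c \<noteq> 0" "lx (proj x y) = c * x" "ly (proj x y) = c * y" by (rule lift_proj[OF nz])
  thus ?thesis by (simp add: rf_map_q[OF r] qf_scale proj_scale)
qed

lemma rf_map_iter:
  fixes f g :: "'k :: field_gcd \<times> 'k \<times> 'k"
  assumes r: "res f g \<noteq> 0" and nz: "x \<noteq> 0 \<or> y \<noteq> 0"
  shows "(rf_map (rf_q f g) ^^ d) (proj x y) = proj (fst (qit f g d (x, y))) (snd (qit f g d (x, y)))"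
proof (induction d)
  case (Suc d)
  thus ?case by (simp add: rf_map_proj[OF r qit_nonzero[OF r nz]] fst_qit_Suc snd_qit_Suc)
qed simp

lemma U_defined_phi_rs:
  assumes n: "n > 0"
  shows "U_defined n phi_rs"
proof -
  have "(rf_map phi_rs ^^ n) Infty \<noteq> Infty"
    using rf_map_iter[OF rs.res, of 1 0 n] rs.infty[OF n] by (simp add: phi_rs_eq proj_def)
  thus ?thesis using rs.discriminant_nonzero[OF n]
    by (simp add: U_defined_def n_periodic_def phi_rs_eq)
qed

subsection \<open>Critical points, multipliers and multiplicities\<close>

text \<open>Exchange of the two homogeneous coordinates, i.e. the substitution of 1/x.\<close>

definition rev3 :: "'a \<times> 'a \<times> 'a \<Rightarrow> 'a \<times> 'a \<times> 'a" where
  "rev3 f = (case f of (a, b, c) \<Rightarrow> (c, b, a))"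

lemma rev3_simp [simp]: "rev3 (a, b, c) = (c, b, a)"
  by (simp add: rev3_def)

lemma qf_rev3: "qf (rev3 f) x y = qf f y x"
  by (cases f) (simp add: mult_ac add_ac)

lemma res_rev3 [simp]: "res (rev3 f) (rev3 g) = res f g"
  by (cases f; cases g) (simp add: power2_eq_square algebra_simps)

lemma res_swap: "res g f = res f g"
  by (cases f; cases g) (simp add: power2_eq_square algebra_simps)

lemma jac_rev3: "jac (rev3 f) (rev3 g) x y = - jac f g y x"
  by (cases f; cases g) (simp add: power2_eq_square algebra_simps)

lemma jac_swap: "jac g f x y = - jac f g x y"
  by (cases f; cases g) (simp add: power2_eq_square algebra_simps)

lemma rf_q_inverse:
  assumes "res f g \<noteq> 0"
  shows "inverse (rf_q f g) = rf_q g f"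
  using res_imp_pq_nonzero[OF assms] by (simp add: rf_q_def)

lemma rf_X_inverse: "inverse rf_X = (rf_q (1, 0, 0) (0, 1, 0) :: 'k :: field poly fract)"
  "inverse rf_X = (Fract 1 [:0, 1:] :: 'k :: field poly fract)"
proof -
  show "inverse rf_X = (Fract 1 [:0, 1:] :: 'k :: field poly fract)"
    by (simp add: rf_X_def to_fract_def)
  thus "inverse rf_X = (rf_q (1, 0, 0) (0, 1, 0) :: 'k :: field poly fract)"
    by (simp add: rf_q_def pCons_one)
qed

lemma rf_comp_q_X:
  fixes f g :: "'k :: field_gcd \<times> 'k \<times> 'k"
  assumes "res f g \<noteq> 0"
  shows "rf_comp (rf_q f g) rf_X = rf_q f g" "rf_comp (rf_q f g) (inverse rf_X) = rf_q (rev3 f) (rev3 g)"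
proof -
  note rc = rf_comp_Fract[OF coprime_pq[OF assms] res_imp_pq_nonzero(2)[OF assms]]
  have 1: "qf (cst h) [:0, 1:] 1 = pq h" "qf (cst h) 1 [:0, 1:] = pq (rev3 h)" for h :: "'k \<times> 'k \<times> 'k"
    by (cases h; simp add: power2_eq_square)+
  have X: "rf_X = Fract [:0, 1 :: 'k:] 1" by (simp add: rf_X_def to_fract_def)
  show "rf_comp (rf_q f g) rf_X = rf_q f g"
    unfolding X using rc[of 1 "[:0, 1:]"] unfolding 1 by (simp add: rf_q_def)
  show "rf_comp (rf_q f g) (inverse rf_X) = rf_q (rev3 f) (rev3 g)"
    unfolding rf_X_inverse(2) using rc[of "[:0, 1:]" 1] unfolding 1 by (simp add: rf_q_def)
qed

lemma flip_conj_q: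
  fixes f g :: "'k :: field_gcd \<times> 'k \<times> 'k"
  assumes r: "res f g \<noteq> 0"
  shows "flip_conj (rf_q f g) = rf_q (rev3 g) (rev3 f)"
proof -
  have r': "res (rev3 f) (rev3 g) \<noteq> 0" using r by simp
  have cop: "coprime (pq (1, 0, 0)) (pq (0, 1, 0) :: 'k poly)" "pq (0, 1, 0) \<noteq> (0 :: 'k poly)"
    by (simp_all add: one_pCons[symmetric])
  have "flip_conj (rf_q f g) = rf_comp (inverse rf_X) (rf_q (rev3 f) (rev3 g))"
    unfolding flip_conj_def rf_comp_q_X(2)[OF r] ..
  also have "\<dots> = rf_comp (rf_q (1, 0, 0) (0, 1, 0)) (Fract (pq (rev3 f)) (pq (rev3 g)))"
    unfolding rf_X_inverse(1) rf_q_def[of "rev3 f" "rev3 g"] ..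
  also have "\<dots> = Fract (qf (cst (1, 0, 0)) (pq (rev3 f)) (pq (rev3 g))) (qf (cst (0, 1, 0)) (pq (rev3 f)) (pq (rev3 g)))"
    by (rule rf_comp_Fract[OF cop res_imp_pq_nonzero(2)[OF r']])
  also have "\<dots> = rf_q (rev3 g) (rev3 f)"
    using res_imp_pq_nonzero[OF r'] by (simp add: rf_q_def eq_fract power2_eq_square)
  finally show ?thesis .
qed

text \<open>Reducing the fraction does not matter: a zero of the reduced denominator at a would also
  be one of the reduced numerator, against coprimality.\<close>

lemma rf_eval_Fract:
  fixes P Q :: "'k :: field_gcd poly"
  assumes "poly Q a \<noteq> 0"
  shows "rf_eval (Fract P Q) a = poly P a / poly Q a"
proof -
  have Q: "Q \<noteq> 0" using assms by auto
  let ?n = "rf_num (Fract P Q)" and ?d = "rf_den (Fract P Q)"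
  have "P * ?d = ?n * Q"
    by (rule iffD1[OF eq_fract(1)[OF Q rf_quot_spec(1)] rf_quot_spec(3)])
  from arg_cong[OF this, of "\<lambda>p. poly p a"]
  have e: "poly P a * poly ?d a = poly ?n a * poly Q a" by simp
  have "poly ?d a \<noteq> 0"
  proof
    assume 0: "poly ?d a = 0"
    hence "poly ?n a = 0" using e assms by simp
    with 0 have "[:-a, 1:] dvd ?n" "[:-a, 1:] dvd ?d" by (simp_all only: poly_eq_0_iff_dvd)
    hence "is_unit [:-a, 1:]" by (rule coprime_common_divisor[OF rf_quot_spec(2)])
    thus False by (simp add: is_unit_iff_degree)
  qed
  hence "poly ?n a / poly ?d a = poly P a / poly Q a"
    using e assms by (simp add: frac_eq_eq)
  thus ?thesis unfolding rf_eval_def .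
qed

lemma rf_deriv_q:
  fixes f g :: "'k :: field_gcd \<times> 'k \<times> 'k"
  assumes r: "res f g \<noteq> 0"
  shows "rf_deriv (rf_q f g) = Fract (jac (cst f) (cst g) [:0, 1:] 1) ((pq g)\<^sup>2)"
proof -
  obtain c where c: "c \<noteq> 0" "rf_num (rf_q f g) = smult c (pq f)" "rf_den (rf_q f g) = smult c (pq g)"
    by (rule rf_q_rep[OF r])
  have "rf_deriv (rf_q f g) = Fract (smult (c\<^sup>2) (jac (cst f) (cst g) [:0, 1:] 1)) (smult (c\<^sup>2) ((pq g)\<^sup>2))"
    unfolding rf_deriv_def c pderiv_pq[symmetric]
    by (simp add: pderiv_smult smult_diff_right power2_eq_square)
  also have "\<dots> = Fract (jac (cst f) (cst g) [:0, 1:] 1) ((pq g)\<^sup>2)"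
    using c(1) res_imp_pq_nonzero(2)[OF r] by (simp add: eq_fract)
  finally show ?thesis .
qed

lemma rf_eval_deriv_q:
  fixes f g :: "'k :: field_gcd \<times> 'k \<times> 'k"
  assumes r: "res f g \<noteq> 0" and a: "qf g a 1 \<noteq> 0"
  shows "rf_eval (rf_deriv (rf_q f g)) a = jac f g a 1 / (qf g a 1)\<^sup>2"
proof -
  have "poly ((pq g)\<^sup>2) a \<noteq> 0" using a by (simp add: poly_pq)
  from rf_eval_Fract[OF this] show ?thesis
    by (simp add: rf_deriv_q[OF r] poly_pq comm_ring_hom.hom_jac[OF comm_ring_hom_poly])
qed

text \<open>Exchanging the coordinates in the source or in the target only changes the sign of the
  Jacobian, so all choices of charts give the same condition.\<close>

lemma critical_point_q:
  fixes f g :: "'k :: field_gcd \<times> 'k \<times> 'k"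
  assumes r: "res f g \<noteq> 0"
  shows "critical_point (rf_q f g) P \<longleftrightarrow> jac f g (lx P) (ly P) = 0"
proof -
  have main: "rf_eval (rf_deriv (if qf g' a 1 = 0 then inverse (rf_q f' g') else rf_q f' g')) a = 0 \<longleftrightarrow> jac f' g' a 1 = 0"
    if r': "res f' g' \<noteq> 0" for f' g' :: "'k \<times> 'k \<times> 'k" and a
  proof (cases "qf g' a 1 = 0")
    case True
    hence "qf f' a 1 \<noteq> 0" using qmap_nonzero[OF r', of a 1] by simp
    thus ?thesis using True rf_eval_deriv_q[of g' f' a] r'
      by (simp add: rf_q_inverse res_swap[of g' f'] jac_swap[of g' f'])
  next
    case False
    thus ?thesis using rf_eval_deriv_q[OF r' False] by simp
  qed
  show ?thesis
  proof (cases P)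
    case (Fin a)
    thus ?thesis using main[OF r, of a] by (simp add: critical_point_def rf_map_q[OF r] split del: if_split)
  next
    case Infty
    have "res (rev3 f) (rev3 g) \<noteq> 0" using r by simp
    from main[OF this, of 0] show ?thesis
      by (simp add: Infty critical_point_def rf_map_q[OF r] rf_comp_q_X[OF r] qf_rev3 jac_rev3 split del: if_split)
  qed
qed

lemma jac_scale: "jac f g (c * x) (c * y) = c\<^sup>2 * jac f g x y"
  by (cases f; cases g) (simp add: power2_eq_square algebra_simps)

section \<open>Multipliers and multiplicities of fixed points\<close>

lemma rf_iter_1_q:
  fixes f g :: "'k :: field_gcd \<times> 'k \<times> 'k"
  assumes "res f g \<noteq> 0"
  shows "rf_iter 1 (rf_q f g) = rf_q f g"
  using rf_comp_q_X(1)[OF assms] by (simp add: rf_iter_def)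

text \<open>Rescaling the lift (x, y) by a factor multiplies k by it and the Jacobian by its square,
  so the quotient depends only on the point and can be computed in either chart.\<close>

lemma multiplier_q:
  fixes f g :: "'k :: field_gcd \<times> 'k \<times> 'k"
  assumes r: "res f g \<noteq> 0" and nz: "x \<noteq> 0 \<or> y \<noteq> 0" and k: "qf f x y = k * x" "qf g x y = k * y"
  shows "multiplier 1 (rf_q f g) (proj x y) = jac f g x y / k\<^sup>2"
proof -
  have k0: "k \<noteq> 0"
  proof
    assume "k = 0"
    hence "qf f x y = 0" "qf g x y = 0" unfolding k by simp_all
    thus False using qmap_nonzero[OF r nz] by blast
  qed
  show ?thesis
  proof (cases "y = 0")
    case False
    have sc: "1 / y * x = x / y" "1 / y * y = 1" using False by simp_all
    have g: "qf g (x / y) 1 = k / y"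
      using qf_scale[of g "1 / y" x y] unfolding sc k by (simp add: power2_eq_square)
    have j: "jac f g (x / y) 1 = (1 / y)\<^sup>2 * jac f g x y"
      using jac_scale[of f g "1 / y" x y] unfolding sc .
    have "qf g (x / y) 1 \<noteq> 0" unfolding g using k0 False by simp
    from rf_eval_deriv_q[OF r this]
    have "rf_eval (rf_deriv (rf_q f g)) (x / y) = jac f g x y / k\<^sup>2"
      unfolding g j using False by (simp add: power_divide)
    thus ?thesis unfolding multiplier_def rf_iter_1_q[OF r] using False by (simp add: proj_def)
  next
    case True
    hence x: "x \<noteq> 0" using nz by simp
    have r': "res (rev3 g) (rev3 f) \<noteq> 0" unfolding res_rev3 using r res_swap[of g f] by simp
    have sc: "1 / x * x = 1" "1 / x * y = 0" using x True by simp_all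
    have f: "qf (rev3 f) 0 1 = k / x"
      using qf_scale[of f "1 / x" x y] unfolding sc k qf_rev3 by (simp add: power2_eq_square)
    have j: "jac (rev3 g) (rev3 f) 0 1 = (1 / x)\<^sup>2 * jac f g x y"
      using jac_scale[of f g "1 / x" x y] unfolding sc jac_rev3 jac_swap[of g f] by simp
    have "qf (rev3 f) 0 1 \<noteq> 0" unfolding f using k0 x by simp
    from rf_eval_deriv_q[OF r' this]
    have "rf_eval (rf_deriv (rf_q (rev3 g) (rev3 f))) 0 = jac f g x y / k\<^sup>2"
      unfolding f j using x by (simp add: power_divide)
    thus ?thesis unfolding multiplier_def flip_conj_q[OF r] rf_iter_1_q[OF r'] using True by (simp add: proj_def)
  qed
qed

text \<open>\<open>fix3 f g c v\<^sub>1 v\<^sub>2 v\<^sub>3\<close>: the fixed points, with multiplicity, are the classes of the vectors \<open>v\<^sub>i\<close>.\<close>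

definition fix3 where
  "fix3 f g c x1 y1 x2 y2 x3 y3 \<longleftrightarrow> c \<noteq> 0 \<and> (x1 \<noteq> 0 \<or> y1 \<noteq> 0) \<and> (x2 \<noteq> 0 \<or> y2 \<noteq> 0) \<and> (x3 \<noteq> 0 \<or> y3 \<noteq> 0) \<and>
    (\<forall>x y. x * qf g x y - y * qf f x y = c * (x * y1 - y * x1) * (x * y2 - y * x2) * (x * y3 - y * x3))"

lemma order_linear:
  fixes a b z :: "'k :: field"
  assumes "a \<noteq> 0 \<or> b \<noteq> 0"
  shows "order z [:a, b:] = (if a + z * b = 0 then 1 else 0)"
proof (cases "a + z * b = 0")
  case True
  hence a: "a = - z * b" by (simp add: eq_neg_iff_add_eq_0)
  hence b: "b \<noteq> 0" using assms by auto
  have "[:a, b:] = smult b [:-z, 1:]" using a by simp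
  hence "order z [:a, b:] = order z [:-z, 1:]" using order_smult[OF b] by (simp only:)
  also have "\<dots> = 1" using order_power_n_n[of z 1] by simp
  finally show ?thesis using True by simp
next
  case False
  hence "poly [:a, b:] z \<noteq> 0" by simp
  thus ?thesis using False by (simp add: order_0I)
qed

lemma fixed_mult_q:
  fixes f g :: "'k :: {field_gcd, field_char_0} \<times> 'k \<times> 'k"
  assumes r: "res f g \<noteq> 0" and fx: "fix3 f g c x1 y1 x2 y2 x3 y3"
  shows "fixed_mult (rf_q f g) P = count_list [proj x1 y1, proj x2 y2, proj x3 y3] P"
proof -
  have nz: "c \<noteq> 0" "x1 \<noteq> 0 \<or> y1 \<noteq> 0" "x2 \<noteq> 0 \<or> y2 \<noteq> 0" "x3 \<noteq> 0 \<or> y3 \<noteq> 0"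
    and id: "\<And>x y. x * qf g x y - y * qf f x y = c * (x * y1 - y * x1) * (x * y2 - y * x2) * (x * y3 - y * x3)"
    using fx unfolding fix3_def by blast+
  have ord: "order z (smult k ([:a1, b1:] * [:a2, b2:] * [:a3, b3:])) =
      (if a1 + z * b1 = 0 then 1 else 0) + (if a2 + z * b2 = 0 then 1 else 0) + (if a3 + z * b3 = 0 then 1 else 0)"
    if k: "k \<noteq> 0" and n: "a1 \<noteq> 0 \<or> b1 \<noteq> 0" "a2 \<noteq> 0 \<or> b2 \<noteq> 0" "a3 \<noteq> 0 \<or> b3 \<noteq> 0" for k a1 b1 a2 b2 a3 b3 z :: 'k
  proof -
    have l: "[:a1, b1:] \<noteq> 0" "[:a2, b2:] \<noteq> 0" "[:a3, b3:] \<noteq> 0" using n by simp_all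
    have l12: "[:a1, b1:] * [:a2, b2:] \<noteq> 0" using l(1,2) mult_eq_0_iff by blast
    have l123: "[:a1, b1:] * [:a2, b2:] * [:a3, b3:] \<noteq> 0" using l12 l(3) mult_eq_0_iff by blast
    show ?thesis
      unfolding order_smult[OF k] order_mult[OF l123] order_mult[OF l12] order_linear[OF n(1)] order_linear[OF n(2)] order_linear[OF n(3)] ..
  qed
  have lin: "- x + z * y = 0 \<longleftrightarrow> proj x y = Fin z" if "x \<noteq> 0 \<or> y \<noteq> 0" for x y z :: 'k
    using that by (auto simp: proj_def field_simps)
  show ?thesis
  proof (cases P)
    case (Fin a)
    obtain k where k: "k \<noteq> 0" "rf_num (rf_q f g) = smult k (pq f)" "rf_den (rf_q f g) = smult k (pq g)"
      by (rule rf_q_rep[OF r])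
    have "poly ([:0, 1:] * rf_den (rf_q f g) - rf_num (rf_q f g)) =
        poly (smult (k * c) ([:-x1, y1:] * [:-x2, y2:] * [:-x3, y3:]))"
    proof
      fix x
      have "poly ([:0, 1:] * rf_den (rf_q f g) - rf_num (rf_q f g)) x = k * (x * qf g x 1 - 1 * qf f x 1)"
        by (simp add: k poly_pq algebra_simps)
      thus "poly ([:0, 1:] * rf_den (rf_q f g) - rf_num (rf_q f g)) x =
        poly (smult (k * c) ([:-x1, y1:] * [:-x2, y2:] * [:-x3, y3:])) x"
        unfolding id by (simp add: algebra_simps)
    qed
    hence e: "[:0, 1:] * rf_den (rf_q f g) - rf_num (rf_q f g) =
        smult (k * c) ([:-x1, y1:] * [:-x2, y2:] * [:-x3, y3:])"
      by (rule iffD1[OF poly_eq_poly_eq_iff])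
    have "k * c \<noteq> 0" using k nz by simp
    moreover have "- x1 \<noteq> 0 \<or> y1 \<noteq> 0" "- x2 \<noteq> 0 \<or> y2 \<noteq> 0" "- x3 \<noteq> 0 \<or> y3 \<noteq> 0" using nz by simp_all
    ultimately
    have "order a ([:0, 1:] * rf_den (rf_q f g) - rf_num (rf_q f g)) =
      (if proj x1 y1 = Fin a then 1 else 0) + (if proj x2 y2 = Fin a then 1 else 0) + (if proj x3 y3 = Fin a then 1 else 0)"
      unfolding e lin[OF nz(2), symmetric] lin[OF nz(3), symmetric] lin[OF nz(4), symmetric] by (rule ord)
    thus ?thesis unfolding Fin fixed_mult_def by simp
  next
    case Infty
    have r': "res (rev3 g) (rev3 f) \<noteq> 0" using r by (simp add: res_swap[of g f])
    obtain k where k: "k \<noteq> 0" "rf_num (rf_q (rev3 g) (rev3 f)) = smult k (pq (rev3 g))"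
        "rf_den (rf_q (rev3 g) (rev3 f)) = smult k (pq (rev3 f))"
      by (rule rf_q_rep[OF r'])
    let ?q = "rf_q (rev3 g) (rev3 f)"
    have "poly ([:0, 1:] * rf_den ?q - rf_num ?q) = poly (smult (- k * c) ([:y1, -x1:] * [:y2, -x2:] * [:y3, -x3:]))"
    proof
      fix x
      have "poly ([:0, 1:] * rf_den ?q - rf_num ?q) x = - k * (1 * qf g 1 x - x * qf f 1 x)"
        by (simp add: k poly_pq qf_rev3 algebra_simps)
      thus "poly ([:0, 1:] * rf_den ?q - rf_num ?q) x =
        poly (smult (- k * c) ([:y1, -x1:] * [:y2, -x2:] * [:y3, -x3:])) x"
        unfolding id by (simp add: algebra_simps)
    qed
    hence e: "[:0, 1:] * rf_den ?q - rf_num ?q = smult (- k * c) ([:y1, -x1:] * [:y2, -x2:] * [:y3, -x3:])"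
      by (rule iffD1[OF poly_eq_poly_eq_iff])
    have "- k * c \<noteq> 0" using k nz by simp
    moreover have "y1 \<noteq> 0 \<or> - x1 \<noteq> 0" "y2 \<noteq> 0 \<or> - x2 \<noteq> 0" "y3 \<noteq> 0 \<or> - x3 \<noteq> 0" using nz by auto
    ultimately
    have "order 0 ([:0, 1:] * rf_den ?q - rf_num ?q) =
      (if y1 + 0 * - x1 = 0 then 1 else 0) + (if y2 + 0 * - x2 = 0 then 1 else 0) + (if y3 + 0 * - x3 = 0 then 1 else 0)"
      unfolding e by (rule ord)
    thus ?thesis unfolding Infty fixed_mult_def flip_conj_q[OF r] by simp
  qed
qed

lemma count_list_3_labels:
  obtains j1 j2 j3 where
    "(SIGMA P : UNIV. {..<count_list [P1, P2, P3] P}) = {(P1, j1), (P2, j2), (P3, j3)}"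
    "(P1, j1) \<noteq> (P2, j2)" "(P1, j1) \<noteq> (P3, j3)" "(P2, j2) \<noteq> (P3, j3 :: nat)"
\<comment> \<open>The label of a point counts its earlier occurrences among the three.\<close>
proof (rule that[of 0 "of_bool (P2 = P1)" "of_bool (P3 = P1) + of_bool (P3 = P2)"])
  show "(SIGMA P : UNIV. {..<count_list [P1, P2, P3] P}) =
      {(P1, 0), (P2, of_bool (P2 = P1)), (P3, of_bool (P3 = P1) + of_bool (P3 = P2))}"
    by (cases "P1 = P2"; cases "P1 = P3"; cases "P2 = P3") (auto split: if_splits simp: less_Suc_eq)
qed auto

lemma esym_three:
  fixes w :: "'a \<Rightarrow> 'b :: comm_ring_1"
  assumes S: "S = {a, b, c}" and ne: "a \<noteq> b" "a \<noteq> c" "b \<noteq> c"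
  shows "(\<Sum>A | A \<subseteq> S \<and> finite A \<and> card A = 1. \<Prod>x\<in>A. w x) = w a + w b + w c"
    and "(\<Sum>A | A \<subseteq> S \<and> finite A \<and> card A = 2. \<Prod>x\<in>A. w x) = w a * w b + w a * w c + w b * w c"
proof -
  have 1: "{A. A \<subseteq> S \<and> finite A \<and> card A = 1} = {{a}, {b}, {c}}"
    unfolding S by (auto simp: card_1_singleton_iff)
  show "(\<Sum>A | A \<subseteq> S \<and> finite A \<and> card A = 1. \<Prod>x\<in>A. w x) = w a + w b + w c"
    unfolding 1 using ne by simp
  have "A \<in> {{a, b}, {a, c}, {b, c}}" if A: "A \<subseteq> S" "card A = 2" for A
  proof -
    obtain x y where "A = {x, y}" "x \<noteq> y" using A(2) by (auto simp: card_2_iff)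
    thus ?thesis using A(1) unfolding S by (auto simp: doubleton_eq_iff)
  qed
  hence 2: "{A. A \<subseteq> S \<and> finite A \<and> card A = 2} = {{a, b}, {a, c}, {b, c}}"
    unfolding S using ne by auto
  have "{a, b} \<noteq> {a, c}" "{a, b} \<noteq> {b, c}" "{a, c} \<noteq> {b, c}" using ne by (auto simp: doubleton_eq_iff)
  thus "(\<Sum>A | A \<subseteq> S \<and> finite A \<and> card A = 2. \<Prod>x\<in>A. w x) = w a * w b + w a * w c + w b * w c"
    unfolding 2 using ne by simp
qed

lemma multiplier_esym_q:
  fixes f g :: "'k :: {field_gcd, field_char_0} \<times> 'k \<times> 'k"
  assumes r: "res f g \<noteq> 0" and fx: "fix3 f g c x1 y1 x2 y2 x3 y3"
    and k1: "qf f x1 y1 = k1 * x1" "qf g x1 y1 = k1 * y1"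
    and k2: "qf f x2 y2 = k2 * x2" "qf g x2 y2 = k2 * y2"
    and k3: "qf f x3 y3 = k3 * x3" "qf g x3 y3 = k3 * y3"
  defines "m1 \<equiv> jac f g x1 y1 / k1\<^sup>2" and "m2 \<equiv> jac f g x2 y2 / k2\<^sup>2" and "m3 \<equiv> jac f g x3 y3 / k3\<^sup>2"
  shows "multiplier_esym 1 (rf_q f g) = m1 + m2 + m3"
    and "multiplier_esym 2 (rf_q f g) = m1 * m2 + m1 * m3 + m2 * m3"
proof -
  have nz: "x1 \<noteq> 0 \<or> y1 \<noteq> 0" "x2 \<noteq> 0 \<or> y2 \<noteq> 0" "x3 \<noteq> 0 \<or> y3 \<noteq> 0"
    using fx unfolding fix3_def by blast+
  let ?w = "\<lambda>(P, j :: nat). multiplier 1 (rf_q f g) P"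
  have fm: "fixed_mult (rf_q f g) = count_list [proj x1 y1, proj x2 y2, proj x3 y3]"
    by (rule ext) (rule fixed_mult_q[OF r fx])
  obtain j1 j2 j3 where j: "(SIGMA P : UNIV. {..<count_list [proj x1 y1, proj x2 y2, proj x3 y3] P}) =
      {(proj x1 y1, j1), (proj x2 y2, j2), (proj x3 y3, j3)}"
    "(proj x1 y1, j1) \<noteq> (proj x2 y2, j2)" "(proj x1 y1, j1) \<noteq> (proj x3 y3, j3)"
    "(proj x2 y2, j2) \<noteq> (proj x3 y3, j3)"
    by (rule count_list_3_labels)
  note m = multiplier_q[OF r nz(1) k1, folded m1_def] multiplier_q[OF r nz(2) k2, folded m2_def]
    multiplier_q[OF r nz(3) k3, folded m3_def]
  show "multiplier_esym 1 (rf_q f g) = m1 + m2 + m3"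
    "multiplier_esym 2 (rf_q f g) = m1 * m2 + m1 * m3 + m2 * m3"
    unfolding multiplier_esym_def fm esym_three[OF j, of ?w] by (simp_all only: prod.case m)
qed

subsection \<open>Conjugation by matrices\<close>

text \<open>The coefficients of the form after the substitution (x, y) \<mapsto> (a x + b y, c x + d
  y).\<close>

definition comp3 :: "'a :: comm_ring_1 \<times> 'a \<times> 'a \<Rightarrow> 'a \<Rightarrow> 'a \<Rightarrow> 'a \<Rightarrow> 'a \<Rightarrow> 'a \<times> 'a \<times> 'a" where
  "comp3 f a b c d = (case f of (f0, f1, f2) \<Rightarrow>
     (f0 * d\<^sup>2 + f1 * b * d + f2 * b\<^sup>2, 2 * f0 * c * d + f1 * (a * d + b * c) + 2 * f2 * a * b,
      f0 * c\<^sup>2 + f1 * a * c + f2 * a\<^sup>2))"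

definition lin3 :: "'a :: comm_ring_1 \<Rightarrow> 'a \<Rightarrow> 'a \<times> 'a \<times> 'a \<Rightarrow> 'a \<times> 'a \<times> 'a \<Rightarrow> 'a \<times> 'a \<times> 'a" where
  "lin3 p q f g = (case f of (f0, f1, f2) \<Rightarrow> case g of (g0, g1, g2) \<Rightarrow>
     (p * f0 + q * g0, p * f1 + q * g1, p * f2 + q * g2))"

text \<open>The adjugate of \<open>M = (a, b; c, d)\<close> applied to the pair \<open>(f, g) \<circ> M\<close>.\<close>

definition conjf where "conjf a b c d f g = lin3 d (- b) (comp3 f a b c d) (comp3 g a b c d)"
definition conjg where "conjg a b c d f g = lin3 (- c) a (comp3 f a b c d) (comp3 g a b c d)"

lemma comp3_simp [simp]: "comp3 (f0, f1, f2) a b c d =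
     (f0 * d\<^sup>2 + f1 * b * d + f2 * b\<^sup>2, 2 * f0 * c * d + f1 * (a * d + b * c) + 2 * f2 * a * b,
      f0 * c\<^sup>2 + f1 * a * c + f2 * a\<^sup>2)"
  by (simp add: comp3_def)

lemma lin3_simp [simp]: "lin3 p q (f0, f1, f2) (g0, g1, g2) = (p * f0 + q * g0, p * f1 + q * g1, p * f2 + q * g2)"
  by (simp add: lin3_def)

lemma qf_comp3: "qf (comp3 f a b c d) x y = qf f (a * x + b * y) (c * x + d * y)"
  by (cases f) (simp add: power2_eq_square algebra_simps)

lemma qf_lin3: "qf (lin3 p q f g) x y = p * qf f x y + q * qf g x y"
  by (cases f; cases g) (simp add: algebra_simps)

lemma comp3_comp3: "comp3 (comp3 f a b c d) a' b' c' d' =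
    comp3 f (a * a' + b * c') (a * b' + b * d') (c * a' + d * c') (c * b' + d * d')"
  by (cases f) (simp add: power2_eq_square algebra_simps)

lemma comp3_lin3: "comp3 (lin3 p q f g) a b c d = lin3 p q (comp3 f a b c d) (comp3 g a b c d)"
  by (cases f; cases g) (simp add: power2_eq_square algebra_simps)

lemma lin3_lin3: "lin3 p q (lin3 p1 q1 f g) (lin3 p2 q2 f g) = lin3 (p * p1 + q * p2) (p * q1 + q * q2) f g"
  by (cases f; cases g) (simp add: algebra_simps)

lemma conj_conj:
  "conjf a' b' c' d' (conjf a b c d f g) (conjg a b c d f g) =
     conjf (a * a' + b * c') (a * b' + b * d') (c * a' + d * c') (c * b' + d * d') f g"
  "conjg a' b' c' d' (conjf a b c d f g) (conjg a b c d f g) =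
     conjg (a * a' + b * c') (a * b' + b * d') (c * a' + d * c') (c * b' + d * d') f g"
proof -
  have 1: "d' * d + - b' * - c = c * b' + d * d'" "d' * - b + - b' * a = - (a * b' + b * d')"
    "- c' * d + a' * - c = - (c * a' + d * c')" "- c' * - b + a' * a = a * a' + b * c'"
    by (simp_all add: algebra_simps)
  show
  "conjf a' b' c' d' (conjf a b c d f g) (conjg a b c d f g) =
     conjf (a * a' + b * c') (a * b' + b * d') (c * a' + d * c') (c * b' + d * d') f g"
  "conjg a' b' c' d' (conjf a b c d f g) (conjg a b c d f g) =
     conjg (a * a' + b * c') (a * b' + b * d') (c * a' + d * c') (c * b' + d * d') f g"
    unfolding conjf_def conjg_def comp3_lin3 comp3_comp3 lin3_lin3 1 by (rule refl)+
qed

lemma qf_conj: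
  "qf (conjf a b c d f g) x y = d * qf f (a * x + b * y) (c * x + d * y) - b * qf g (a * x + b * y) (c * x + d * y)"
  "qf (conjg a b c d f g) x y = a * qf g (a * x + b * y) (c * x + d * y) - c * qf f (a * x + b * y) (c * x + d * y)"
  by (simp_all add: conjf_def conjg_def qf_lin3 qf_comp3)

lemma jac_comp3: "jac (comp3 f a b c d) (comp3 g a b c d) x y =
    (a * d - b * c) * jac f g (a * x + b * y) (c * x + d * y)"
  by (cases f; cases g) (simp add: power2_eq_square algebra_simps)

lemma jac_lin3: "jac (lin3 p q f g) (lin3 p' q' f g) x y = (p * q' - q * p') * jac f g x y"
  by (cases f; cases g) (simp add: power2_eq_square algebra_simps)

lemma jac_conj: "jac (conjf a b c d f g) (conjg a b c d f g) x y =
    (a * d - b * c)\<^sup>2 * jac f g (a * x + b * y) (c * x + d * y)"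
  unfolding conjf_def conjg_def jac_lin3 jac_comp3 by (simp add: power2_eq_square algebra_simps)

lemma res_lin3: "res (lin3 p q f g) (lin3 p' q' f g) = (p * q' - q * p')\<^sup>2 * res f g"
proof -
  obtain f0 f1 f2 where f: "f = (f0, f1, f2)" by (cases f)
  obtain g0 g1 g2 where g: "g = (g0, g1, g2)" by (cases g)
  have m: "(p * u + q * v) * (p' * w + q' * z) - (p * w + q * z) * (p' * u + q' * v) =
      (p * q' - q * p') * (u * z - w * v)" for u v w z
    by (simp add: algebra_simps)
  show ?thesis unfolding f g lin3_simp res_simp m
    by (simp add: power2_eq_square algebra_simps)
qed

text \<open>The resultant is a quarter of the discriminant of the Jacobian form
  \<open>A * x\<^sup>2 + 2 * B * x * y + D * y\<^sup>2\<close>. That form transforms by substitution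
  and a factor e; each of the two contributes the square of e.\<close>

lemma res_comp3: "res (comp3 f a b c d) (comp3 g a b c d) = (a * d - b * c) ^ 4 * res f g"
proof -
  obtain f0 f1 f2 where f: "f = (f0, f1, f2)" by (cases f)
  obtain g0 g1 g2 where g: "g = (g0, g1, g2)" by (cases g)
  define A B D e where "A = f2 * g1 - f1 * g2" "B = f2 * g0 - f0 * g2" "D = f1 * g0 - f0 * g1" "e = a * d - b * c"
  obtain h0 h1 h2 where h: "comp3 f a b c d = (h0, h1, h2)" by (cases "comp3 f a b c d")
  obtain k0 k1 k2 where k: "comp3 g a b c d = (k0, k1, k2)" by (cases "comp3 g a b c d")
  have 1: "h2 * k1 - h1 * k2 = e * (A * a\<^sup>2 + 2 * B * a * c + D * c\<^sup>2)"
    "h2 * k0 - h0 * k2 = e * (A * a * b + B * (a * d + b * c) + D * c * d)"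
    "h1 * k0 - h0 * k1 = e * (A * b\<^sup>2 + 2 * B * b * d + D * d\<^sup>2)"
    using h k unfolding f g comp3_simp A_B_D_e_def
    by (auto simp: power2_eq_square algebra_simps)
  have "res (h0, h1, h2) (k0, k1, k2) = e\<^sup>2 * ((A * a * b + B * (a * d + b * c) + D * c * d)\<^sup>2 -
      (A * a\<^sup>2 + 2 * B * a * c + D * c\<^sup>2) * (A * b\<^sup>2 + 2 * B * b * d + D * d\<^sup>2))"
    unfolding res_simp 1 by (simp add: power2_eq_square algebra_simps)
  also have "(A * a * b + B * (a * d + b * c) + D * c * d)\<^sup>2 -
      (A * a\<^sup>2 + 2 * B * a * c + D * c\<^sup>2) * (A * b\<^sup>2 + 2 * B * b * d + D * d\<^sup>2) = e\<^sup>2 * (B\<^sup>2 - A * D)"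
    unfolding A_B_D_e_def(4) by (simp add: power2_eq_square algebra_simps)
  also have "B\<^sup>2 - A * D = res f g" by (simp add: f g A_B_D_e_def)
  finally show ?thesis unfolding h k by (simp add: A_B_D_e_def(4) power4_eq_xxxx power2_eq_square mult_ac)
qed

lemma res_conj: "res (conjf a b c d f g) (conjg a b c d f g) = (a * d - b * c) ^ 6 * res f g"
proof -
  have "d * a - - b * - c = a * d - b * c" by (simp add: mult.commute)
  moreover have "(a * d - b * c)\<^sup>2 * ((a * d - b * c) ^ 4 * res f g) = (a * d - b * c) ^ 6 * res f g"
    by (simp add: mult.assoc[symmetric] power_add[symmetric])
  ultimately show ?thesis unfolding conjf_def conjg_def res_lin3 res_comp3 by (simp only:)
qed

lemma coprime_linear:
  fixes a b c d :: "'k :: field_gcd"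
  assumes "a * d - b * c \<noteq> 0"
  shows "coprime [:b, a:] [:d, c:]" "[:d, c:] \<noteq> 0"
proof -
  show "[:d, c:] \<noteq> 0" using assms by auto
  show "coprime [:b, a:] [:d, c:]"
  proof (rule coprime_if_no_prime)
    fix p assume p: "prime_elem p" "p dvd [:b, a:]" "p dvd [:d, c:]"
    have "p dvd smult a [:d, c:] - smult c [:b, a:]"
      by (rule dvd_diff; rule dvd_smult; rule p)
    also have "smult a [:d, c:] - smult c [:b, a:] = [:a * d - b * c:]" by (simp add: mult.commute)
    finally show False using const_prime_not_dvd[OF p(1) assms] by blast
  qed (use assms in auto)
qed

lemma rf_comp_linear:
  fixes a b c d :: "'k :: field_gcd"
  assumes "coprime [:b, a:] [:d, c:]" "[:d, c:] \<noteq> 0" "Q \<noteq> 0"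
  shows "rf_comp (Fract [:b, a:] [:d, c:]) (Fract P Q) = Fract (smult a P + smult b Q) (smult c P + smult d Q)"
proof -
  have e: "pq (b, a, 0) = [:b, a:]" "pq (d, c, 0) = [:d, c:]" by simp_all
  have "rf_comp (rf_q (b, a, 0) (d, c, 0)) (Fract P Q) =
      Fract (qf (cst (b, a, 0)) P Q) (qf (cst (d, c, 0)) P Q)"
    by (rule rf_comp_Fract) (use assms in \<open>simp_all only: e not_False_eq_True\<close>)
  also have "\<dots> = Fract ((smult a P + smult b Q) * Q) ((smult c P + smult d Q) * Q)"
    by (simp add: power2_eq_square algebra_simps)
  also have "\<dots> = Fract (smult a P + smult b Q) (smult c P + smult d Q)"
    using assms(3) by (cases "smult c P + smult d Q = 0") (simp_all add: eq_fract)
  finally show ?thesis unfolding rf_q_def e .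
qed

lemma rf_comp_q_linear:
  fixes f g :: "'k :: field_gcd \<times> 'k \<times> 'k"
  assumes r: "res f g \<noteq> 0" and dc: "[:d, c:] \<noteq> 0"
  shows "rf_comp (rf_q f g) (Fract [:b, a:] [:d, c:]) = rf_q (comp3 f a b c d) (comp3 g a b c d)"
proof -
  have "qf (cst h) [:b, a:] [:d, c:] = pq (comp3 h a b c d)" for h
    by (cases h) (simp add: power2_eq_square algebra_simps)
  thus ?thesis using rf_comp_Fract[OF coprime_pq[OF r] res_imp_pq_nonzero(2)[OF r] dc, of "[:b, a:]"]
    by (simp add: rf_q_def)
qed

lemma pq_lin3: "pq (lin3 p q f g) = smult p (pq f) + smult q (pq g)"
  by (cases f; cases g) simp

lemma Fract_X: "Fract [:0, k:] [:k:] = (rf_X :: 'k :: field poly fract)" if "k \<noteq> 0"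
  using that by (simp add: rf_X_def to_fract_def eq_fract)

lemma rf_degree_Fract:
  assumes "coprime p q" "q \<noteq> (0 :: 'k :: field_gcd poly)"
  shows "rf_degree (Fract p q) = max (degree p) (degree q)"
proof -
  obtain c where "c \<noteq> 0" "rf_num (Fract p q) = smult c p" "rf_den (Fract p q) = smult c q"
    by (rule rf_Fract[OF assms])
  thus ?thesis by (simp add: rf_degree_def)
qed

lemma conjugateI:
  fixes f g :: "'k :: field_gcd \<times> 'k \<times> 'k"
  assumes r: "res f g \<noteq> 0" and det: "a * d - b * c \<noteq> 0"
  shows "conjugate (rf_q f g) (rf_q (conjf a b c d f g) (conjg a b c d f g))"
proof -
  define s t where "s = Fract [:b, a:] [:d, c:]" "t = Fract [:- b, d:] [:a, - c:]"
  have det': "d * a - - b * - c \<noteq> 0" using det by (simp add: mult.commute)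
  note cop = coprime_linear[OF det] coprime_linear[OF det']
  have "rf_degree s = 1" "rf_degree t = 1"
    unfolding s_t_def rf_degree_Fract[OF cop(1,2)] rf_degree_Fract[OF cop(3,4)] using det by (auto simp: max_def)
  moreover have "rf_comp s t = rf_X"
  proof -
    have "rf_comp s t = Fract [:0, a * d - b * c:] [:a * d - b * c:]"
      unfolding s_t_def rf_comp_linear[OF cop(1,2) cop(4)] by (simp add: algebra_simps)
    thus ?thesis using Fract_X[OF det] by simp
  qed
  moreover have "rf_comp t s = rf_X"
  proof -
    have "rf_comp t s = Fract [:0, a * d - b * c:] [:a * d - b * c:]"
      unfolding s_t_def rf_comp_linear[OF cop(3,4) cop(2)] by (simp add: algebra_simps)
    thus ?thesis using Fract_X[OF det] by simp
  qed
  moreover have "rf_q (conjf a b c d f g) (conjg a b c d f g) = rf_comp t (rf_comp (rf_q f g) s)"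
  proof -
    have "res (comp3 f a b c d) (comp3 g a b c d) \<noteq> 0" using r det by (simp add: res_comp3)
    hence "pq (comp3 g a b c d) \<noteq> 0" by (rule res_imp_pq_nonzero)
    from rf_comp_linear[OF cop(3,4) this] show ?thesis
      unfolding s_t_def rf_comp_q_linear[OF r cop(2)] unfolding rf_q_def conjf_def conjg_def pq_lin3 by simp
  qed
  ultimately show ?thesis unfolding conjugate_def by blast
qed

lemma rf_degree_1_rep:
  assumes "rf_degree (s :: 'k :: field_gcd poly fract) = 1"
  obtains a b c d where "s = Fract [:b, a:] [:d, c:]" "coprime [:b, a:] [:d, c:]" "[:d, c:] \<noteq> 0"
proof -
  have lin: "p = [:coeff p 0, coeff p 1:]" if "degree p \<le> 1" for p :: "'k poly"
  proof (rule poly_eqI)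
    fix n
    show "coeff p n = coeff [:coeff p 0, coeff p 1:] n"
      using that by (auto simp: coeff_pCons coeff_eq_0 split: nat.split)
  qed
  have "degree (rf_num s) \<le> 1" "degree (rf_den s) \<le> 1" using assms by (simp_all add: rf_degree_def)
  note l = lin[OF this(1)] lin[OF this(2)]
  have "s = Fract [:coeff (rf_num s) 0, coeff (rf_num s) 1:] [:coeff (rf_den s) 0, coeff (rf_den s) 1:]"
    unfolding l[symmetric] by (rule rf_quot_spec)
  moreover have "coprime [:coeff (rf_num s) 0, coeff (rf_num s) 1:] [:coeff (rf_den s) 0, coeff (rf_den s) 1:]"
    unfolding l[symmetric] by (rule rf_quot_spec)
  moreover have "[:coeff (rf_den s) 0, coeff (rf_den s) 1:] \<noteq> 0"
    unfolding l[symmetric] by (rule rf_quot_spec)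
  ultimately show ?thesis by (rule that)
qed

lemma rf_q_scale:
  fixes f g :: "'k :: field \<times> 'k \<times> 'k"
  assumes "k \<noteq> 0"
  shows "rf_q (map3 ((*) k) f) (map3 ((*) k) g) = rf_q f g"
proof -
  have "pq (map3 ((*) k) h) = smult k (pq h)" for h by (cases h) simp
  thus ?thesis using assms by (cases "pq g = 0") (simp_all add: rf_q_def eq_fract)
qed

text \<open>Since \<sigma> and \<tau> compose to the identity, the product of their matrices is a
  scalar k, so the matrix of \<tau> is a multiple of the adjugate of that of \<sigma>. The multiple
  drops out of the quotient.\<close>

lemma conjugateE:
  fixes f g :: "'k :: field_gcd \<times> 'k \<times> 'k"
  assumes r: "res f g \<noteq> 0" and con: "conjugate (rf_q f g) \<psi>"
  obtains a b c d where "a * d - b * c \<noteq> 0" "\<psi> = rf_q (conjf a b c d f g) (conjg a b c d f g)"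
proof -
  obtain s t where st: "rf_degree s = 1" "rf_degree t = 1" "rf_comp s t = rf_X"
    "\<psi> = rf_comp t (rf_comp (rf_q f g) s)"
    using con unfolding conjugate_def by blast
  obtain a b c d where s: "s = Fract [:b, a:] [:d, c:]" "coprime [:b, a:] [:d, c:]" "[:d, c:] \<noteq> 0"
    by (rule rf_degree_1_rep[OF st(1)])
  obtain a' b' c' d' where t: "t = Fract [:b', a':] [:d', c':]" "coprime [:b', a':] [:d', c':]" "[:d', c':] \<noteq> 0"
    by (rule rf_degree_1_rep[OF st(2)])
  define p q where "p = smult a [:b', a':] + smult b [:d', c':]" "q = smult c [:b', a':] + smult d [:d', c':]"
  have X: "Fract p q = Fract [:0, 1:] 1"
    using st(3) rf_comp_linear[OF s(2,3) t(3)] unfolding s(1) t(1) p_q_def by (simp add: rf_X_def to_fract_def)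
  have q0: "q \<noteq> 0"
  proof
    assume "q = 0"
    hence "Fract [:0, 1:] 1 = (Fract 0 1 :: 'k poly fract)" using X eq_fract(2)[of p] by simp
    thus False by (simp add: eq_fract(1))
  qed
  have "p = [:0, 1:] * q" using X q0 by (simp add: eq_fract)
  hence eqs: "a * b' + b * d' = 0" "a * a' + b * c' = c * b' + d * d'" "c * a' + d * c' = 0"
    unfolding p_q_def by simp_all
  define k where "k = a * a' + b * c'"
  have k: "k \<noteq> 0" using q0 eqs unfolding p_q_def k_def by auto
  have dd: "(a * d - b * c) * (a' * d' - b' * c') = k\<^sup>2"
  proof -
    have "(a * d - b * c) * (a' * d' - b' * c') =
      (a * a' + b * c') * (c * b' + d * d') - (a * b' + b * d') * (c * a' + d * c')"
      by (simp add: algebra_simps)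
    thus ?thesis using eqs by (simp add: k_def power2_eq_square)
  qed
  hence det: "a * d - b * c \<noteq> 0" using k by auto
  define m where "m = k / (a * d - b * c)"
  have m: "m \<noteq> 0" using k det by (simp add: m_def)
  have inv: "a' = m * d" "b' = m * - b" "c' = m * - c" "d' = m * a"
  proof -
    have "(a * d - b * c) * a' = d * (a * a' + b * c') - b * (c * a' + d * c')"
      "(a * d - b * c) * b' = d * (a * b' + b * d') - b * (c * b' + d * d')"
      "(a * d - b * c) * c' = a * (c * a' + d * c') - c * (a * a' + b * c')"
      "(a * d - b * c) * d' = a * (c * b' + d * d') - c * (a * b' + b * d')"
      by (simp_all add: algebra_simps)
    hence "(a * d - b * c) * a' = d * k" "(a * d - b * c) * b' = - b * k"
      "(a * d - b * c) * c' = - c * k" "(a * d - b * c) * d' = a * k"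
      using eqs by (simp_all add: k_def)
    moreover have "z' = m * z" if "(a * d - b * c) * z' = z * k" for z z'
      using that det by (simp add: m_def nonzero_eq_divide_eq mult.commute)
    ultimately show "a' = m * d" "b' = m * - b" "c' = m * - c" "d' = m * a" by blast+
  qed
  have "res (comp3 f a b c d) (comp3 g a b c d) \<noteq> 0" using r det by (simp add: res_comp3)
  hence "pq (comp3 g a b c d) \<noteq> 0" by (rule res_imp_pq_nonzero)
  from rf_comp_linear[OF t(2,3) this]
  have "\<psi> = rf_q (lin3 a' b' (comp3 f a b c d) (comp3 g a b c d)) (lin3 c' d' (comp3 f a b c d) (comp3 g a b c d))"
    unfolding st(4) s(1) t(1) rf_comp_q_linear[OF r s(3)] unfolding rf_q_def pq_lin3 .
  also have "\<dots> = rf_q (map3 ((*) m) (conjf a b c d f g)) (map3 ((*) m) (conjg a b c d f g))"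
  proof -
    have "lin3 (m * p) (m * q) F G = map3 ((*) m) (lin3 p q F G)" for p q F G
      by (cases F; cases G) (simp add: algebra_simps)
    thus ?thesis unfolding inv conjf_def conjg_def by (simp only:)
  qed
  also have "\<dots> = rf_q (conjf a b c d f g) (conjg a b c d f g)" by (rule rf_q_scale[OF m])
  finally show ?thesis using that det by blast
qed

lemma rf_degree_q:
  fixes f g :: "'k :: field_gcd \<times> 'k \<times> 'k"
  assumes r: "res f g \<noteq> 0"
  shows "rf_degree (rf_q f g) = 2"
  unfolding rf_q_def rf_degree_Fract[OF coprime_pq[OF r] res_imp_pq_nonzero(2)[OF r]]
  using r by (cases f; cases g) (auto simp: max_def)

lemma rf_degree_2_rep:
  fixes \<phi> :: "'k :: field_gcd poly fract"
  assumes deg: "rf_degree \<phi> = 2"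
  obtains f g where "\<phi> = rf_q f g" "res f g \<noteq> 0"
proof -
  define tr where "tr p = (coeff p 0, coeff p 1, coeff p 2)" for p :: "'k poly"
  have quad: "pq (tr p) = p" if "degree p \<le> 2" for p :: "'k poly"
  proof (rule poly_eqI)
    fix n :: nat
    have "n = 0 \<or> n = 1 \<or> n = 2 \<or> n > 2" by linarith
    thus "coeff (pq (tr p)) n = coeff p n"
      using that by (auto simp: tr_def coeff_pCons coeff_eq_0 numeral_2_eq_2 split: nat.splits)
  qed
  define f g where "f = tr (rf_num \<phi>)" "g = tr (rf_den \<phi>)"
  have dg: "degree (rf_num \<phi>) \<le> 2" "degree (rf_den \<phi>) \<le> 2" "degree (rf_num \<phi>) = 2 \<or> degree (rf_den \<phi>) = 2"
    using deg unfolding rf_degree_def by linarith+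
  have pqs: "pq f = rf_num \<phi>" "pq g = rf_den \<phi>" using quad dg by (simp_all add: f_g_def)
  have phi: "\<phi> = rf_q f g" unfolding rf_q_def pqs by (rule rf_quot_spec)
  have cop: "coprime (pq f) (pq g)" unfolding pqs by (rule rf_quot_spec)
  obtain f0 f1 f2 where f: "f = (f0, f1, f2)" by (cases f)
  obtain g0 g1 g2 where g: "g = (g0, g1, g2)" by (cases g)
  have top: "f2 \<noteq> 0 \<or> g2 \<noteq> 0"
    using dg(3) unfolding pqs[symmetric] f g by (auto split: if_splits)
  have "res f g \<noteq> 0"
  proof
    assume 0: "res f g = 0"
    define A B D where ABD: "A = f2 * g1 - f1 * g2" "B = f2 * g0 - f0 * g2" "D = f1 * g0 - f0 * g1"
    have BAD: "B * B = A * D" using 0 by (simp add: f g ABD power2_eq_square)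
    show False
    proof (cases "A = 0")
      case False
      \<comment> \<open>The Jacobian form has discriminant 0, and its double root is the common root
        of the two forms.\<close>
      define t where "t = - B / A"
      have At: "A * t = - B" using False by (simp add: t_def)
      have Att: "A * t * t = D"
      proof -
        have "A * (A * t * t) = (A * t) * (A * t)" by (simp add: mult_ac)
        also have "\<dots> = A * D" unfolding At using BAD by simp
        finally show ?thesis using False by simp
      qed
      define F G where "F = f0 + f1 * t + f2 * t * t" "G = g0 + g1 * t + g2 * t * t"
      have 1: "f2 * G - g2 * F = 0" "f1 * G - g1 * F = 0"
      proof -
        have "f2 * G - g2 * F = A * t + B" by (simp add: F_G_def ABD algebra_simps)
        thus "f2 * G - g2 * F = 0" using At by simp
        have "f1 * G - g1 * F = D - A * t * t" by (simp add: F_G_def ABD algebra_simps)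
        thus "f1 * G - g1 * F = 0" using Att by simp
      qed
      have "F * A = f2 * (g1 * F - f1 * G) - f1 * (g2 * F - f2 * G)" "G * A = g1 * (f2 * G - g2 * F) - g2 * (f1 * G - g1 * F)"
        by (simp_all add: ABD algebra_simps)
      moreover have "g1 * F - f1 * G = 0" "g2 * F - f2 * G = 0" using 1 by simp_all
      ultimately have "F * A = 0" "G * A = 0" using 1 by (simp_all only: mult_zero_right diff_self)
      hence "F = 0" "G = 0" using False by simp_all
      hence "poly (pq f) t = 0" "poly (pq g) t = 0" by (simp_all add: f g F_G_def algebra_simps)
      hence "[:-t, 1:] dvd pq f" "[:-t, 1:] dvd pq g" by (simp_all only: poly_eq_0_iff_dvd)
      hence "is_unit [:-t, 1:]" by (rule coprime_common_divisor[OF cop])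
      thus False by (simp add: is_unit_iff_degree)
    next
      case True
      hence B0: "B = 0" using BAD by simp
      have "f2 * D = f1 * B - f0 * A" "g2 * D = g1 * B - g0 * A" by (simp_all add: ABD algebra_simps)
      hence D0: "D = 0" using True B0 top by auto
      \<comment> \<open>Here all 2 by 2 minors of the coefficients vanish, so the two forms are
        proportional.\<close>
      have eq: "smult f2 (pq g) = smult g2 (pq f)"
        using True B0 by (simp add: f g ABD algebra_simps)
      show False
      proof (cases "f2 = 0")
        case False
        have "pq f dvd smult f2 (pq g)" unfolding eq by (rule dvd_smult) simp
        hence "pq f dvd pq g" using False by (simp add: dvd_smult_iff)
        hence "is_unit (pq f)" by (intro coprime_common_divisor[OF cop]) simp_all
        thus False using False by (simp add: f is_unit_iff_degree)
      next
        case True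
        hence g2: "g2 \<noteq> 0" using top by simp
        have "pq g dvd smult g2 (pq f)" unfolding eq[symmetric] by (rule dvd_smult) simp
        hence "pq g dvd pq f" using g2 by (simp add: dvd_smult_iff)
        hence "is_unit (pq g)" by (intro coprime_common_divisor[OF cop]) simp_all
        thus False using g2 by (simp add: g is_unit_iff_degree)
      qed
    qed
  qed
  with phi show ?thesis by (rule that)
qed

subsection \<open>Multipliers of the fixed points as conjugacy invariants\<close>

text \<open>Phrased through lifts and their scalars k, so that conjugation acts linearly and
  \<infinity> needs no chart of its own.\<close>

definition fixed_multipliers where
  "fixed_multipliers f g m1 m2 m3 \<longleftrightarrow> (\<exists>c x1 y1 x2 y2 x3 y3 k1 k2 k3. fix3 f g c x1 y1 x2 y2 x3 y3 \<and>
     qf f x1 y1 = k1 * x1 \<and> qf g x1 y1 = k1 * y1 \<and>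
     qf f x2 y2 = k2 * x2 \<and> qf g x2 y2 = k2 * y2 \<and>
     qf f x3 y3 = k3 * x3 \<and> qf g x3 y3 = k3 * y3 \<and>
     m1 = jac f g x1 y1 / k1\<^sup>2 \<and> m2 = jac f g x2 y2 / k2\<^sup>2 \<and> m3 = jac f g x3 y3 / k3\<^sup>2)"

lemma fixed_multipliersI:
  assumes "fix3 f g c x1 y1 x2 y2 x3 y3"
    "qf f x1 y1 = k1 * x1" "qf g x1 y1 = k1 * y1"
    "qf f x2 y2 = k2 * x2" "qf g x2 y2 = k2 * y2"
    "qf f x3 y3 = k3 * x3" "qf g x3 y3 = k3 * y3"
  shows "fixed_multipliers f g (jac f g x1 y1 / k1\<^sup>2) (jac f g x2 y2 / k2\<^sup>2) (jac f g x3 y3 / k3\<^sup>2)"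
  using assms unfolding fixed_multipliers_def by blast

lemma fixed_multipliers_esym:
  fixes f g :: "'k :: {field_gcd, field_char_0} \<times> 'k \<times> 'k"
  assumes "res f g \<noteq> 0" "fixed_multipliers f g m1 m2 m3"
  shows "multiplier_esym 1 (rf_q f g) = m1 + m2 + m3"
    "multiplier_esym 2 (rf_q f g) = m1 * m2 + m1 * m3 + m2 * m3"
  using assms(2) multiplier_esym_q[OF assms(1)] unfolding fixed_multipliers_def by blast+

lemma jac_scale_map3: "jac (map3 ((*) k) f) (map3 ((*) k) g) x y = k\<^sup>2 * jac f g x y"
  by (cases f; cases g) (simp add: power2_eq_square algebra_simps)

lemma qf_scale_map3: "qf (map3 ((*) k) f) x y = k * qf f x y"
  by (cases f) (simp add: algebra_simps)

lemma fixed_multipliers_scale: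
  fixes f g :: "'k :: field \<times> 'k \<times> 'k"
  assumes k: "k \<noteq> 0" and fm: "fixed_multipliers f g m1 m2 m3"
  shows "fixed_multipliers (map3 ((*) k) f) (map3 ((*) k) g) m1 m2 m3"
proof -
  obtain c x1 y1 x2 y2 x3 y3 k1 k2 k3 where fx: "fix3 f g c x1 y1 x2 y2 x3 y3"
    and e: "qf f x1 y1 = k1 * x1" "qf g x1 y1 = k1 * y1" "qf f x2 y2 = k2 * x2" "qf g x2 y2 = k2 * y2"
      "qf f x3 y3 = k3 * x3" "qf g x3 y3 = k3 * y3"
    and m: "m1 = jac f g x1 y1 / k1\<^sup>2" "m2 = jac f g x2 y2 / k2\<^sup>2" "m3 = jac f g x3 y3 / k3\<^sup>2"
    using fm unfolding fixed_multipliers_def by blast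
  have "x * (k * qf g x y) - y * (k * qf f x y) = k * c * (x * y1 - y * x1) * (x * y2 - y * x2) * (x * y3 - y * x3)" for x y
  proof -
    have "x * (k * qf g x y) - y * (k * qf f x y) = k * (x * qf g x y - y * qf f x y)"
      by (simp add: algebra_simps)
    also have "x * qf g x y - y * qf f x y = c * (x * y1 - y * x1) * (x * y2 - y * x2) * (x * y3 - y * x3)"
      using fx unfolding fix3_def by blast
    finally show ?thesis by (simp only: mult.assoc)
  qed
  hence "fix3 (map3 ((*) k) f) (map3 ((*) k) g) (k * c) x1 y1 x2 y2 x3 y3"
    using fx k unfolding fix3_def qf_scale_map3 by simp
  hence "fixed_multipliers (map3 ((*) k) f) (map3 ((*) k) g) (k\<^sup>2 * jac f g x1 y1 / (k * k1)\<^sup>2)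
      (k\<^sup>2 * jac f g x2 y2 / (k * k2)\<^sup>2) (k\<^sup>2 * jac f g x3 y3 / (k * k3)\<^sup>2)"
    unfolding jac_scale_map3[symmetric] by (rule fixed_multipliersI) (simp_all add: qf_scale_map3 e)
  moreover have "k\<^sup>2 * j / (k * k')\<^sup>2 = j / k'\<^sup>2" for j k' :: 'k
    using k by (simp add: power_mult_distrib)
  ultimately show ?thesis unfolding m by (simp only:)
qed

text \<open>The matrix carries a lifted fixed point with scalar k to one with scalar k / D; the
  factor \<open>D\<^sup>2\<close> in \<open>jac_conj\<close> compensates exactly for this.\<close>

lemma fixed_multipliers_conjD:
  fixes f g :: "'k :: field \<times> 'k \<times> 'k"
  assumes det: "a * d - b * c \<noteq> 0"
    and fm: "fixed_multipliers (conjf a b c d f g) (conjg a b c d f g) m1 m2 m3"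
  shows "fixed_multipliers f g m1 m2 m3"
proof -
  let ?f = "conjf a b c d f g" and ?g = "conjg a b c d f g"
  define D where "D = a * d - b * c"
  obtain e x1 y1 x2 y2 x3 y3 k1 k2 k3 where fx: "fix3 ?f ?g e x1 y1 x2 y2 x3 y3"
    and ev: "qf ?f x1 y1 = k1 * x1" "qf ?g x1 y1 = k1 * y1" "qf ?f x2 y2 = k2 * x2" "qf ?g x2 y2 = k2 * y2"
      "qf ?f x3 y3 = k3 * x3" "qf ?g x3 y3 = k3 * y3"
    and m: "m1 = jac ?f ?g x1 y1 / k1\<^sup>2" "m2 = jac ?f ?g x2 y2 / k2\<^sup>2" "m3 = jac ?f ?g x3 y3 / k3\<^sup>2"
    using fm unfolding fixed_multipliers_def by blast
  have D: "D \<noteq> 0" using det by (simp add: D_def)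
  have nz: "a * x + b * y \<noteq> 0 \<or> c * x + d * y \<noteq> 0" if "x \<noteq> 0 \<or> y \<noteq> 0" for x y
  proof (rule ccontr)
    assume "\<not> ?thesis"
    hence 0: "a * x + b * y = 0" "c * x + d * y = 0" by simp_all
    have "D * x = d * (a * x + b * y) - b * (c * x + d * y)" "D * y = a * (c * x + d * y) - c * (a * x + b * y)"
      by (simp_all add: D_def algebra_simps)
    thus False using that D unfolding 0 by simp
  qed
  have eig: "qf f (a * x + b * y) (c * x + d * y) = k / D * (a * x + b * y)"
      "qf g (a * x + b * y) (c * x + d * y) = k / D * (c * x + d * y)"
    if "qf ?f x y = k * x" "qf ?g x y = k * y" for x y k
  proof -
    let ?F = "qf f (a * x + b * y) (c * x + d * y)" and ?G = "qf g (a * x + b * y) (c * x + d * y)"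
    have 1: "d * ?F - b * ?G = k * x" "a * ?G - c * ?F = k * y" using that unfolding qf_conj .
    have "D * ?F = a * (d * ?F - b * ?G) + b * (a * ?G - c * ?F)" "D * ?G = c * (d * ?F - b * ?G) + d * (a * ?G - c * ?F)"
      by (simp_all add: D_def algebra_simps)
    hence "D * ?F = k * (a * x + b * y)" "D * ?G = k * (c * x + d * y)" unfolding 1 by (simp_all add: algebra_simps)
    thus "?F = k / D * (a * x + b * y)" "?G = k / D * (c * x + d * y)" using D by (simp_all add: nonzero_eq_divide_eq mult.commute)
  qed
  have mul: "jac ?f ?g x y / k\<^sup>2 = jac f g (a * x + b * y) (c * x + d * y) / (k / D)\<^sup>2" for x y k
    unfolding jac_conj D_def[symmetric] by (simp add: power_divide)
  have "x * qf g x y - y * qf f x y = e / D ^ 3 * (x * (c * x1 + d * y1) - y * (a * x1 + b * y1)) *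
      (x * (c * x2 + d * y2) - y * (a * x2 + b * y2)) * (x * (c * x3 + d * y3) - y * (a * x3 + b * y3))" for x y
  proof -
    \<comment> \<open>The adjugate applied to (x, y): the matrix sends (v, w) to D (x, y), so the
      factorisation at (v, w) is transported to (x, y).\<close>
    define v w where "v = d * x - b * y" "w = a * y - c * x"
    have vw: "a * v + b * w = D * x" "c * v + d * w = D * y" by (simp_all add: v_w_def D_def algebra_simps)
    have lin: "x * (c * s + d * t) - y * (a * s + b * t) = v * t - w * s" for s t
      by (simp add: v_w_def algebra_simps)
    have "v * qf ?g v w - w * qf ?f v w = (a * v + b * w) * (D\<^sup>2 * qf g x y) - (c * v + d * w) * (D\<^sup>2 * qf f x y)"
      unfolding qf_conj vw qf_scale[symmetric] by (simp add: vw[symmetric] algebra_simps)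
    also have "\<dots> = D ^ 3 * (x * qf g x y - y * qf f x y)" unfolding vw
      by (simp add: power2_eq_square power3_eq_cube algebra_simps)
    also have "v * qf ?g v w - w * qf ?f v w = e * (v * y1 - w * x1) * (v * y2 - w * x2) * (v * y3 - w * x3)"
      using fx unfolding fix3_def by blast
    finally have "D ^ 3 * (x * qf g x y - y * qf f x y) = e * (v * y1 - w * x1) * (v * y2 - w * x2) * (v * y3 - w * x3)" ..
    thus ?thesis unfolding lin using D by (simp add: nonzero_eq_divide_eq mult.commute)
  qed
  moreover have "e / D ^ 3 \<noteq> 0" using fx D by (simp add: fix3_def)
  ultimately have "fix3 f g (e / D ^ 3) (a * x1 + b * y1) (c * x1 + d * y1) (a * x2 + b * y2) (c * x2 + d * y2)
      (a * x3 + b * y3) (c * x3 + d * y3)"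
    using fx nz unfolding fix3_def by blast
  thus ?thesis unfolding m mul
    by (rule fixed_multipliersI) (rule eig[OF ev(1,2)] eig[OF ev(3,4)] eig[OF ev(5,6)])+
qed

lemma conj_scalar:
  "conjf e 0 0 e f g = map3 ((*) (e ^ 3)) f" "conjg e 0 0 e f g = map3 ((*) (e ^ 3)) g"
  by (cases f; cases g; simp add: conjf_def conjg_def power2_eq_square power3_eq_cube mult_ac)+

lemma conj_adjugate:
  fixes f g :: "'k :: comm_ring_1 \<times> 'k \<times> 'k"
  shows "conjf d (- b) (- c) a (conjf a b c d f g) (conjg a b c d f g) = map3 ((*) ((a * d - b * c) ^ 3)) f"
    "conjg d (- b) (- c) a (conjf a b c d f g) (conjg a b c d f g) = map3 ((*) ((a * d - b * c) ^ 3)) g"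
proof -
  have e: "a * d + b * - c = a * d - b * c" "a * - b + b * a = 0" "c * d + d * - c = 0" "c * - b + d * a = a * d - b * c"
    by (simp_all add: algebra_simps)
  show "conjf d (- b) (- c) a (conjf a b c d f g) (conjg a b c d f g) = map3 ((*) ((a * d - b * c) ^ 3)) f"
    "conjg d (- b) (- c) a (conjf a b c d f g) (conjg a b c d f g) = map3 ((*) ((a * d - b * c) ^ 3)) g"
    unfolding conj_conj e conj_scalar by (rule refl)+
qed

text \<open>Conjugation by the adjugate undoes conjugation by the matrix up to a scalar, so this
  direction follows from the other one.\<close>

lemma fixed_multipliers_conjI:
  fixes f g :: "'k :: field \<times> 'k \<times> 'k"
  assumes det: "a * d - b * c \<noteq> 0" and fm: "fixed_multipliers f g m1 m2 m3"
  shows "fixed_multipliers (conjf a b c d f g) (conjg a b c d f g) m1 m2 m3"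
proof -
  have det': "d * a - - b * - c \<noteq> 0" using det by (simp add: mult.commute)
  have "(a * d - b * c) ^ 3 \<noteq> 0" using det by simp
  from fixed_multipliers_scale[OF this fm] show ?thesis
    unfolding conj_adjugate[of d b c a f g, symmetric] by (rule fixed_multipliers_conjD[OF det'])
qed

text \<open>\<open>the_elem\<close> returns the common value because the coordinates are constant on
  the class and the class is nonempty, as the identity matrix shows.\<close>

lemma moduli_coords_q:
  fixes f g :: "'k :: {field_gcd, field_char_0} \<times> 'k \<times> 'k"
  assumes r: "res f g \<noteq> 0" and fm: "fixed_multipliers f g m1 m2 m3"
  shows "moduli_coords (conj_class (rf_q f g)) = (m1 + m2 + m3, m1 * m2 + m1 * m3 + m2 * m3)"
proof -
  let ?v = "(m1 + m2 + m3, m1 * m2 + m1 * m3 + m2 * m3)"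
  have "(\<lambda>\<phi>. (multiplier_esym 1 \<phi>, multiplier_esym 2 \<phi>)) ` conj_class (rf_q f g) = (\<lambda>_. ?v) ` conj_class (rf_q f g)"
  proof (rule image_cong[OF refl])
    fix \<psi> assume "\<psi> \<in> conj_class (rf_q f g)"
    hence con: "conjugate (rf_q f g) \<psi>" by (simp add: conj_class_def)
    obtain a b c d where M: "a * d - b * c \<noteq> 0" "\<psi> = rf_q (conjf a b c d f g) (conjg a b c d f g)"
      by (rule conjugateE[OF r con])
    have "res (conjf a b c d f g) (conjg a b c d f g) \<noteq> 0" using r M(1) by (simp add: res_conj)
    from fixed_multipliers_esym[OF this fixed_multipliers_conjI[OF M(1) fm]]
    show "(multiplier_esym 1 \<psi>, multiplier_esym 2 \<psi>) = ?v" by (simp add: M(2))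
  qed
  moreover have "conjugate (rf_q f g) (rf_q (conjf 1 0 0 1 f g) (conjg 1 0 0 1 f g))"
    by (rule conjugateI[OF r]) simp
  hence "conj_class (rf_q f g) \<noteq> {}" unfolding conj_class_def by blast
  ultimately have "(\<lambda>\<phi>. (multiplier_esym 1 \<phi>, multiplier_esym 2 \<phi>)) ` conj_class (rf_q f g) = {?v}"
    by (simp add: image_constant_conv)
  thus ?thesis unfolding moduli_coords_def by simp
qed

lemma fixed_multipliers_nf:
  fixes b u :: "'k :: {alg_closed_field, field_gcd, field_char_0}"
  assumes b: "b \<noteq> 0"
  obtains m1 m2 m3 where "fixed_multipliers (1, u, 1) (0, b, 0) m1 m2 m3"
    "m1 + m2 + m3 = r_of b u" "m1 * m2 + m1 * m3 + m2 * m3 = s_of b u"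
proof -
  \<comment> \<open>The fixed points other than [1 : 0] are written as [1 : \<alpha>] and
    [1 : \<beta>]. In this coordinate their polynomial is monic also for b = 1, when one of them
    merges with \<infinity>.\<close>
  obtain \<alpha> where "poly [:1 - b, u, 1:] \<alpha> = 0"
    using alg_closed_imp_poly_has_root[of "[:1 - b, u, 1:]"] by auto
  hence \<alpha>: "\<alpha> * \<alpha> + u * \<alpha> + 1 = b" by (simp add: algebra_simps)
  define \<beta> where "\<beta> = - u - \<alpha>"
  have u: "u = - \<alpha> - \<beta>" by (simp add: \<beta>_def)
  have b': "b = 1 - \<alpha> * \<beta>" using \<alpha> by (simp add: \<beta>_def algebra_simps)
  have "fix3 (1, u, 1) (0, b, 0) 1 1 0 1 \<alpha> 1 \<beta>"
    unfolding fix3_def u b' by (simp add: power2_eq_square algebra_simps)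
  hence "fixed_multipliers (1, u, 1) (0, b, 0) (jac (1, u, 1) (0, b, 0) 1 0 / 1\<^sup>2)
      (jac (1, u, 1) (0, b, 0) 1 \<alpha> / b\<^sup>2) (jac (1, u, 1) (0, b, 0) 1 \<beta> / b\<^sup>2)"
    by (rule fixed_multipliersI) (simp_all add: b' u power2_eq_square algebra_simps)
  moreover have "jac (1, u, 1) (0, b, 0) 1 0 / 1\<^sup>2 = b" by (simp add: jac_def)
  moreover have "jac (1, u, 1) (0, b, 0) 1 z / b\<^sup>2 = (1 - z\<^sup>2) / b" for z
    using b by (simp add: jac_def power2_eq_square field_simps)
  ultimately have fm: "fixed_multipliers (1, u, 1) (0, b, 0) b ((1 - \<alpha>\<^sup>2) / b) ((1 - \<beta>\<^sup>2) / b)"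
    by (simp only:)
  have sq: "\<alpha>\<^sup>2 + \<beta>\<^sup>2 = u\<^sup>2 - 2 * (1 - b)"
    by (simp add: u b' power2_eq_square algebra_simps)
  have ab: "\<alpha> * \<beta> = 1 - b" using b' by simp
  have "b + (1 - \<alpha>\<^sup>2) / b + (1 - \<beta>\<^sup>2) / b = b + (2 - (\<alpha>\<^sup>2 + \<beta>\<^sup>2)) / b"
    by (simp add: add_divide_distrib diff_divide_distrib)
  also have "\<dots> = r_of b u" unfolding sq r_of_def by (simp add: algebra_simps)
  finally have 1: "b + (1 - \<alpha>\<^sup>2) / b + (1 - \<beta>\<^sup>2) / b = r_of b u" .
  have "b * ((1 - \<alpha>\<^sup>2) / b) + b * ((1 - \<beta>\<^sup>2) / b) + (1 - \<alpha>\<^sup>2) / b * ((1 - \<beta>\<^sup>2) / b) =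
      2 - (\<alpha>\<^sup>2 + \<beta>\<^sup>2) + (1 - (\<alpha>\<^sup>2 + \<beta>\<^sup>2) + (\<alpha> * \<beta>)\<^sup>2) / b\<^sup>2"
    using b by (simp add: power2_eq_square algebra_simps)
  also have "\<dots> = s_of b u"
    unfolding sq ab s_of_def by (simp add: power2_eq_square algebra_simps)
  finally have 2: "b * ((1 - \<alpha>\<^sup>2) / b) + b * ((1 - \<beta>\<^sup>2) / b) + (1 - \<alpha>\<^sup>2) / b * ((1 - \<beta>\<^sup>2) / b) = s_of b u" .
  show ?thesis by (rule that[OF fm 1 2])
qed

subsection \<open>Normal form of a quadratic map over an algebraically closed field\<close>

definition conj_related where
  "conj_related f g f' g' \<longleftrightarrow> (\<exists>a b c d. a * d - b * c \<noteq> 0 \<and> f' = conjf a b c d f g \<and> g' = conjg a b c d f g)"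

lemma conj_relatedI: "a * d - b * c \<noteq> 0 \<Longrightarrow> conj_related f g (conjf a b c d f g) (conjg a b c d f g)"
  unfolding conj_related_def by blast

lemma conj_related_refl: "conj_related (f :: 'k :: field \<times> 'k \<times> 'k) g f g"
proof -
  have "conjf 1 0 0 1 f g = f" "conjg 1 0 0 1 f g = g"
    by (cases f; cases g; simp add: conjf_def conjg_def)+
  thus ?thesis using conj_relatedI[of "1 :: 'k" 1 0 0 f g] by simp
qed

lemma conj_related_trans [trans]:
  fixes f g :: "'k :: field \<times> 'k \<times> 'k"
  assumes "conj_related f g f' g'" "conj_related f' g' f'' g''"
  shows "conj_related f g f'' g''"
proof -
  obtain a b c d where 1: "a * d - b * c \<noteq> 0" "f' = conjf a b c d f g" "g' = conjg a b c d f g"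
    using assms(1) unfolding conj_related_def by blast
  obtain a' b' c' d' where 2: "a' * d' - b' * c' \<noteq> 0" "f'' = conjf a' b' c' d' f' g'" "g'' = conjg a' b' c' d' f' g'"
    using assms(2) unfolding conj_related_def by blast
  have "(a * a' + b * c') * (c * b' + d * d') - (a * b' + b * d') * (c * a' + d * c') =
      (a * d - b * c) * (a' * d' - b' * c')"
    by (simp add: algebra_simps)
  hence "(a * a' + b * c') * (c * b' + d * d') - (a * b' + b * d') * (c * a' + d * c') \<noteq> 0"
    using 1(1) 2(1) by simp
  from conj_relatedI[OF this, of f g] show ?thesis
    unfolding 1(2,3) 2(2,3) conj_conj .
qed

lemma conj_related_res:
  fixes f g :: "'k :: field \<times> 'k \<times> 'k"
  assumes "conj_related f g f' g'"
  shows "res f' g' \<noteq> 0 \<longleftrightarrow> res f g \<noteq> 0"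
  using assms unfolding conj_related_def by (auto simp: res_conj)

text \<open>A vanishing last entry of the denominator means that \<infinity> is fixed. Otherwise the
  fixed-point polynomial has degree 3, and the matrix (t, 1; 1, 0) moves its root t to
  \<infinity>.\<close>

lemma conj_related_fix_infty:
  fixes f g :: "'k :: alg_closed_field \<times> 'k \<times> 'k"
  obtains f' g0 g1 where "conj_related f g f' (g0, g1, 0)"
proof -
  obtain f0 f1 f2 where f: "f = (f0, f1, f2)" by (cases f)
  obtain g0 g1 g2 where g: "g = (g0, g1, g2)" by (cases g)
  show ?thesis
  proof (cases "g2 = 0")
    case True
    thus ?thesis using that conj_related_refl[of f g] unfolding g by simp
  next
    case False
    obtain t where "poly [:- f0, g0 - f1, g1 - f2, g2:] t = 0"
      using alg_closed_imp_poly_has_root[of "[:- f0, g0 - f1, g1 - f2, g2:]"] False by auto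
    hence t: "t * (g0 + g1 * t + g2 * t * t) = f0 + f1 * t + f2 * t * t"
      by (simp add: algebra_simps)
    have "conjg t 1 1 0 f g = (- f2 + t * g2, - (f1 + 2 * f2 * t) + t * (g1 + 2 * g2 * t), 0)"
      using t by (simp add: f g conjg_def power2_eq_square algebra_simps)
    moreover have "conj_related f g (conjf t 1 1 0 f g) (conjg t 1 1 0 f g)"
      by (rule conj_relatedI) simp
    ultimately show ?thesis using that by simp
  qed
qed

text \<open>\<open>g1 = 0\<close> means that the fixed point \<infinity> has multiplier 0. Then the
  multipliers of the two finite fixed points add up to 2, so one of them is nonzero, and that fixed
  point is moved to \<infinity>.\<close>

lemma conj_related_simple_infty:
  fixes f :: "'k :: {alg_closed_field, field_char_0} \<times> 'k \<times> 'k"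
  assumes r: "res f (g0, g1, 0) \<noteq> 0"
  obtains f' g0' g1' where "conj_related f (g0, g1, 0) f' (g0', g1', 0)" "g1' \<noteq> 0"
proof (cases "g1 = 0")
  case False
  thus ?thesis using that conj_related_refl by blast
next
  case True
  obtain f0 f1 f2 where f: "f = (f0, f1, f2)" by (cases f)
  have nz: "f2 \<noteq> 0" "g0 \<noteq> 0" using r by (auto simp: f True)
  have "\<exists>x. f2 * x * x + (f1 - g0) * x + f0 = 0 \<and> f1 + 2 * f2 * x \<noteq> 0"
  proof -
    obtain x where "poly [:f0, f1 - g0, f2:] x = 0"
      using alg_closed_imp_poly_has_root[of "[:f0, f1 - g0, f2:]"] nz by auto
    hence x: "f2 * x * x + (f1 - g0) * x + f0 = 0" by (simp add: algebra_simps)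
    show ?thesis
    proof (cases "f1 + 2 * f2 * x = 0")
      case True
      define y where "y = (g0 - f1) / f2 - x"
      have "f2 * (w / f2) = w" for w using nz(1) by simp
      hence fy: "f2 * y = g0 - f1 - f2 * x" unfolding y_def right_diff_distrib by (simp only:)
      have "f2 * y * y + (f1 - g0) * y + f0 = (f2 * y + (f1 - g0)) * y + f0" by (simp add: algebra_simps)
      also have "f2 * y + (f1 - g0) = - (f2 * x)" unfolding fy by simp
      also have "- (f2 * x) * y + f0 = - x * (f2 * y) + f0" by (simp add: mult_ac)
      also have "\<dots> = f2 * x * x + (f1 - g0) * x + f0" unfolding fy by (simp add: algebra_simps)
      finally have "f2 * y * y + (f1 - g0) * y + f0 = 0" using x by simp
      moreover have "f1 + 2 * f2 * y = 2 * g0 - (f1 + 2 * f2 * x)"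
        unfolding mult.assoc fy by (simp add: algebra_simps)
      ultimately show ?thesis using True nz by auto
    qed (use x in blast)
  qed
  then obtain x where x: "f2 * x * x + (f1 - g0) * x + f0 = 0" "f1 + 2 * f2 * x \<noteq> 0" by blast
  have "conjg x 1 1 0 f (g0, g1, 0) = (- f2, - (f1 + 2 * f2 * x), 0)"
    using x(1) by (simp add: f True conjg_def power2_eq_square algebra_simps)
  moreover have "conj_related f (g0, g1, 0) (conjf x 1 1 0 f (g0, g1, 0)) (conjg x 1 1 0 f (g0, g1, 0))"
    by (rule conj_relatedI) simp
  ultimately have rel: "conj_related f (g0, g1, 0) (conjf x 1 1 0 f (g0, g1, 0)) (- f2, - (f1 + 2 * f2 * x), 0)"
    by (simp only:)
  show ?thesis by (rule that[OF rel]) (use x(2) in \<open>simp only: neg_equal_0_iff_equal not_False_eq_True\<close>)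
qed

lemma conj_related_normal_form:
  fixes f g :: "'k :: {alg_closed_field, field_char_0} \<times> 'k \<times> 'k"
  assumes r: "res f g \<noteq> 0"
  obtains k b u where "k \<noteq> 0" "b \<noteq> 0" "conj_related f g (map3 ((*) k) (1, u, 1)) (map3 ((*) k) (0, b, 0))"
proof -
  obtain f' g0' g1' where 1: "conj_related f g f' (g0', g1', 0)" by (rule conj_related_fix_infty)
  have "res f' (g0', g1', 0) \<noteq> 0" by (rule iffD2[OF conj_related_res[OF 1] r])
  then obtain f'' g0 g1 where 2: "conj_related f' (g0', g1', 0) f'' (g0, g1, 0)" "g1 \<noteq> 0"
    by (rule conj_related_simple_infty)
  \<comment> \<open>This translation moves the finite pole to 0.\<close>
  have "conjg 1 (- g0 / g1) 0 1 f'' (g0, g1, 0) = (0, g1, 0)"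
    using 2(2) by (cases f'') (simp add: conjg_def)
  moreover have "conj_related f'' (g0, g1, 0) (conjf 1 (- g0 / g1) 0 1 f'' (g0, g1, 0)) (conjg 1 (- g0 / g1) 0 1 f'' (g0, g1, 0))"
    by (rule conj_relatedI) simp
  moreover obtain f0 f1 f2 where f: "conjf 1 (- g0 / g1) 0 1 f'' (g0, g1, 0) = (f0, f1, f2)"
    by (cases "conjf 1 (- g0 / g1) 0 1 f'' (g0, g1, 0)")
  ultimately have 3: "conj_related f g (f0, f1, f2) (0, g1, 0)"
    using conj_related_trans[OF conj_related_trans[OF 1 2(1)]] by simp
  have "res (f0, f1, f2) (0, g1, 0) \<noteq> 0" by (rule iffD2[OF conj_related_res[OF 3] r])
  hence nz: "f0 \<noteq> 0" "f2 \<noteq> 0" by auto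
  \<comment> \<open>The scaling by t balances the outer coefficients of the numerator, which puts
    the critical points at 1 and -1.\<close>
  obtain t where t: "t\<^sup>2 = f0 / f2" using nth_root_exists[of 2 "f0 / f2"] by auto
  have t0: "t \<noteq> 0" using t nz by auto
  have tt: "t * t = f0 / f2" using t by (simp add: power2_eq_square)
  have "conjf t 0 0 1 (f0, f1, f2) (0, g1, 0) = map3 ((*) f0) (1, f1 * t / f0, 1)"
    using nz by (simp add: conjf_def t)
  moreover have "conjg t 0 0 1 (f0, f1, f2) (0, g1, 0) = map3 ((*) f0) (0, g1 / f2, 0)"
    using nz tt by (simp add: conjg_def mult.left_commute[of t])
  moreover have "conj_related (f0, f1, f2) (0, g1, 0) (conjf t 0 0 1 (f0, f1, f2) (0, g1, 0)) (conjg t 0 0 1 (f0, f1, f2) (0, g1, 0))"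
    by (rule conj_relatedI) (simp add: t0)
  ultimately have "conj_related f g (map3 ((*) f0) (1, f1 * t / f0, 1)) (map3 ((*) f0) (0, g1 / f2, 0))"
    using conj_related_trans[OF 3] by simp
  moreover have "g1 / f2 \<noteq> 0" using nz 2(2) by simp
  ultimately show ?thesis using nz(1) by (intro that)
qed

subsection \<open>Periodic critical points\<close>

definition has_periodic_critical_point :: "nat \<Rightarrow> 'k :: field poly fract \<Rightarrow> bool" where
  "has_periodic_critical_point n \<phi> \<longleftrightarrow> (\<exists>P. critical_point \<phi> P \<and> n_periodic n \<phi> P)"

lemma n_periodic_semiconj:
  assumes "\<And>P. h (rf_map \<psi> P) = rf_map \<phi> (h P)" "inj h"
  shows "n_periodic n \<phi> (h P) \<longleftrightarrow> n_periodic n \<psi> P"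
proof -
  have "(rf_map \<phi> ^^ k) (h P) = h ((rf_map \<psi> ^^ k) P)" for k
    by (induction k) (simp_all add: assms(1))
  thus ?thesis unfolding n_periodic_def by (simp add: inj_eq[OF assms(2)])
qed

lemma has_periodic_critical_point_conj:
  fixes f g :: "'k :: field_gcd \<times> 'k \<times> 'k"
  assumes r: "res f g \<noteq> 0" and rel: "conj_related f g f' g'"
  shows "has_periodic_critical_point n (rf_q f g) \<longleftrightarrow> has_periodic_critical_point n (rf_q f' g')"
proof -
  obtain a b c d where det: "a * d - b * c \<noteq> 0" and f': "f' = conjf a b c d f g" and g': "g' = conjg a b c d f g"
    using rel unfolding conj_related_def by blast
  have r': "res f' g' \<noteq> 0" using conj_related_res[OF rel] r by blast
  define D where "D = a * d - b * c"
  have D: "D \<noteq> 0" using det by (simp add: D_def)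
  define h where "h P = proj (a * lx P + b * ly P) (c * lx P + d * ly P)" for P
  have inverse: "d * (a * x + b * y) - b * (c * x + d * y) = D * x" "a * (c * x + d * y) - c * (a * x + b * y) = D * y" for x y
    by (simp_all add: D_def algebra_simps)
  have nz: "a * x + b * y \<noteq> 0 \<or> c * x + d * y \<noteq> 0" if "x \<noteq> 0 \<or> y \<noteq> 0" for x y
    using inverse[of x y] that D by auto
  have h_proj: "h (proj x y) = proj (a * x + b * y) (c * x + d * y)" if xy: "x \<noteq> 0 \<or> y \<noteq> 0" for x y
  proof -
    obtain e where e: "e \<noteq> 0" "lx (proj x y) = e * x" "ly (proj x y) = e * y" by (rule lift_proj[OF xy])
    have "h (proj x y) = proj (e * (a * x + b * y)) (e * (c * x + d * y))"
      unfolding h_def e by (simp add: algebra_simps)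
    thus ?thesis by (simp only: proj_scale[OF e(1)])
  qed
  have inj: "inj h"
  proof (rule injI)
    fix P Q assume "h P = h Q"
    hence "(a * lx P + b * ly P) * (c * lx Q + d * ly Q) = (a * lx Q + b * ly Q) * (c * lx P + d * ly P)"
      unfolding h_def by (simp only: proj_eq_iff[OF nz[OF lift_nonzero] nz[OF lift_nonzero]])
    hence "D * (lx P * ly Q - lx Q * ly P) = 0" by (simp add: D_def algebra_simps)
    hence "lx P * ly Q = lx Q * ly P" using D by simp
    hence "proj (lx P) (ly P) = proj (lx Q) (ly Q)" by (simp only: proj_eq_iff[OF lift_nonzero lift_nonzero])
    thus "P = Q" by simp
  qed
  have semi: "h (rf_map (rf_q f' g') P) = rf_map (rf_q f g) (h P)" for P
  proof -
    let ?x = "a * lx P + b * ly P" and ?y = "c * lx P + d * ly P"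
    have "h (rf_map (rf_q f' g') P) = proj (a * qf f' (lx P) (ly P) + b * qf g' (lx P) (ly P))
        (c * qf f' (lx P) (ly P) + d * qf g' (lx P) (ly P))"
      unfolding rf_map_q[OF r'] by (rule h_proj[OF qmap_nonzero[OF r' lift_nonzero]])
    also have "\<dots> = proj (D * qf f ?x ?y) (D * qf g ?x ?y)"
    proof -
      have "a * (d * F - b * G) + b * (a * G - c * F) = D * F" "c * (d * F - b * G) + d * (a * G - c * F) = D * G" for F G
        by (simp_all add: D_def algebra_simps)
      thus ?thesis unfolding f' g' qf_conj by (simp only:)
    qed
    also have "\<dots> = proj (qf f ?x ?y) (qf g ?x ?y)" by (rule proj_scale[OF D])
    also have "\<dots> = rf_map (rf_q f g) (h P)"
      unfolding h_def by (rule rf_map_proj[OF r nz[OF lift_nonzero], symmetric])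
    finally show ?thesis .
  qed
  have crit: "critical_point (rf_q f g) (h P) \<longleftrightarrow> critical_point (rf_q f' g') P" for P
  proof -
    obtain e where e: "e \<noteq> 0" "lx (h P) = e * (a * lx P + b * ly P)" "ly (h P) = e * (c * lx P + d * ly P)"
      unfolding h_def by (rule lift_proj[OF nz[OF lift_nonzero]])
    show ?thesis unfolding critical_point_q[OF r] critical_point_q[OF r'] e jac_scale
      unfolding f' g' jac_conj using e(1) det by simp
  qed
  have surj: "\<exists>Q. P = h Q" for P
  proof -
    have nz': "d * lx P - b * ly P \<noteq> 0 \<or> a * ly P - c * lx P \<noteq> 0"
    proof (rule ccontr)
      assume "\<not> ?thesis"
      hence 0: "d * lx P - b * ly P = 0" "a * ly P - c * lx P = 0" by simp_all
      have "D * lx P = a * (d * lx P - b * ly P) + b * (a * ly P - c * lx P)"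
        "D * ly P = c * (d * lx P - b * ly P) + d * (a * ly P - c * lx P)"
        by (simp_all add: D_def algebra_simps)
      thus False unfolding 0 using D lift_nonzero[of P] by simp
    qed
    have "h (proj (d * lx P - b * ly P) (a * ly P - c * lx P)) = proj (D * lx P) (D * ly P)"
      unfolding h_proj[OF nz'] by (simp add: D_def algebra_simps)
    also have "\<dots> = P" by (simp add: proj_scale[OF D])
    finally show ?thesis by metis
  qed
  show ?thesis unfolding has_periodic_critical_point_def
    using n_periodic_semiconj[where h = h, OF semi inj] crit surj by metis
qed

lemma res_nf: "res (1, u, 1) (0, b, 0) = (b :: 'k :: comm_ring_1)\<^sup>2"
  by (simp add: power2_eq_square)

lemma n_periodic_proj_iff:
  fixes f g :: "'k :: field_gcd \<times> 'k \<times> 'k"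
  assumes r: "res f g \<noteq> 0" and nz: "x \<noteq> 0 \<or> y \<noteq> 0"
  shows "n_periodic n (rf_q f g) (proj x y) \<longleftrightarrow>
    n > 0 \<and> per_form f g n x y = 0 \<and> (\<forall>m. 0 < m \<and> m < n \<longrightarrow> per_form f g m x y \<noteq> 0)"
proof -
  have "(rf_map (rf_q f g) ^^ d) (proj x y) = proj x y \<longleftrightarrow> per_form f g d x y = 0" for d
    unfolding rf_map_iter[OF r nz] proj_eq_iff[OF qit_nonzero[OF r nz] nz]
    by (auto simp: per_form_def mult.commute)
  thus ?thesis unfolding n_periodic_def by simp
qed

lemma has_periodic_critical_point_nf:
  fixes b u :: "'k :: {field_gcd, field_char_0}"
  assumes n: "n > 0" and A: "asq_quotient n A" and b: "b \<noteq> 0"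
  shows "has_periodic_critical_point n (rf_q (1, u, 1) (0, b, 0)) \<longleftrightarrow> eval2 A b u = 0 \<or> eval2 A b (- u) = 0"
proof -
  let ?\<phi> = "rf_q (1, u, 1) (0, b, 0)"
  have r: "res (1, u, 1) (0, b, 0) \<noteq> 0" using b by (simp add: res_nf)
  have crit: "critical_point ?\<phi> P \<longleftrightarrow> P = proj 1 1 \<or> P = proj (- 1) 1" for P
  proof (cases P)
    case (Fin a)
    have "critical_point ?\<phi> P \<longleftrightarrow> b * (a\<^sup>2 - 1) = 0"
      unfolding critical_point_q[OF r] by (simp add: Fin jac_def power2_eq_square algebra_simps)
    also have "\<dots> \<longleftrightarrow> a = 1 \<or> a = - 1" using b by (simp add: power2_eq_1_iff)
    finally show ?thesis by (simp add: Fin proj_def)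
  next
    case Infty
    thus ?thesis using b unfolding critical_point_q[OF r] by (simp add: jac_def proj_def)
  qed
  have per: "n_periodic n ?\<phi> (proj 1 1) \<longleftrightarrow> eval2 A b u = 0"
    "n_periodic n ?\<phi> (proj (- 1) 1) \<longleftrightarrow> eval2 A b (- u) = 0"
    using n by (auto simp: n_periodic_proj_iff[OF r] per_form_nit asq_quotient_zero_iff[OF n A b])
  show ?thesis unfolding has_periodic_critical_point_def crit using per by blast
qed

theorem proposition2p2:
  fixes n :: nat
  assumes "n > 0"
  shows "U_defined n phi_rs \<and>
    (\<exists>F :: int poly poly.
       U n phi_rs = eval2 F r_var s_var \<and>
       moduli_coords ` C n = {(a, b). eval2 F a b = 0})"
proof -
  obtain A where A: "asq_quotient n A" by (rule asq_quotient_ex[OF assms])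
  obtain F k k' where F: "U n phi_rs = eval2 F r_var s_var"
    "\<And>r s b u :: rat alg_closure. poly (chi r s) b = 0 \<Longrightarrow> u\<^sup>2 = 4 - 2 * b - (r - b) * b \<Longrightarrow>
       eval2 F r s * b ^ k = eval2 A b u * eval2 A b (- u) * b ^ k'"
    by (rule U_integral[OF assms A, of thesis]) (use [[show_types]] in blast)
  \<comment> \<open>The powers of b cancel, and the two factors on the right belong to the critical
    points 1 and -1 of the normal form.\<close>
  have zero_iff: "eval2 F (r_of b u) (s_of b u) = 0 \<longleftrightarrow>
      has_periodic_critical_point n (rf_q (1, u, 1) (0, b, 0))"
    if b: "b \<noteq> 0" for b u :: "rat alg_closure"
    using F(2)[OF chi_of_params[OF b], of u] b
    by (simp add: has_periodic_critical_point_nf[OF assms A b]) (metis mult_eq_0_iff power_not_zero)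
  have "moduli_coords ` C n = {(a, b). eval2 F a b = 0}"
  proof (intro equalityI subsetI)
    fix z assume "z \<in> moduli_coords ` C n"
    then obtain \<phi> where \<phi>: "z = moduli_coords (conj_class \<phi>)" "rf_degree \<phi> = 2" "has_periodic_critical_point n \<phi>"
      unfolding C_def has_periodic_critical_point_def by blast
    obtain f g where fg: "\<phi> = rf_q f g" "res f g \<noteq> 0" by (rule rf_degree_2_rep[OF \<phi>(2)])
    obtain k b u where nf: "k \<noteq> 0" "b \<noteq> 0"
      "conj_related f g (map3 ((*) k) (1, u, 1)) (map3 ((*) k) (0, b, 0))"
      by (rule conj_related_normal_form[OF fg(2)])
    obtain m1 m2 m3 where m: "fixed_multipliers (1, u, 1) (0, b, 0) m1 m2 m3"
      "m1 + m2 + m3 = r_of b u" "m1 * m2 + m1 * m3 + m2 * m3 = s_of b u"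
      by (rule fixed_multipliers_nf[OF nf(2)])
    have "fixed_multipliers f g m1 m2 m3"
      using nf(3) fixed_multipliers_scale[OF nf(1) m(1)] fixed_multipliers_conjD
      unfolding conj_related_def by metis
    hence "z = (r_of b u, s_of b u)" unfolding \<phi>(1) fg(1) moduli_coords_q[OF fg(2)] m(2,3)[symmetric]
      by (simp add: moduli_coords_q[OF fg(2)])
    moreover have "has_periodic_critical_point n (rf_q (1, u, 1) (0, b, 0))"
      using \<phi>(3) has_periodic_critical_point_conj[OF fg(2) nf(3), of n] unfolding fg(1) rf_q_scale[OF nf(1)] by blast
    ultimately show "z \<in> {(a, b). eval2 F a b = 0}" using zero_iff[OF nf(2)] by simp
  next
    fix z assume "z \<in> {(a, b). eval2 F a b = (0 :: rat alg_closure)}"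
    then obtain r s where z: "z = (r, s)" "eval2 F r s = 0" by auto
    \<comment> \<open>The roots of the cubic multiply to r - 2, so 0 is a root only for r = 2; then
      the other two roots have sum 2 and are not both 0.\<close>
    obtain b where b: "b \<noteq> 0" "poly (chi r s) b = 0"
    proof (cases "r = 2")
      case False
      obtain b where "poly (chi r s) b = 0"
        using alg_closed_imp_poly_has_root[of "chi r s"] by auto
      moreover have "b \<noteq> 0" using calculation False by (auto simp: poly_chi)
      ultimately show ?thesis by (rule that[rotated])
    next
      case True
      obtain b where b: "poly [:s, - 2, 1:] b = 0"
        using alg_closed_imp_poly_has_root[of "[:s, - 2, 1:]"] by auto
      hence s: "s = 2 * b - b\<^sup>2" by (simp add: power2_eq_square algebra_simps)
      show ?thesis
      proof (cases "b = 0")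
        case True
        thus ?thesis using that[of 2] \<open>r = 2\<close> s by (simp add: poly_chi power3_eq_cube)
      next
        case False
        thus ?thesis using that[of b] \<open>r = 2\<close> s by (simp add: poly_chi power2_eq_square power3_eq_cube algebra_simps)
      qed
    qed
    obtain u where u: "u\<^sup>2 = 4 - 2 * b - (r - b) * b" by (rule disc_sqrt_exists)
    note rs = chi_root_params[OF b u]
    let ?\<phi> = "rf_q (1, u, 1) (0, b, 0)"
    have res: "res (1, u, 1) (0, b, 0) \<noteq> 0" using b by (simp add: res_nf)
    obtain m1 m2 m3 where m: "fixed_multipliers (1, u, 1) (0, b, 0) m1 m2 m3"
      "m1 + m2 + m3 = r_of b u" "m1 * m2 + m1 * m3 + m2 * m3 = s_of b u"
      by (rule fixed_multipliers_nf[OF b(1)])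
    have "z = moduli_coords (conj_class ?\<phi>)"
      unfolding moduli_coords_q[OF res m(1)] m z using rs by simp
    moreover have "conj_class ?\<phi> \<in> C n"
      using rf_degree_q[OF res] zero_iff[OF b(1), of u] z(2) rs
      unfolding C_def M2_def has_periodic_critical_point_def by blast
    ultimately show "z \<in> moduli_coords ` C n" by blast
  qed
  thus ?thesis using U_defined_phi_rs[OF assms] F(1) by blast
qed

end
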